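(* Let $V$ be an admissible potential, $H=-\Delta+V$, and let $\mu_S$ be a multiplicity two $L^2_{\mathbf M}$-eigenvalue of $H$ with orthonormal eigenfunctions $\Phi_1\in L^2_{\mathbf M,+i}$ and $\Phi_2(\mathbf x)=\overline{\Phi_1(-\mathbf x)}\in L^2_{\mathbf M,-i}$. For amplitudes $C_1,C_2$ depending on slow variables, set $$\psi_0=\sum_{q=1}^2C_q\,\Phi_q(\mathbf x),\qquad \psi_1=2\,\mathscr R(\mu_S)\sum_{q=1}^2\nabla_{\mathbf X_1}C_q\cdot\nabla_{\mathbf x}\Phi_q(\mathbf x),$$ and consider the problem for $\psi_2=\psi_2(\mathbf x;\mathbf X_1,\mathbf X_2,T_2)$, with the slow variables $\mathbf X_1,\mathbf X_2\in\mathbb R^2$, $T_2\in\mathbb R$ regarded as frozen parameters: $$(\mu_S-H)\psi_2=-(i\partial_{T_2}+2\nabla_{\mathbf x}\cdot\nabla_{\mathbf X_2}+\Delta_{\mathbf X_1})\psi_0-2\nabla_{\mathbf x}\cdot\nabla_{\mathbf X_1}\psi_1,\qquad \psi_2(\mathbf x+\mathbf v;\cdot)=e^{i\mathbf M\cdot\mathbf v}\psi_2(\mathbf x;\cdot)\quad(\mathbf v\in\mathbb Z^2).$$ A sufficient condition for the solvability of this problem is that the pair of (smooth) amplitudes $C_1=C_1(\mathbf X_1,T_2)$ and $C_2=C_2(\mathbf X_1,T_2)$ satisfy the coupled system of constant coefficient Schrödinger equations $$i\partial_{T_2}C_p=-\Delta_{\mathbf X_1}C_p+4\sum_{q=1}^2\sum_{r,s=1}^2a^{p,q}_{r,s}\frac{\partial^2C_q}{\partial(X_1)_r\,\partial(X_1)_s},\qquad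 p=1,2,$$ where $a^{p,q}_{r,s}=\langle\partial_{x_r}\Phi_p,\mathscr R(\mu_S)\partial_{x_s}\Phi_q\rangle$.
   Context: $\Lambda=\mathbb Z^2$, $\mathbf M=(\pi,\pi)^T$. $L^2_{\mathbf M}=\{f\in L^2_{\rm loc}(\mathbb R^2): e^{-i\mathbf M\cdot\mathbf x}f(\mathbf x)\text{ is }\Lambda\text{-periodic}\}$ with inner product $\langle f,g\rangle=\int_{[0,1]^2}\overline f g$. $R=\begin{pmatrix}0&1\\-1&0\end{pmatrix}$, so $R^*(x_1,x_2)=(-x_2,x_1)$, and $\mathcal R[f](\mathbf x)=f(R^*\mathbf x)$. $L^2_{\mathbf M,\sigma}=\{f\in L^2_{\mathbf M}:\mathcal R[f]=\sigma f\}$ for $\sigma\in\{\pm1,\pm i\}$. A potential $V$ is admissible if it is $C^\infty$ on $\mathbb R^2$, $\Lambda$-periodic, real-valued, even, and $V(R^*\mathbf x)=V(\mathbf x)$. $\mathscr R(\mu_S)=(H-\mu_SI)^{-1}$ denotes the bounded inverse of $H-\mu_SI$ on the orthogonal complement in $L^2_{\mathbf M}$ of $\mathrm{span}\{\Phi_1,\Phi_2\}$ (precomposed with orthogonal projection onto that complement). Here $\nabla_{\mathbf X_j}$ and $\Delta_{\mathbf X_1}$ act on the slow variables $\mathbf X_j=((X_j)_1,(X_j)_2)$, treated as independent of $\mathbf x$. The problem is the order-$\delta^2$ equation in a multiple-scale expansion $e^{-i\mu_St}(\psi_0+\delta\psi_1+\delta^2\psi_2+\cdots)$ of solutions of $i\partial_t\psi=H\psi$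 with $\mathbf X_j=\delta^j\mathbf x$, $T_2=\delta^2t$. *)

theory Defs
  imports "HOL-Analysis.Analysis"
begin

section \<open>Classical derivatives and smoothness\<close>

definition pd :: "'n::finite \<Rightarrow> (real^'n \<Rightarrow> 'b::real_normed_vector) \<Rightarrow> real^'n \<Rightarrow> 'b" where
  "pd r f x = frechet_derivative f (at x) (axis r 1)"

primrec C_diff :: "nat \<Rightarrow> ('a::euclidean_space \<Rightarrow> 'b::real_normed_vector) \<Rightarrow> bool" where
  "C_diff 0 f \<longleftrightarrow> continuous_on UNIV f"
| "C_diff (Suc k) f \<longleftrightarrow>
     (\<forall>x. f differentiable (at x)) \<and> (\<forall>b\<in>Basis. C_diff k (\<lambda>x. frechet_derivative f (at x) b))"

definition smooth :: "('a::euclidean_space \<Rightarrow> 'b::real_normed_vector) \<Rightarrow> bool" where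
  "smooth f \<longleftrightarrow> (\<forall>k. C_diff k f)"

section \<open>Lattice, quasi-momentum, rotation and admissible potentials\<close>

definition Lattice :: "(real^2) set" ("\<Lambda>") where
  "\<Lambda> = {v. \<forall>i. v $ i \<in> \<int>}"

definition M_point :: "real^2" ("\<^bold>M") where
  "\<^bold>M = vector [pi, pi]"

definition rot_matrix :: "real^2^2" where
  "rot_matrix = vector [vector [0, 1], vector [-1, 0]]"

definition Rstar :: "real^2 \<Rightarrow> real^2" where
  "Rstar x = transpose rot_matrix *v x"

lemma Rstar_eq: "Rstar x = vector [- (x $ 2), x $ 1]"
  by (simp add: Rstar_def rot_matrix_def transpose_def matrix_vector_mult_def vec_eq_iff
      forall_2 sum_2 vector_2)

definition rotate :: "(real^2 \<Rightarrow> 'a) \<Rightarrow> real^2 \<Rightarrow> 'a" where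
  "rotate f x = f (Rstar x)"

definition admissible :: "(real^2 \<Rightarrow> real) \<Rightarrow> bool" where
  "admissible V \<longleftrightarrow> smooth V \<and> (\<forall>x. \<forall>v\<in>\<Lambda>. V (x + v) = V x) \<and>
     (\<forall>x. V (- x) = V x) \<and> (\<forall>x. V (Rstar x) = V x)"

section \<open>The pseudo-periodic Hilbert space and its rotational subspaces\<close>

text \<open>Elements of $L^2$-type spaces are represented by functions; all identities between such
  elements are understood almost everywhere.\<close>

definition L2_loc :: "(real^2 \<Rightarrow> complex) set" where
  "L2_loc = {f. f \<in> borel_measurable lebesgue \<and>
     (\<forall>K. compact K \<longrightarrow> set_integrable lebesgue K (\<lambda>x. (norm (f x))\<^sup>2))}"

definition L2_M :: "(real^2 \<Rightarrow> complex) set" where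
  "L2_M = {f \<in> L2_loc. \<forall>v\<in>\<Lambda>. AE x in lebesgue.
     exp (- (\<i> * of_real (\<^bold>M \<bullet> (x + v)))) * f (x + v) = exp (- (\<i> * of_real (\<^bold>M \<bullet> x))) * f x}"

definition inner_M :: "(real^2 \<Rightarrow> complex) \<Rightarrow> (real^2 \<Rightarrow> complex) \<Rightarrow> complex" where
  "inner_M f g = (LINT x:cbox 0 1|lebesgue. cnj (f x) * g x)"

definition L2_M_rot :: "complex \<Rightarrow> (real^2 \<Rightarrow> complex) set" where
  "L2_M_rot \<sigma> = {f \<in> L2_M. AE x in lebesgue. rotate f x = \<sigma> * f x}"

section \<open>Weak derivatives and the Hamiltonian\<close>

text \<open>Weak derivatives are tested against smooth pseudo-periodic functions over one period
  cell; the boundary terms cancel. By periodization of compactly supported test functions this is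
  the distributional derivative on the plane.\<close>

definition weak_pd :: "2 \<Rightarrow> (real^2 \<Rightarrow> complex) \<Rightarrow> (real^2 \<Rightarrow> complex) \<Rightarrow> bool" where
  "weak_pd r f g \<longleftrightarrow> f \<in> L2_M \<and> g \<in> L2_M \<and>
     (\<forall>\<phi>\<in>L2_M. smooth \<phi> \<longrightarrow> inner_M (pd r \<phi>) f = - inner_M \<phi> g)"

text \<open>A representative of the weak derivative, which is unique up to null sets.\<close>

definition wpd :: "2 \<Rightarrow> (real^2 \<Rightarrow> complex) \<Rightarrow> real^2 \<Rightarrow> complex" where
  "wpd r f = (SOME g. weak_pd r f g)"

definition H2_M :: "(real^2 \<Rightarrow> complex) set" where
  "H2_M = {f \<in> L2_M. (\<forall>r. \<exists>g. weak_pd r f g) \<and> (\<forall>r s. \<exists>g. weak_pd s (wpd r f) g)}"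

text \<open>$H = -\Delta + V$ as an operator on \<open>L2_M\<close> with domain \<open>H2_M\<close>.\<close>

definition hamiltonian :: "(real^2 \<Rightarrow> real) \<Rightarrow> (real^2 \<Rightarrow> complex) \<Rightarrow> real^2 \<Rightarrow> complex" where
  "hamiltonian V f x = - (\<Sum>r\<in>UNIV. wpd r (wpd r f) x) + of_real (V x) * f x"

definition eigenspace_M :: "(real^2 \<Rightarrow> real) \<Rightarrow> real \<Rightarrow> (real^2 \<Rightarrow> complex) set" where
  "eigenspace_M V \<mu> = {f \<in> H2_M. AE x in lebesgue. hamiltonian V f x = of_real \<mu> * f x}"

text \<open>The eigenspace has complex dimension \<open>n > 0\<close>, modulo almost everywhere equality.\<close>

definition eigenvalue_of_multiplicity :: "(real^2 \<Rightarrow> real) \<Rightarrow> real \<Rightarrow> nat \<Rightarrow> bool" where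
  "eigenvalue_of_multiplicity V \<mu> n \<longleftrightarrow> n > 0 \<and>
     (\<exists>b :: nat \<Rightarrow> real^2 \<Rightarrow> complex.
        (\<forall>i<n. b i \<in> eigenspace_M V \<mu>) \<and>
        (\<forall>c :: nat \<Rightarrow> complex. (AE x in lebesgue. (\<Sum>i<n. c i * b i x) = 0) \<longrightarrow> (\<forall>i<n. c i = 0)) \<and>
        (\<forall>f\<in>eigenspace_M V \<mu>. \<exists>c :: nat \<Rightarrow> complex. AE x in lebesgue. f x = (\<Sum>i<n. c i * b i x)))"

text \<open>The inverse of $H - \mu$ on the orthogonal complement of the span of the orthonormal pair
  \<open>\<Phi>\<close>, precomposed with the orthogonal projection onto that complement. Elements of \<open>H2_M\<close> have
  a unique continuous representative (Sobolev embedding in dimension two); choosing that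
  representative makes the operator linear pointwise, so that values of the resolvent
  depending on parameters can be differentiated pointwise in these parameters.\<close>

definition resolvent ::
  "(real^2 \<Rightarrow> real) \<Rightarrow> real \<Rightarrow> (2 \<Rightarrow> real^2 \<Rightarrow> complex) \<Rightarrow> (real^2 \<Rightarrow> complex) \<Rightarrow> real^2 \<Rightarrow> complex" where
  "resolvent V \<mu> \<Phi> f = (THE u. continuous_on UNIV u \<and> u \<in> H2_M \<and> (\<forall>p. inner_M (\<Phi> p) u = 0) \<and>
     (AE x in lebesgue. hamiltonian V u x - of_real \<mu> * u x
        = f x - (\<Sum>p\<in>UNIV. inner_M (\<Phi> p) f * \<Phi> p x)))"

section \<open>Multiple-scale expansion\<close>

text \<open>Amplitudes have arguments \<open>X1 X2 T2\<close>; the terms of the expansion have arguments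
  \<open>x X1 X2 T2\<close>. The index type \<open>2\<close> has the elements \<open>1\<close> and \<open>2\<close>.\<close>

type_synonym amplitude = "real^2 \<Rightarrow> real^2 \<Rightarrow> real \<Rightarrow> complex"

definition psi0 :: "(2 \<Rightarrow> real^2 \<Rightarrow> complex) \<Rightarrow> (2 \<Rightarrow> amplitude) \<Rightarrow> real^2 \<Rightarrow> amplitude" where
  "psi0 \<Phi> C x X1 X2 T2 = (\<Sum>q\<in>UNIV. C q X1 X2 T2 * \<Phi> q x)"

definition psi1 :: "(real^2 \<Rightarrow> real) \<Rightarrow> real \<Rightarrow> (2 \<Rightarrow> real^2 \<Rightarrow> complex) \<Rightarrow> (2 \<Rightarrow> amplitude)
    \<Rightarrow> real^2 \<Rightarrow> amplitude" where
  "psi1 V \<mu> \<Phi> C x X1 X2 T2 = 2 * resolvent V \<mu> \<Phi>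
     (\<lambda>y. \<Sum>q\<in>UNIV. \<Sum>s\<in>UNIV. pd s (\<lambda>X. C q X X2 T2) X1 * wpd s (\<Phi> q) y) x"

text \<open>The right-hand side
  $-(i\partial_{T_2}+2\nabla_x\cdot\nabla_{X_2}+\Delta_{X_1})\psi_0-2\nabla_x\cdot\nabla_{X_1}\psi_1$.\<close>

definition rhs2 :: "(real^2 \<Rightarrow> amplitude) \<Rightarrow> (real^2 \<Rightarrow> amplitude)
    \<Rightarrow> real^2 \<Rightarrow> amplitude" where
  "rhs2 \<psi>0 \<psi>1 x X1 X2 T2 =
     - (\<i> * vector_derivative (\<lambda>T. \<psi>0 x X1 X2 T) (at T2)
        + 2 * (\<Sum>r\<in>UNIV. wpd r (\<lambda>y. pd r (\<lambda>X. \<psi>0 y X1 X T2) X2) x)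
        + (\<Sum>r\<in>UNIV. pd r (pd r (\<lambda>X. \<psi>0 x X X2 T2)) X1))
     - 2 * (\<Sum>r\<in>UNIV. wpd r (\<lambda>y. pd r (\<lambda>X. \<psi>1 y X X2 T2) X1) x)"

definition a_coeff :: "(real^2 \<Rightarrow> real) \<Rightarrow> real \<Rightarrow> (2 \<Rightarrow> real^2 \<Rightarrow> complex)
    \<Rightarrow> 2 \<Rightarrow> 2 \<Rightarrow> 2 \<Rightarrow> 2 \<Rightarrow> complex" where
  "a_coeff V \<mu> \<Phi> p q r s = inner_M (wpd r (\<Phi> p)) (resolvent V \<mu> \<Phi> (wpd s (\<Phi> q)))"

text \<open>Solvability of $(\mu-H)\psi_2 = F$ with pseudo-periodic boundary conditions,
  for every value of the frozen slow variables.\<close>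

definition solvable2 :: "(real^2 \<Rightarrow> real) \<Rightarrow> real \<Rightarrow> (real^2 \<Rightarrow> amplitude) \<Rightarrow> bool" where
  "solvable2 V \<mu> F \<longleftrightarrow> (\<exists>\<psi>2 :: real^2 \<Rightarrow> amplitude. \<forall>X1 X2 T2.
     (\<lambda>x. \<psi>2 x X1 X2 T2) \<in> H2_M \<and>
     (AE x in lebesgue. of_real \<mu> * \<psi>2 x X1 X2 T2 - hamiltonian V (\<lambda>y. \<psi>2 y X1 X2 T2) x
        = F x X1 X2 T2) \<and>
     (\<forall>x. \<forall>v\<in>\<Lambda>. \<psi>2 (x + v) X1 X2 T2 = exp (\<i> * of_real (\<^bold>M \<bullet> v)) * \<psi>2 x X1 X2 T2))"

end

(* Fourier expansion in the characters exp (i (M + 2 pi k) . x) identifies L2_M with l^2 over Z^2,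
   turns weak derivatives into multipliers and H2_M into a weighted l^2 space that embeds into l^1;
   multiplication by the smooth potential is a convolution with an l^1 kernel. A shift of finitely
   many modes makes H - mu invertible by a contraction argument, which reduces the Fredholm
   alternative to a finite Hermitian linear system. Hence the problem for psi_2 is solvable as soon
   as its right-hand side is orthogonal to Phi_1 and Phi_2. Integration by parts moves the outer
   derivative of psi_1 onto Phi_p and produces the coefficients a^{p,q}_{r,s}, so the two
   orthogonality conditions are the amplitude equations. *)
theory Submission imports Defs begin

section \<open>The space of pseudo-periodic functions\<close>

text \<open>Two obstacles shape the details. First, \<open>wpd\<close> is an arbitrary choice within
  an almost-everywhere class, so its linearity holds only up to null sets; identities are therefore
  proved for Fourier coefficients, where they are exact. Second, the slow derivatives act at fixed x
  on values of \<open>resolvent\<close>, so this operator has to be linear at every point. That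
  follows from uniqueness of its continuous representative, and it turns \<open>psi1\<close> into a
  finite sum of slow coefficients times the fixed functions \<open>res_grad q s\<close>; a
  derivative in X1 then falls on the amplitudes alone. The components of M + 2 pi k are odd
  multiples of pi, so the symbol of the Laplacian vanishes nowhere and no zero mode needs separate
  care. The shifted operator is inverted in the sup norm of coefficient sequences, where an l1 bound
  on the coefficients of the potential is all that a contraction needs. The sign and the constant of
  the system arise as follows: the factor 2 of \<open>psi1\<close> and the factor 2 of the equation
  give 4, and the minus sign from integration by parts cancels the one in front of the last term of
  the right-hand side.\<close>

abbreviation cell :: "(real^2) measure" where
  "cell \<equiv> lebesgue_on (cbox 0 1)"

lemma AE_cell_iff: "(AE x in cell. P x) \<longleftrightarrow> (AE x in lebesgue. x \<in> cbox 0 1 \<longrightarrow> P x)"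
  by (subst AE_restrict_space_iff) auto

lemma AE_cellI: "(AE x in lebesgue. P x) \<Longrightarrow> AE x in cell. P x"
  by (auto simp: AE_cell_iff)

section \<open>Translation invariance of Lebesgue measure\<close>

lemma AE_lebesgue_translate:
  fixes v :: "'a::euclidean_space"
  assumes "AE x in lebesgue. P x"
  shows "AE x in lebesgue. P (x + v)"
proof -
  obtain N where N: "{x \<in> space lebesgue. \<not> P x} \<subseteq> N" "N \<in> null_sets lebesgue"
    using assms by (auto simp: eventually_ae_filter)
  have "{x. \<not> P (x + v)} \<subseteq> (+) (- v) ` N"
  proof
    fix x assume "x \<in> {x. \<not> P (x + v)}"
    then have "x + v \<in> N" using N(1) by auto
    then show "x \<in> (+) (- v) ` N" by (rule_tac image_eqI[of _ _ "x + v"]) auto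
  qed
  then show ?thesis
    using negligible_translation[of N "-v"] N(2)
    by (intro AE_I'[of "(+) (- v) ` N"]) (auto simp: negligible_iff_null_sets)
qed

text \<open>A translation is the affine map of \<open>lebesgue_affine_euclidean\<close> with all
  scaling factors 1, whose density is then 1.\<close>

lemma lebesgue_distr_translate:
  fixes v :: "'a::euclidean_space"
  shows "(\<lambda>x. x + v) \<in> lebesgue \<rightarrow>\<^sub>M lebesgue" "distr lebesgue lebesgue (\<lambda>x. x + v) = lebesgue"
proof -
  have eq: "(\<lambda>x. v + (\<Sum>j\<in>Basis. (1 * (x \<bullet> j)) *\<^sub>R j)) = (\<lambda>x::'a. x + v)"
    by (simp add: euclidean_representation add.commute)
  show "(\<lambda>x. x + v) \<in> lebesgue \<rightarrow>\<^sub>M lebesgue"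
    using lebesgue_affine_measurable[of "\<lambda>_. 1" v] by (simp only: eq)
  have "lebesgue = density (distr lebesgue lebesgue (\<lambda>x. x + v)) (\<lambda>_. \<Prod>j\<in>(Basis::'a set). \<bar>1::real\<bar>)"
    using lebesgue_affine_euclidean[of "\<lambda>_. 1" v] by (simp only: eq)
  then show "distr lebesgue lebesgue (\<lambda>x. x + v) = lebesgue"
    by (simp add: density_1)
qed

lemma set_integrable_translate:
  fixes h :: "'a::euclidean_space \<Rightarrow> 'b::{banach,second_countable_topology}"
  assumes "set_integrable lebesgue S h"
  shows "set_integrable lebesgue ((+) v ` S) (\<lambda>x. h (x - v))"
proof -
  have "integrable (distr lebesgue lebesgue (\<lambda>x. x + (-v))) (\<lambda>x. indicator S x *\<^sub>R h x)"
    using assms by (simp only: set_integrable_def lebesgue_distr_translate(2))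
  then have "integrable lebesgue (\<lambda>x. indicator S (x - v) *\<^sub>R h (x - v))"
    using borel_measurable_integrable[OF assms[unfolded set_integrable_def]]
    by (subst (asm) integrable_distr_eq) (simp_all add: lebesgue_distr_translate(1)[of "-v", simplified])
  moreover have "indicator S (x - v) = (indicator ((+) v ` S) x :: real)" for x
    by (simp add: indicator_def image_iff) (metis add.commute diff_add_cancel add_diff_cancel_left')
  ultimately show ?thesis by (simp add: set_integrable_def)
qed

section \<open>The lattice, the period cell and the phase factor\<close>

lemma lattice_axis: "axis i (of_int n) \<in> \<Lambda>"
  by (auto simp: Lattice_def axis_def)

definition floor_vec :: "real^2 \<Rightarrow> real^2" where
  "floor_vec x = (\<chi> i. of_int \<lfloor>x $ i\<rfloor>)"

lemma floor_vec_lattice: "floor_vec x \<in> \<Lambda>"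
  by (auto simp: Lattice_def floor_vec_def)

lemma floor_vec_cell: "x - floor_vec x \<in> cbox 0 1"
  by (auto simp: mem_box_cart floor_vec_def) linarith

lemma lattice_eq: "\<Lambda> = range (\<lambda>(m, n). vector [of_int m, of_int n])" 
proof (intro set_eqI iffI)
  fix v :: "real^2" assume "v \<in> \<Lambda>"
  then have "v $ 1 \<in> \<int>" "v $ 2 \<in> \<int>" by (auto simp: Lattice_def)
  then obtain m n where "v $ 1 = of_int m" "v $ 2 = of_int n" by (auto elim!: Ints_cases)
  then have "v = (\<lambda>(m, n). vector [of_int m, of_int n]) (m, n)" by (auto simp: vec_eq_iff forall_2)
  then show "v \<in> range (\<lambda>(m, n). vector [of_int m, of_int n])" by blast
qed (auto simp: Lattice_def forall_2)

lemma countable_lattice: "countable \<Lambda>"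
  unfolding lattice_eq by simp

lemma lattice_minus: "v \<in> \<Lambda> \<Longrightarrow> - v \<in> \<Lambda>"
  by (auto simp: Lattice_def)

definition phase :: "real^2 \<Rightarrow> complex" where
  "phase x = exp (\<i> * of_real (\<^bold>M \<bullet> x))"

lemma phase_add: "phase (x + y) = phase x * phase y"
  by (simp add: phase_def inner_add_right distrib_left exp_add)

lemma phase_minus: "phase (- x) = exp (- (\<i> * of_real (\<^bold>M \<bullet> x)))"
  by (simp add: phase_def)

lemma norm_phase [simp]: "norm (phase x) = 1"
  by (simp add: phase_def)

lemma phase_nonzero [simp]: "phase x \<noteq> 0"
  by (simp add: phase_def)

lemma phase_minus_mult [simp]: "phase (- x) * phase x = 1"
  by (simp add: phase_def flip: exp_add)

text \<open>Multiplying by \<open>phase (x + v)\<close> brings the defining condition of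
  \<open>L2_M\<close> into the multiplicative form used from here on.\<close>

lemma quasi_periodic_iff:
  "exp (- (\<i> * of_real (\<^bold>M \<bullet> (x + v)))) * a = exp (- (\<i> * of_real (\<^bold>M \<bullet> x))) * b \<longleftrightarrow> a = phase v * b"
proof -
  have "phase (- (x + v)) * a = phase (- x) * b \<longleftrightarrow> phase (x + v) * (phase (- (x + v)) * a) = phase (x + v) * (phase (- x) * b)"
    by auto
  also have "phase (x + v) * (phase (- (x + v)) * a) = a" 
    using phase_minus_mult[of "x+v"] by (simp add: mult.commute mult.left_commute flip: mult.assoc)
  also have "phase (x + v) * (phase (- x) * b) = (phase (- x) * phase x) * phase v * b"
    by (simp only: phase_add mult_ac)
  finally show ?thesis unfolding phase_minus[symmetric] by (simp only: phase_minus_mult mult_1_left)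
qed

lemma cbox_cover:
  assumes "compact K"
  shows "\<exists>W. finite W \<and> W \<subseteq> \<Lambda> \<and> K \<subseteq> (\<Union>v\<in>W. (+) v ` cbox 0 1)"
proof -
  obtain B where B: "\<And>x. x \<in> K \<Longrightarrow> norm x \<le> B"
    using compact_imp_bounded[OF assms] by (auto simp: bounded_iff)
  define N where "N = \<lceil>B\<rceil> + 1"
  define W where "W = (\<lambda>(m, n). vector [of_int m, of_int n] :: real^2) ` ({-N..N} \<times> {-N..N})"
  have "floor_vec x \<in> W" if "x \<in> K" for x
  proof -
    have "\<bar>x $ i\<bar> \<le> B" for i using component_le_norm_cart[of x i] B[OF that] by linarith
    then have "\<lfloor>x $ i\<rfloor> \<in> {-N..N}" for i
    proof -
      assume "\<And>i. \<bar>x $ i\<bar> \<le> B"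
      then have "- B \<le> x $ i" "x $ i \<le> B" by (auto simp: abs_le_iff minus_le_iff)
      then show ?thesis unfolding N_def by auto linarith+
    qed
    moreover have "floor_vec x = vector [of_int \<lfloor>x $ 1\<rfloor>, of_int \<lfloor>x $ 2\<rfloor>]"
      by (auto simp: floor_vec_def vec_eq_iff forall_2)
    ultimately show ?thesis unfolding W_def by force
  qed
  moreover have "x \<in> (+) (floor_vec x) ` cbox 0 1" for x
    using floor_vec_cell[of x] by (force simp: image_iff intro: bexI[of _ "x - floor_vec x"])
  ultimately have "K \<subseteq> (\<Union>v\<in>W. (+) v ` cbox 0 1)" by blast
  then show ?thesis
    by (intro exI[of _ W]) (auto simp: W_def lattice_eq)
qed

text \<open>Up to null sets the modulus of a quasi-periodic function is periodic, and a compact set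
  meets only finitely many translates of the cell; hence square integrability on one cell gives it
  on every compact set.\<close>

lemma L2_M_iff:
  "f \<in> L2_M \<longleftrightarrow> f \<in> borel_measurable lebesgue \<and> integrable cell (\<lambda>x. (norm (f x))\<^sup>2) \<and>
     (\<forall>v\<in>\<Lambda>. AE x in lebesgue. f (x + v) = phase v * f x)"
proof -
  have 1: "integrable cell h \<longleftrightarrow> set_integrable lebesgue (cbox 0 1) h" for h :: "real^2 \<Rightarrow> real"
    by (subst integrable_restrict_space) (auto simp: set_integrable_def)
  have 2: "set_integrable lebesgue K (\<lambda>x. (norm (f x))\<^sup>2)"
    if f: "f \<in> borel_measurable lebesgue" and i: "set_integrable lebesgue (cbox 0 1) (\<lambda>x. (norm (f x))\<^sup>2)"
      and p: "\<forall>v\<in>\<Lambda>. AE x in lebesgue. f (x + v) = phase v * f x" and K: "compact K" for K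
  proof -
    obtain W where W: "finite W" "W \<subseteq> \<Lambda>" "K \<subseteq> (\<Union>v\<in>W. (+) v ` cbox 0 1)"
      using cbox_cover[OF K] by blast
    have sets: "(+) v ` cbox 0 1 \<in> sets lebesgue" for v :: "real^2"
      by (intro lebesgue_sets_translation) auto
    have "set_integrable lebesgue ((+) v ` cbox 0 1) (\<lambda>x. (norm (f x))\<^sup>2)" if "v \<in> W" for v
    proof -
      have "AE x in lebesgue. f (x - v + v) = phase v * f (x - v)"
        using AE_lebesgue_translate[OF p[rule_format, of v], of "- v"] that W by auto
      then have ae: "AE x in lebesgue. (norm (f (x - v)))\<^sup>2 = (norm (f x))\<^sup>2" 
        by eventually_elim (auto simp: norm_mult)
      have m: "(\<lambda>x. f (x - v)) \<in> borel_measurable lebesgue"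
        using measurable_compose[OF lebesgue_distr_translate(1)[of "-v"] f] by simp
      show ?thesis
        using set_integrable_translate[OF i, of v] unfolding set_integrable_def
        apply (rule integrable_cong_AE_imp)
        subgoal using f sets[of v] by measurable
        subgoal using ae by eventually_elim auto
        done
    qed
    then have "set_integrable lebesgue (\<Union>v\<in>W. (+) v ` cbox 0 1) (\<lambda>x. (norm (f x))\<^sup>2)"
      by (intro set_integrable_UN W) (auto intro: sets)
    then show ?thesis
      by (rule set_integrable_subset) (use K W in \<open>auto simp: lmeasurable_compact fmeasurableD\<close>)
  qed
  show ?thesis unfolding L2_M_def L2_loc_def quasi_periodic_iff
    using 1 2 by (auto simp: compact_cbox)
qed

lemma L2_M_I:
  assumes "f \<in> borel_measurable lebesgue" "integrable cell (\<lambda>x. (norm (f x))\<^sup>2)"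
    "\<And>v. v \<in> \<Lambda> \<Longrightarrow> AE x in lebesgue. f (x + v) = phase v * f x"
  shows "f \<in> L2_M"
  using assms by (auto simp: L2_M_iff)

lemma L2_M_measurable: "f \<in> L2_M \<Longrightarrow> f \<in> borel_measurable lebesgue"
  and L2_M_square_integrable: "f \<in> L2_M \<Longrightarrow> integrable cell (\<lambda>x. (norm (f x))\<^sup>2)"
  and L2_M_quasi_periodic: "f \<in> L2_M \<Longrightarrow> v \<in> \<Lambda> \<Longrightarrow> AE x in lebesgue. f (x + v) = phase v * f x"
  by (auto simp: L2_M_iff)

lemma measurable_cellI: "f \<in> borel_measurable lebesgue \<Longrightarrow> f \<in> borel_measurable cell"
  by (simp add: measurable_restrict_space1)

lemma L2_M_measurable_cell: "f \<in> L2_M \<Longrightarrow> f \<in> borel_measurable cell"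
  by (simp add: measurable_cellI L2_M_measurable)

lemma L2_M_cong_AE:
  assumes "f \<in> L2_M" "AE x in lebesgue. f x = g x"
  shows "g \<in> L2_M"
proof (rule L2_M_I)
  show g: "g \<in> borel_measurable lebesgue"
    by (rule borel_measurable_AE[OF L2_M_measurable[OF assms(1)] assms(2)])
  show "integrable cell (\<lambda>x. (norm (g x))\<^sup>2)"
    by (rule integrable_cong_AE_imp[OF L2_M_square_integrable[OF assms(1)]])
       (use measurable_cellI[OF g] AE_cellI[OF assms(2)] in auto)
  fix v :: "real^2" assume "v \<in> \<Lambda>"
  from L2_M_quasi_periodic[OF assms(1) this] AE_lebesgue_translate[OF assms(2), of v] assms(2)
  show "AE x in lebesgue. g (x + v) = phase v * g x" by eventually_elim auto
qed

lemma L2_M_add: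
  assumes "f \<in> L2_M" "g \<in> L2_M"
  shows "(\<lambda>x. f x + g x) \<in> L2_M"
proof (rule L2_M_I)
  note [measurable] = assms[THEN L2_M_measurable] assms[THEN L2_M_measurable_cell]
  show "(\<lambda>x. f x + g x) \<in> borel_measurable lebesgue" by measurable
  have "(norm (f x + g x))\<^sup>2 \<le> 2 * (norm (f x))\<^sup>2 + 2 * (norm (g x))\<^sup>2" for x
  proof -
    have "(norm (f x + g x))\<^sup>2 \<le> (norm (f x) + norm (g x))\<^sup>2"
      by (intro power_mono norm_triangle_ineq) auto
    also have "\<dots> \<le> 2 * (norm (f x))\<^sup>2 + 2 * (norm (g x))\<^sup>2"
      using zero_le_power2[of "norm (f x) - norm (g x)"] by (simp add: power2_eq_square algebra_simps)
    finally show ?thesis .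
  qed
  moreover have "integrable cell (\<lambda>x. 2 * (norm (f x))\<^sup>2 + 2 * (norm (g x))\<^sup>2)"
    using assms[THEN L2_M_square_integrable] by simp
  ultimately show "integrable cell (\<lambda>x. (norm (f x + g x))\<^sup>2)"
    by (elim Bochner_Integration.integrable_bound) auto
  fix v :: "real^2" assume "v \<in> \<Lambda>"
  from assms[THEN L2_M_quasi_periodic, OF this] 
  show "AE x in lebesgue. f (x + v) + g (x + v) = phase v * (f x + g x)"
    by eventually_elim (auto simp: algebra_simps)
qed

lemma L2_M_mult_periodic:
  assumes "f \<in> L2_M" and h: "h \<in> borel_measurable lebesgue" "\<And>x. norm (h x) \<le> B"
    and per: "\<And>x v. v \<in> \<Lambda> \<Longrightarrow> h (x + v) = h x"
  shows "(\<lambda>x. h x * f x) \<in> L2_M"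
proof (rule L2_M_I)
  note [measurable] = assms(1)[THEN L2_M_measurable] assms(1)[THEN L2_M_measurable_cell] h(1) measurable_cellI[OF h(1)]
  show "(\<lambda>x. h x * f x) \<in> borel_measurable lebesgue" by measurable
  have "(norm (h x * f x))\<^sup>2 \<le> B\<^sup>2 * (norm (f x))\<^sup>2" for x
    unfolding norm_mult power_mult_distrib by (intro mult_right_mono power_mono h) auto
  moreover have "integrable cell (\<lambda>x. B\<^sup>2 * (norm (f x))\<^sup>2)"
    using assms(1)[THEN L2_M_square_integrable] by simp
  ultimately show "integrable cell (\<lambda>x. (norm (h x * f x))\<^sup>2)"
    by (elim Bochner_Integration.integrable_bound) auto
  fix v :: "real^2" assume v: "v \<in> \<Lambda>"
  from assms(1)[THEN L2_M_quasi_periodic, OF this] 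
  show "AE x in lebesgue. h (x + v) * f (x + v) = phase v * (h x * f x)"
    by eventually_elim (auto simp: algebra_simps per[OF v])
qed

lemma L2_M_scale: "f \<in> L2_M \<Longrightarrow> (\<lambda>x. c * f x) \<in> L2_M"
  by (rule L2_M_mult_periodic[where B = "norm c"]) auto

lemma L2_M_zero: "(\<lambda>x. 0) \<in> L2_M"
  by (rule L2_M_I) auto

lemma L2_M_uminus: "f \<in> L2_M \<Longrightarrow> (\<lambda>x. - f x) \<in> L2_M"
  using L2_M_scale[of f "-1"] by simp

lemma L2_M_diff: "f \<in> L2_M \<Longrightarrow> g \<in> L2_M \<Longrightarrow> (\<lambda>x. f x - g x) \<in> L2_M"
  using L2_M_add[OF _ L2_M_uminus, of f g] by simp

lemma L2_M_sum: "(\<And>i. i \<in> I \<Longrightarrow> f i \<in> L2_M) \<Longrightarrow> (\<lambda>x. \<Sum>i\<in>I. f i x) \<in> L2_M"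
  by (induction I rule: infinite_finite_induct) (auto intro: L2_M_zero L2_M_add)

section \<open>The inner product over the period cell\<close>

lemma inner_M_eq: "inner_M f g = (\<integral>x. cnj (f x) * g x \<partial>cell)"
  unfolding inner_M_def set_lebesgue_integral_def by (subst integral_restrict_space) auto

lemma measurable_cnj [measurable]: "cnj \<in> borel_measurable borel"
  by (intro borel_measurable_continuous_onI continuous_intros)

lemma L2_M_integrable_mult:
  assumes "f \<in> L2_M" "g \<in> L2_M"
  shows "integrable cell (\<lambda>x. cnj (f x) * g x)"
proof -
  note [measurable] = assms[THEN L2_M_measurable_cell]
  have "norm (f x) * norm (g x) \<le> (norm (f x))\<^sup>2 + (norm (g x))\<^sup>2" for x
    using zero_le_power2[of "norm (f x) - norm (g x)"] zero_le_power2[of "norm (f x) + norm (g x)"]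
    unfolding power2_diff power2_sum by linarith
  moreover have "integrable cell (\<lambda>x. (norm (f x))\<^sup>2 + (norm (g x))\<^sup>2)"
    using assms[THEN L2_M_square_integrable] by simp
  ultimately show ?thesis
    by (elim Bochner_Integration.integrable_bound) (auto simp: norm_mult)
qed

lemma inner_M_add_right:
  "f \<in> L2_M \<Longrightarrow> g \<in> L2_M \<Longrightarrow> h \<in> L2_M \<Longrightarrow> inner_M f (\<lambda>x. g x + h x) = inner_M f g + inner_M f h"
  unfolding inner_M_eq by (simp add: distrib_left L2_M_integrable_mult)

lemma inner_M_diff_right:
  "f \<in> L2_M \<Longrightarrow> g \<in> L2_M \<Longrightarrow> h \<in> L2_M \<Longrightarrow> inner_M f (\<lambda>x. g x - h x) = inner_M f g - inner_M f h"
  unfolding inner_M_eq by (simp add: right_diff_distrib L2_M_integrable_mult)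

lemma inner_M_scale_right: "inner_M f (\<lambda>x. c * g x) = c * inner_M f g"
  unfolding inner_M_eq by (simp add: mult.left_commute[of _ c])

lemma inner_M_zero_right [simp]: "inner_M f (\<lambda>x. 0) = 0"
  by (simp add: inner_M_eq)

lemma inner_M_uminus_right: "inner_M f (\<lambda>x. - g x) = - inner_M f g"
  unfolding inner_M_eq by simp

lemma inner_M_cnj: "cnj (inner_M f g) = inner_M g f"
  unfolding inner_M_eq by (subst integral_bounded_linear'[OF bounded_linear_cnj bounded_linear_cnj, symmetric]) (simp_all add: mult.commute)

lemma inner_M_scale_left: "inner_M (\<lambda>x. c * f x) g = cnj c * inner_M f g"
  unfolding inner_M_eq by (simp add: mult.assoc)

lemma inner_M_sum_right:
  assumes "f \<in> L2_M" "\<And>i. i \<in> I \<Longrightarrow> g i \<in> L2_M"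
  shows "inner_M f (\<lambda>x. \<Sum>i\<in>I. g i x) = (\<Sum>i\<in>I. inner_M f (g i))"
  unfolding inner_M_eq sum_distrib_left
  by (rule Bochner_Integration.integral_sum) (use assms L2_M_integrable_mult in auto)

lemma inner_M_sum_left:
  assumes "f \<in> L2_M" "\<And>i. i \<in> I \<Longrightarrow> g i \<in> L2_M"
  shows "inner_M (\<lambda>x. \<Sum>i\<in>I. g i x) f = (\<Sum>i\<in>I. inner_M (g i) f)"
  using arg_cong[where f = cnj, OF inner_M_sum_right[OF assms]] by (simp add: inner_M_cnj)

lemma inner_M_cong_AE:
  assumes "f \<in> L2_M" "f' \<in> L2_M" "g \<in> L2_M" "g' \<in> L2_M"
    and "AE x in lebesgue. f x = f' x" "AE x in lebesgue. g x = g' x"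
  shows "inner_M f g = inner_M f' g'"
  unfolding inner_M_eq
proof (rule integral_cong_AE)
  note [measurable] = assms(1-4)[THEN L2_M_measurable_cell]
  show "(\<lambda>x. cnj (f x) * g x) \<in> borel_measurable cell" "(\<lambda>x. cnj (f' x) * g' x) \<in> borel_measurable cell"
    by measurable
  from AE_cellI[OF assms(5)] AE_cellI[OF assms(6)]
  show "AE x in cell. cnj (f x) * g x = cnj (f' x) * g' x" by eventually_elim auto
qed

lemma inner_M_self: "inner_M f f = of_real (\<integral>x. (norm (f x))\<^sup>2 \<partial>cell)"
  unfolding inner_M_eq 
  by (subst integral_complex_of_real[symmetric]) (simp add: complex_norm_square mult.commute del: of_real_power)

text \<open>The lattice is countable, so the exceptional null sets of all translates can be
  discarded together; afterwards every remaining point is moved into the cell by its own lattice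
  vector \<open>floor_vec x\<close>.\<close>

lemma AE_zero_of_cell:
  assumes f: "f \<in> L2_M" and z: "AE x in cell. f x = 0"
  shows "AE x in lebesgue. f x = 0"
proof -
  have "AE x in lebesgue. \<forall>v\<in>\<Lambda>. x - v \<in> cbox 0 1 \<longrightarrow> f (x - v) = 0"
    using AE_lebesgue_translate[OF z[unfolded AE_cell_iff], of "- v" for v]
    by (subst AE_ball_countable[OF countable_lattice]) simp
  moreover have "AE x in lebesgue. \<forall>v\<in>\<Lambda>. f (x - v) = phase (- v) * f x"
    using L2_M_quasi_periodic[OF f lattice_minus]
    by (subst AE_ball_countable[OF countable_lattice]) simp
  ultimately show ?thesis
  proof eventually_elim
    case (elim x)
    then have "phase (- floor_vec x) * f x = 0" using floor_vec_lattice[of x] floor_vec_cell[of x] by metis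
    then show ?case by simp
  qed
qed

lemma continuous_L2_M:
  assumes c: "continuous_on UNIV f" and p: "\<And>x v. v \<in> \<Lambda> \<Longrightarrow> f (x + v) = phase v * f x"
  shows "f \<in> L2_M"
proof (rule L2_M_I)
  show "f \<in> borel_measurable lebesgue"
    using continuous_imp_measurable_on_sets_lebesgue[OF c] by (simp add: lebesgue_on_UNIV_eq)
  show "integrable cell (\<lambda>x. (norm (f x))\<^sup>2)"
  proof -
    have "continuous_on (cbox 0 1) (\<lambda>x. (norm (f x))\<^sup>2)"
      by (intro continuous_intros continuous_on_subset[OF c]) auto
    from absolutely_integrable_continuous[OF this] show ?thesis
      by (subst integrable_restrict_space) (auto simp: set_integrable_def)
  qed
qed (use p in auto)

section \<open>Integration by parts over the period cell\<close>

text \<open>The coincidence set is closed and of full measure, and such a set is the whole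
  space.\<close>

lemma continuous_AE_imp_eq:
  fixes f g :: "'a::euclidean_space \<Rightarrow> 'b::t2_space"
  assumes "continuous_on UNIV f" "continuous_on UNIV g" "AE x in lebesgue. f x = g x"
  shows "f x = g x"
proof -
  have "closed {x. f x = g x}" by (intro closed_Collect_eq assms)
  from mem_closed_if_AE_lebesgue[OF this, of x] assms(3) show ?thesis by simp
qed

lemma continuous_L2_M_quasi_periodic:
  assumes "f \<in> L2_M" "continuous_on UNIV f" "v \<in> \<Lambda>"
  shows "f (x + v) = phase v * f x"
  using L2_M_quasi_periodic[OF assms(1,3)]
  by (intro continuous_AE_imp_eq[where f = "\<lambda>x. f (x + v)"])
     (auto intro!: continuous_intros continuous_on_compose2[OF assms(2)] assms(2))

lemma pd_eqI: "(f has_derivative D) (at x) \<Longrightarrow> pd r f x = D (axis r 1)"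
  unfolding pd_def using frechet_derivative_at by metis

lemma integral_translate:
  fixes h :: "real^2 \<Rightarrow> complex"
  assumes "continuous_on UNIV h"
  shows "integral (cbox a b) (\<lambda>x. h (x + c)) = integral (cbox (a + c) (b + c)) h"
proof -
  have "(h has_integral integral (cbox (a + c) (b + c)) h) (cbox (a + c) (b + c))"
    by (intro integrable_integral integrable_continuous continuous_on_subset[OF assms]) auto
  from has_integral_affinity'[OF this, of 1 c] show ?thesis
    by (simp add: integral_unique)
qed

text \<open>By periodicity the integral of a translate of \<open>h\<close> over the cell does not depend on the
  translation; differentiating in the translation gives the claim.\<close>

lemma integral_pd_periodic:
  fixes h :: "real^2 \<Rightarrow> complex"
  assumes diff: "\<And>x. h differentiable (at x)" and cont: "continuous_on UNIV (pd r h)"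
    and per: "\<And>x v. v \<in> \<Lambda> \<Longrightarrow> h (x + v) = h x"
  shows "integral (cbox 0 1) (pd r h) = 0"
proof -
  define e :: "real^2" where "e = axis r 1"
  have eB: "e \<in> Basis" by (simp add: e_def axis_in_Basis_iff)
  have ein: "x \<bullet> e = x $ r" for x by (simp add: e_def inner_axis)
  have ei: "e $ i = (if i = r then 1 else 0)" for i by (simp add: e_def axis_def)
  have ch: "continuous_on UNIV h"
    using diff by (simp add: continuous_on_eq_continuous_within differentiable_imp_continuous_within)
  have int: "h integrable_on cbox a b" for a b
    by (intro integrable_continuous continuous_on_subset[OF ch]) auto
  define F where "F t = integral (cbox 0 1) (\<lambda>x. h (x + t *\<^sub>R e))" for t
  have F: "F t = F 0" if t: "t \<in> {0..1}" for t
  proof -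
    \<comment> \<open>The shifted cell is cut at height 1 and the original cell at height t. Both
      contain \<open>cbox (t *\<^sub>R e) 1\<close>, and the two remaining slabs are translates of
      each other by the lattice vector \<open>e\<close>.\<close>
    have s1: "cbox (t *\<^sub>R e) (1 + t *\<^sub>R e) \<inter> {x. x \<bullet> e \<le> 1} = cbox (t *\<^sub>R e) 1"
      "cbox (t *\<^sub>R e) (1 + t *\<^sub>R e) \<inter> {x. x \<bullet> e \<ge> 1} = cbox e (1 + t *\<^sub>R e)"
      using t by (auto simp: mem_box_cart ein ei split: if_splits) (smt (verit, best))+
    have s2: "cbox 0 1 \<inter> {x. x \<bullet> e \<ge> t} = cbox (t *\<^sub>R e) 1"
      "cbox 0 1 \<inter> {x. x \<bullet> e \<le> t} = cbox 0 (1 + (t - 1) *\<^sub>R e)"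
      using t by (auto simp: mem_box_cart ein ei split: if_splits) (smt (verit, best))+
    have "integral (cbox 0 (1 + (t - 1) *\<^sub>R e)) (\<lambda>x. h (x + e)) = integral (cbox e (1 + t *\<^sub>R e)) h"
      using integral_translate[OF ch, of 0 "1 + (t - 1) *\<^sub>R e" e] by (simp add: algebra_simps)
    moreover have "h (x + e) = h x" for x 
      using per[of e x] lattice_axis[of r 1] by (simp add: e_def)
    ultimately have tr: "integral (cbox e (1 + t *\<^sub>R e)) h = integral (cbox 0 (1 + (t - 1) *\<^sub>R e)) h" by simp
    have "(h has_integral (integral (cbox (t *\<^sub>R e) 1) h + integral (cbox e (1 + t *\<^sub>R e)) h)) (cbox (t *\<^sub>R e) (1 + t *\<^sub>R e))"
      by (rule has_integral_split[where k = e and c = 1]) (auto simp: s1 eB intro: integrable_integral int)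
    moreover have "(h has_integral (integral (cbox 0 (1 + (t - 1) *\<^sub>R e)) h + integral (cbox (t *\<^sub>R e) 1) h)) (cbox 0 1)"
      by (rule has_integral_split[where k = e and c = t]) (auto simp: s2 eB intro: integrable_integral int)
    ultimately have "integral (cbox (t *\<^sub>R e) (1 + t *\<^sub>R e)) h = integral (cbox 0 1) h"
      by (auto simp: tr dest!: integral_unique)
    then show ?thesis
      unfolding F_def by (simp add: integral_translate[OF ch])
  qed
  \<comment> \<open>Differentiation under the integral sign at 0 is done within [0, 1], the interval
    on which \<open>F\<close> is known to be constant.\<close>
  have "((\<lambda>t. integral (cbox 0 1) (\<lambda>x. h (x + t *\<^sub>R e))) has_vector_derivative
      integral (cbox 0 1) (\<lambda>x. pd r h (x + 0 *\<^sub>R e))) (at 0 within {0..1})"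
  proof (rule leibniz_rule_vector_derivative)
    fix t x
    have d: "(h has_derivative frechet_derivative h (at (x + t *\<^sub>R e))) (at (x + t *\<^sub>R e))"
      using diff frechet_derivative_works by blast
    have "((\<lambda>t. h (x + t *\<^sub>R e)) has_derivative (\<lambda>s. frechet_derivative h (at (x + t *\<^sub>R e)) (s *\<^sub>R e))) (at t)"
      by (rule has_derivative_compose[where f = "\<lambda>t. x + t *\<^sub>R e", OF _ d]) (auto intro!: derivative_eq_intros)
    moreover have "frechet_derivative h (at (x + t *\<^sub>R e)) (s *\<^sub>R e) = s *\<^sub>R pd r h (x + t *\<^sub>R e)" for s
      unfolding pd_def e_def[symmetric] using d by (simp add: has_derivative_linear linear_cmul)
    ultimately show "((\<lambda>t. h (x + t *\<^sub>R e)) has_vector_derivative pd r h (x + t *\<^sub>R e)) (at t within {0..1})"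
      unfolding has_vector_derivative_def by (auto intro: has_derivative_at_withinI)
  next
    show "(\<lambda>x. h (x + t *\<^sub>R e)) integrable_on cbox 0 1" for t
      by (intro integrable_continuous continuous_on_compose2[OF ch] continuous_intros) auto
    show "continuous_on ({0..1} \<times> cbox 0 1) (\<lambda>(t, x). pd r h (x + t *\<^sub>R e))"
      unfolding case_prod_unfold by (intro continuous_on_compose2[OF cont] continuous_intros) auto
  qed auto
  then have "(F has_vector_derivative integral (cbox 0 1) (pd r h)) (at 0 within {0..1})"
    by (simp add: F_def[abs_def])
  moreover have "(F has_vector_derivative 0) (at 0 within {0..1})"
    by (rule has_vector_derivative_transform[where f = "\<lambda>_. F 0", OF _ F has_vector_derivative_const]) simp_all
  ultimately show ?thesis
    by (intro vector_derivative_unique_within_closed_interval[of 0 1 0 F]) auto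
qed

text \<open>The quasi-momenta \<open>M + 2 \<pi> k\<close>; none of their components vanishes.\<close>

definition xi :: "int \<times> int \<Rightarrow> real^2" where
  "xi k = (\<chi> r. pi * (2 * of_int (if r = 1 then fst k else snd k) + 1))"

section \<open>The characters and their derivatives\<close>

definition ch :: "int \<times> int \<Rightarrow> real^2 \<Rightarrow> complex" where
  "ch k x = exp (\<i> * of_real (xi k \<bullet> x))"

lemma ch_quasi_periodic: "v \<in> \<Lambda> \<Longrightarrow> ch k (x + v) = phase v * ch k x"
proof -
  assume "v \<in> \<Lambda>"
  then obtain m n where v: "v = vector [of_int m, of_int n]" by (auto simp: lattice_eq)
  \<comment> \<open>On a lattice vector the pairings with \<open>xi k\<close> and with M differ by
    an integer multiple of 2 pi, which the exponential does not see.\<close>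
  have "xi k \<bullet> v = \<^bold>M \<bullet> v + of_int (fst k * m + snd k * n) * (2 * pi)"
    by (simp add: v xi_def M_point_def inner_vec_def sum_2 algebra_simps)
  then have "\<i> * of_real (xi k \<bullet> v) =
      \<i> * of_real (\<^bold>M \<bullet> v) + of_int (fst k * m + snd k * n) * (of_real (2 * pi) * \<i>)"
    by (simp add: algebra_simps)
  then have "exp (\<i> * of_real (xi k \<bullet> v)) = phase v"
    unfolding phase_def exp_eq by (intro exI[of _ "fst k * m + snd k * n"]) simp
  then show ?thesis
    by (simp add: ch_def inner_add_right distrib_left exp_add)
qed

lemma ch_continuous: "continuous_on S (ch k)"
  unfolding ch_def by (intro continuous_intros)

lemma ch_L2_M [simp]: "ch k \<in> L2_M"
  by (intro continuous_L2_M ch_continuous ch_quasi_periodic)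

lemma norm_ch [simp]: "norm (ch k x) = 1"
  by (simp add: ch_def)

lemma cnj_ch_mult [simp]: "cnj (ch k x) * ch k x = 1"
  by (metis complex_norm_square mult.commute norm_ch of_real_1 one_power2)

lemma ch_has_derivative:
  "((\<lambda>x. c * ch k x) has_derivative (\<lambda>h. c * (\<i> * of_real (xi k \<bullet> h)) * ch k x)) (at x)"
proof -
  have "((\<lambda>x. of_real (xi k \<bullet> x) :: complex) has_derivative (\<lambda>h. of_real (xi k \<bullet> h))) (at x)"
    by (intro derivative_intros)
  then have "((\<lambda>x. \<i> * of_real (xi k \<bullet> x) :: complex) has_derivative (\<lambda>h. \<i> * of_real (xi k \<bullet> h))) (at x)"
    by (intro derivative_intros)
  from has_derivative_compose[OF this, of exp "\<lambda>h. exp (\<i> * of_real (xi k \<bullet> x)) * h"]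
  have "(ch k has_derivative (\<lambda>h. ch k x * (\<i> * of_real (xi k \<bullet> h)))) (at x)"
    unfolding ch_def[abs_def] by (simp add: DERIV_exp[unfolded has_field_derivative_def])
  from has_derivative_mult_right[OF this, of c] show ?thesis by (simp add: mult_ac)
qed

lemma pd_ch: "pd r (ch k) = (\<lambda>x. \<i> * of_real (xi k $ r) * ch k x)"
  using pd_eqI[OF ch_has_derivative[of 1 k]] by (auto simp: inner_axis fun_eq_iff)

lemma smooth_ch: "smooth (ch k)"
proof -
  have "C_diff n (\<lambda>x. c * ch k x)" for n c
  proof (induction n arbitrary: c)
    case 0 then show ?case by (auto intro!: continuous_intros ch_continuous)
  next
    case (Suc n)
    have "frechet_derivative (\<lambda>x. c * ch k x) (at x) b = (c * (\<i> * of_real (xi k \<bullet> b))) * ch k x" for x b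
      using frechet_derivative_at[OF ch_has_derivative[of c k x]] by (metis)
    moreover have "(\<lambda>x. c * ch k x) differentiable (at x)" for x
      using ch_has_derivative[of c k x] unfolding differentiable_def by blast
    ultimately show ?case using Suc by auto
  qed
  from this[of _ 1] show ?thesis by (simp add: smooth_def)
qed

lemma cell_integral_eq:
  fixes h :: "real^2 \<Rightarrow> complex"
  assumes "continuous_on UNIV h"
  shows "(\<integral>x. h x \<partial>cell) = integral (cbox 0 1) h"
proof -
  have "h absolutely_integrable_on cbox 0 1"
    by (intro absolutely_integrable_continuous continuous_on_subset[OF assms]) auto
  from set_lebesgue_integral_eq_integral(2)[OF this] show ?thesis
    unfolding set_lebesgue_integral_def by (subst integral_restrict_space) auto
qed

lemma pd_quasi_periodic:
  assumes "\<And>x. \<phi> differentiable (at x)" "\<And>x v. v \<in> \<Lambda> \<Longrightarrow> \<phi> (x + v) = phase v * \<phi> x" "v \<in> \<Lambda>"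
  shows "pd r \<phi> (x + v) = phase v * pd r \<phi> x"
proof -
  have d: "(\<phi> has_derivative frechet_derivative \<phi> (at x)) (at x)" for x
    using assms(1) frechet_derivative_works by blast
  have "((\<lambda>x. \<phi> (x + v)) has_derivative (\<lambda>h. frechet_derivative \<phi> (at (x + v)) h)) (at x)"
    by (rule has_derivative_compose[OF _ d]) (auto intro!: derivative_eq_intros)
  moreover have "((\<lambda>x. \<phi> (x + v)) has_derivative (\<lambda>h. phase v * frechet_derivative \<phi> (at x) h)) (at x)"
    unfolding assms(2)[OF assms(3)] by (rule has_derivative_mult_right[OF d])
  ultimately have "frechet_derivative \<phi> (at (x + v)) = (\<lambda>h. phase v * frechet_derivative \<phi> (at x) h)"
    by (rule has_derivative_unique)
  then show ?thesis by (simp add: pd_def)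
qed

text \<open>The product of \<open>cnj (ch k x)\<close> and \<open>\<phi> x\<close> is periodic, so
  its derivative integrates to zero over the cell and the product rule produces the symbol. Asking
  for one continuous partial derivative instead of \<open>smooth\<close> lets the lemma also serve
  for products of a periodic function with a character.\<close>

lemma inner_M_ch_pd:
  assumes diff: "\<And>x. \<phi> differentiable (at x)" and cont: "continuous_on UNIV (pd r \<phi>)"
    and per: "\<And>x v. v \<in> \<Lambda> \<Longrightarrow> \<phi> (x + v) = phase v * \<phi> x"
  shows "inner_M (ch k) (pd r \<phi>) = \<i> * of_real (xi k $ r) * inner_M (ch k) \<phi>" 
    and "\<phi> \<in> L2_M" and "pd r \<phi> \<in> L2_M"
proof -
  have c\<phi>: "continuous_on UNIV \<phi>"
    using diff by (simp add: continuous_on_eq_continuous_within differentiable_imp_continuous_within)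
  show L: "\<phi> \<in> L2_M" "pd r \<phi> \<in> L2_M"
    by (intro continuous_L2_M c\<phi> per cont pd_quasi_periodic diff; assumption)+
  define h where "h x = cnj (ch k x) * \<phi> x" for x
  define a where "a = \<i> * complex_of_real (xi k $ r)"
  have d: "(h has_derivative (\<lambda>s. cnj (ch k x) * frechet_derivative \<phi> (at x) s +
      cnj (\<i> * of_real (xi k \<bullet> s) * ch k x) * \<phi> x)) (at x)" for x
  proof -
    have "((\<lambda>x. cnj (ch k x)) has_derivative (\<lambda>s. cnj (\<i> * of_real (xi k \<bullet> s) * ch k x))) (at x)"
      using has_derivative_compose[OF ch_has_derivative[of 1 k x] 
          bounded_linear_imp_has_derivative[OF bounded_linear_cnj]] by simp
    moreover have "(\<phi> has_derivative frechet_derivative \<phi> (at x)) (at x)"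
      using diff frechet_derivative_works by blast
    ultimately show ?thesis unfolding h_def[abs_def] by (rule has_derivative_mult)
  qed
  have pdh: "pd r h = (\<lambda>x. cnj (ch k x) * pd r \<phi> x - a * (cnj (ch k x) * \<phi> x))"
    using pd_eqI[OF d] by (auto simp: fun_eq_iff pd_def inner_axis a_def)
  have "integral (cbox 0 1) (pd r h) = 0"
  proof (rule integral_pd_periodic)
    show "h differentiable (at x)" for x using d by (auto simp: differentiable_def)
    show "continuous_on UNIV (pd r h)" unfolding pdh
      by (intro continuous_intros ch_continuous c\<phi> cont)
    fix x v assume v: "v \<in> \<Lambda>"
    have "cnj (phase v) * phase v = 1"
      by (metis complex_norm_square mult.commute norm_phase of_real_1 one_power2)
    moreover have "h (x + v) = (cnj (phase v) * phase v) * h x"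
      unfolding h_def per[OF v] ch_quasi_periodic[OF v] by simp
    ultimately show "h (x + v) = h x" by simp
  qed
  moreover have "(\<integral>x. pd r h x \<partial>cell) = integral (cbox 0 1) (pd r h)"
    by (rule cell_integral_eq) (unfold pdh, intro continuous_intros ch_continuous c\<phi> cont)
  moreover have "(\<integral>x. pd r h x \<partial>cell) = inner_M (ch k) (pd r \<phi>) - a * inner_M (ch k) \<phi>"
    unfolding pdh inner_M_eq 
    by (subst Bochner_Integration.integral_diff) (auto intro!: L2_M_integrable_mult L integrable_mult_right)
  ultimately show "inner_M (ch k) (pd r \<phi>) = \<i> * of_real (xi k $ r) * inner_M (ch k) \<phi>"
    by (simp add: a_def)
qed

lemma smooth_differentiable: "smooth f \<Longrightarrow> f differentiable (at x)"
  unfolding smooth_def using C_diff.simps(2)[of 0 f] by blast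

lemma smooth_deriv: "smooth f \<Longrightarrow> b \<in> Basis \<Longrightarrow> smooth (\<lambda>x. frechet_derivative f (at x) b)"
  unfolding smooth_def by (metis C_diff.simps(2))

lemma smooth_continuous: "smooth f \<Longrightarrow> continuous_on UNIV f"
  unfolding smooth_def using C_diff.simps(1)[of f] by blast

lemma smooth_pd: "smooth f \<Longrightarrow> smooth (pd r f)"
  unfolding pd_def[abs_def] by (intro smooth_deriv) (auto intro: axis_in_Basis_iff[THEN iffD2])

lemma smooth_L2_M_pd:
  assumes "smooth \<phi>" "\<phi> \<in> L2_M"
  shows "inner_M (ch k) (pd r \<phi>) = \<i> * of_real (xi k $ r) * inner_M (ch k) \<phi>" and "pd r \<phi> \<in> L2_M"
  by (rule inner_M_ch_pd[where \<phi> = \<phi> and r = r, OF smooth_differentiable smooth_continuous[OF smooth_pd]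
        continuous_L2_M_quasi_periodic[OF assms(2) smooth_continuous]]; use assms in simp)+

lemma xi_inj: "xi k = xi l \<Longrightarrow> k = l"
  by (auto simp: xi_def vec_eq_iff forall_2 prod_eq_iff)

text \<open>Distinct characters are eigenfunctions of some \<open>pd r\<close> for different
  eigenvalues. Evaluating the inner product of \<open>ch k\<close> with \<open>pd r (ch l)\<close>
  in two ways forces it to vanish, so no integral of an exponential is computed.\<close>

lemma ch_orthonormal: "inner_M (ch k) (ch l) = (if k = l then 1 else 0)"
proof (cases "k = l")
  case True
  have "cbox 0 (1::real^2) \<noteq> {}" by (simp add: interval_ne_empty_cart)
  from content_cbox_cart[OF this] have "measure lebesgue (cbox 0 (1::real^2)) = 1"
    by (simp add: measure_completion)
  then show ?thesis using True
    by (simp add: inner_M_eq measure_restrict_space)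
next
  case False
  then obtain r where r: "xi k $ r \<noteq> xi l $ r" using xi_inj[of k l] unfolding vec_eq_iff by blast
  have "\<i> * of_real (xi l $ r) * inner_M (ch k) (ch l) = \<i> * of_real (xi k $ r) * inner_M (ch k) (ch l)"
    using smooth_L2_M_pd(1)[OF smooth_ch ch_L2_M, of k r l]
    unfolding pd_ch by (simp add: inner_M_scale_right)
  then show ?thesis using r False by simp
qed

section \<open>Completeness of the characters\<close>

text \<open>The characters are conjugated because these functions take the place of the first factor
  of \<open>inner_M\<close>.\<close>

inductive trig_poly :: "(real^2 \<Rightarrow> complex) \<Rightarrow> bool" where
  base: "trig_poly (\<lambda>x. cnj (ch k x))"
| add: "trig_poly p \<Longrightarrow> trig_poly q \<Longrightarrow> trig_poly (\<lambda>x. p x + q x)"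
| scale: "trig_poly p \<Longrightarrow> trig_poly (\<lambda>x. c * p x)"

text \<open>The quotient of the plane by the lattice, realised as a product of two unit circles in
  C^2. Periodic functions become functions on a compact set, where Stone-Weierstrass
  applies.\<close>

definition torus :: "real^2 \<Rightarrow> complex \<times> complex" where
  "torus x = (exp (\<i> * of_real (2 * pi * x $ 1)), exp (\<i> * of_real (2 * pi * x $ 2)))"

lemma continuous_torus [continuous_intros]: "continuous_on S torus"
  unfolding torus_def by (intro continuous_intros)

lemma torus_cnj_ch:
  "fst (torus x) * cnj (ch (m, n) x) = cnj (ch (m - 1, n) x)"
  "cnj (fst (torus x)) * cnj (ch (m, n) x) = cnj (ch (m + 1, n) x)"
  "snd (torus x) * cnj (ch (m, n) x) = cnj (ch (m, n - 1) x)"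
  "cnj (snd (torus x)) * cnj (ch (m, n) x) = cnj (ch (m, n + 1) x)"
  unfolding torus_def ch_def
  by (simp_all add: exp_cnj inner_vec_def sum_2 xi_def exp_eq algebra_simps flip: exp_add)

lemma trig_poly_torus:
  assumes "trig_poly p"
  shows "trig_poly (\<lambda>x. fst (torus x) * p x)" "trig_poly (\<lambda>x. cnj (fst (torus x)) * p x)"
    "trig_poly (\<lambda>x. snd (torus x) * p x)" "trig_poly (\<lambda>x. cnj (snd (torus x)) * p x)"
  using assms
proof (induction p)
  case (base k)
  obtain m n where k: "k = (m, n)" by (cases k)
  { case 1 show ?case by (simp add: k torus_cnj_ch trig_poly.base) }
  { case 2 show ?case by (simp add: k torus_cnj_ch trig_poly.base) }
  { case 3 show ?case by (simp add: k torus_cnj_ch trig_poly.base) }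
  { case 4 show ?case by (simp add: k torus_cnj_ch trig_poly.base) }
next
  case (add p q)
  { case 1 show ?case using trig_poly.add[OF add.IH(1) add.IH(5)] by (simp add: algebra_simps) }
  { case 2 show ?case using trig_poly.add[OF add.IH(2) add.IH(6)] by (simp add: algebra_simps) }
  { case 3 show ?case using trig_poly.add[OF add.IH(3) add.IH(7)] by (simp add: algebra_simps) }
  { case 4 show ?case using trig_poly.add[OF add.IH(4) add.IH(8)] by (simp add: algebra_simps) }
next
  case (scale p c)
  { case 1 show ?case using trig_poly.scale[OF scale.IH(1), of c] by (simp add: mult_ac) }
  { case 2 show ?case using trig_poly.scale[OF scale.IH(2), of c] by (simp add: mult_ac) }
  { case 3 show ?case using trig_poly.scale[OF scale.IH(3), of c] by (simp add: mult_ac) }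
  { case 4 show ?case using trig_poly.scale[OF scale.IH(4), of c] by (simp add: mult_ac) }
qed

lemma trig_poly_Re_Im:
  assumes a: "trig_poly (\<lambda>x. z x * p x)" and b: "trig_poly (\<lambda>x. cnj (z x) * p x)"
  shows "trig_poly (\<lambda>x. of_real (Re (z x)) * p x)" "trig_poly (\<lambda>x. of_real (Im (z x)) * p x)"
proof -
  have "(1/2) * (z x * p x) + (1/2) * (cnj (z x) * p x) = of_real (Re (z x)) * p x"
       "(- \<i> / 2) * (z x * p x) + (\<i> / 2) * (cnj (z x) * p x) = of_real (Im (z x)) * p x" for x
    by (auto simp: complex_eq_iff field_simps)
  with trig_poly.add[OF trig_poly.scale[OF a] trig_poly.scale[OF b], of "1/2" "1/2"]
    trig_poly.add[OF trig_poly.scale[OF a] trig_poly.scale[OF b], of "- \<i> / 2" "\<i> / 2"]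
  show "trig_poly (\<lambda>x. of_real (Re (z x)) * p x)" "trig_poly (\<lambda>x. of_real (Im (z x)) * p x)"
    by simp_all
qed

text \<open>The factor \<open>p\<close> is arbitrary so that a product of two polynomials can be
  handled by multiplying with one after the other. The linear case reduces to four real coordinates,
  the real and imaginary parts of the two circle variables.\<close>

lemma trig_poly_polynomial:
  assumes "real_polynomial_function q" "trig_poly p"
  shows "trig_poly (\<lambda>x. of_real (q (torus x)) * p x)"
  using assms
proof (induction q arbitrary: p)
  case (linear q)
  interpret bounded_linear q by fact
  have q: "q zw = Re (fst zw) * q (1, 0) + (Im (fst zw) * q (\<i>, 0) + (Re (snd zw) * q (0, 1) + Im (snd zw) * q (0, \<i>)))" for zw
  proof -
    have "zw = Re (fst zw) *\<^sub>R (1, 0) + (Im (fst zw) *\<^sub>R (\<i>, 0) + (Re (snd zw) *\<^sub>R (0, 1) + Im (snd zw) *\<^sub>R (0, \<i>)))"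
      by (auto simp: prod_eq_iff complex_eq_iff)
    then have "q zw = q (Re (fst zw) *\<^sub>R (1, 0) + (Im (fst zw) *\<^sub>R (\<i>, 0) + (Re (snd zw) *\<^sub>R (0, 1) + Im (snd zw) *\<^sub>R (0, \<i>))))"
      by simp
    then show ?thesis by (simp only: add scaleR real_scaleR_def)
  qed
  note t = trig_poly_torus[OF \<open>trig_poly p\<close>]
  note ri = trig_poly_Re_Im[OF t(1,2)] trig_poly_Re_Im[OF t(3,4)]
  from trig_poly.add[OF ri(1)[THEN trig_poly.scale, of "of_real (q (1, 0))"]
      trig_poly.add[OF ri(2)[THEN trig_poly.scale, of "of_real (q (\<i>, 0))"]
      trig_poly.add[OF ri(3)[THEN trig_poly.scale, of "of_real (q (0, 1))"]
        ri(4)[THEN trig_poly.scale, of "of_real (q (0, \<i>))"]]]]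
  show ?case by (subst q) (simp add: algebra_simps)
next
  case (const c) then show ?case by (intro trig_poly.scale)
next
  case (add f g)
  from trig_poly.add[OF add.IH(1)[OF add.prems] add.IH(2)[OF add.prems]]
  show ?case by (simp add: algebra_simps)
next
  case (mult f g)
  from mult.IH(1)[OF mult.IH(2)[OF mult.prems]] show ?case by (simp add: mult_ac)
qed

lemma trig_poly_orthogonal:
  assumes "trig_poly p" "f \<in> L2_M" "\<And>k. inner_M (ch k) f = 0"
  shows "integrable cell (\<lambda>x. p x * f x) \<and> (\<integral>x. p x * f x \<partial>cell) = 0"
  using assms(1)
proof induction
  case (base k)
  show ?case using assms(2,3) L2_M_integrable_mult[of "ch k" f] by (simp add: inner_M_eq)
next
  case (add p q) then show ?case by (simp add: distrib_right)
next
  case (scale p c) then show ?case by (simp add: mult.assoc)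
qed

text \<open>Polynomials in the torus coordinates are annihilated by
  \<open>trig_poly_orthogonal\<close>, and Stone-Weierstrass approximates \<open>G\<close> by them
  uniformly on a ball containing the torus. The factor \<open>cnj (ch 0 x)\<close> makes
  \<open>f\<close> periodic.\<close>

lemma torus_orthogonal:
  fixes G :: "complex \<times> complex \<Rightarrow> real"
  assumes f: "f \<in> L2_M" "\<And>k. inner_M (ch k) f = 0" and G: "continuous_on UNIV G"
  shows "(\<integral>x. of_real (G (torus x)) * (cnj (ch 0 x) * f x) \<partial>cell) = 0"
proof -
  define g where "g x = cnj (ch 0 x) * f x" for x
  have g: "integrable cell g" unfolding g_def by (intro L2_M_integrable_mult f ch_L2_M)
  have Gm: "(\<lambda>x. complex_of_real (G (torus x))) \<in> borel_measurable cell"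
    by (intro continuous_imp_measurable_on_sets_lebesgue continuous_intros continuous_on_compose2[OF G]) auto
  have nt: "norm (torus x) \<le> 2" for x
    unfolding torus_def norm_Pair by simp (smt (verit) real_sqrt_four real_sqrt_less_mono)
  have small: "norm (\<integral>x. of_real (G (torus x)) * g x \<partial>cell) \<le> e * (\<integral>x. norm (g x) \<partial>cell)" if e: "e > 0" for e
  proof -
    obtain q where q: "real_polynomial_function q" "\<And>z. z \<in> cball 0 2 \<Longrightarrow> \<bar>G z - q z\<bar> < e"
      using Stone_Weierstrass_real_polynomial_function[OF compact_cball continuous_on_subset[OF G] e] by blast
    have "trig_poly (\<lambda>x. of_real (q (torus x)) * cnj (ch 0 x))"
      by (intro trig_poly_polynomial q trig_poly.base)
    from trig_poly_orthogonal[OF this f] 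
    have qi: "integrable cell (\<lambda>x. of_real (q (torus x)) * g x)" "(\<integral>x. of_real (q (torus x)) * g x \<partial>cell) = 0"
      by (simp_all add: g_def mult.assoc)
    have b: "norm (of_real (G (torus x)) * g x - of_real (q (torus x)) * g x) \<le> e * norm (g x)" for x
    proof -
      have "norm (of_real (G (torus x)) * g x - of_real (q (torus x)) * g x) = \<bar>G (torus x) - q (torus x)\<bar> * norm (g x)"
        by (simp flip: left_diff_distrib of_real_diff add: norm_mult)
      also have "\<dots> \<le> e * norm (g x)"
        using q(2)[of "torus x"] nt[of x] by (intro mult_right_mono) auto
      finally show ?thesis .
    qed
    have d: "integrable cell (\<lambda>x. of_real (G (torus x)) * g x - of_real (q (torus x)) * g x)"
      by (rule Bochner_Integration.integrable_bound[of _ "\<lambda>x. e * norm (g x)"])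
         (use g qi Gm b e in \<open>auto intro!: borel_measurable_diff borel_measurable_times\<close>)
    have Gi: "integrable cell (\<lambda>x. of_real (G (torus x)) * g x)"
      using Bochner_Integration.integrable_add[OF d qi(1)] by simp
    have "(\<integral>x. of_real (G (torus x)) * g x \<partial>cell) = (\<integral>x. of_real (G (torus x)) * g x - of_real (q (torus x)) * g x \<partial>cell)"
      by (subst Bochner_Integration.integral_diff[OF Gi qi(1)]) (simp add: qi)
    also have "norm \<dots> \<le> (\<integral>x. e * norm (g x) \<partial>cell)"
      by (rule order_trans[OF integral_norm_bound]) (intro integral_mono integrable_norm d b integrable_mult_right g)
    finally show ?thesis by simp
  qed
  show ?thesis
  proof (rule ccontr)
    let ?I = "norm (\<integral>x. of_real (G (torus x)) * g x \<partial>cell)" and ?J = "\<integral>x. norm (g x) \<partial>cell"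
    assume "\<not> ?thesis"
    then have I: "?I > 0" by (simp add: g_def)
    have J: "?J \<ge> 0" by simp
    \<comment> \<open>The tolerance is chosen so that the error is at most half of the integral; 1
      is added to the denominator because the L1 norm \<open>?J\<close> may be zero.\<close>
    have "?I \<le> ?I / (2 * (?J + 1)) * ?J" by (rule small) (use I J in \<open>auto intro!: divide_pos_pos add_nonneg_pos\<close>)
    also have "\<dots> \<le> ?I / 2"
    proof -
      have "a / (2 * (b + 1)) * b \<le> a / 2" if "0 < a" "0 \<le> b" for a b :: real
        using that by (simp add: divide_simps)
      from this[OF I J] show ?thesis .
    qed
    finally show False using I by simp
  qed
qed

text \<open>One of the points must lie in the open cell, since opposite edges of the closed cell
  have the same image.\<close>

lemma torus_inj:
  assumes "x \<in> cbox 0 1" "y \<in> box 0 1" "torus x = torus y"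
  shows "x = y"
proof -
  have "x $ i = y $ i" for i
  proof -
    have "exp (\<i> * of_real (2 * pi * x $ i)) = exp (\<i> * of_real (2 * pi * y $ i))"
      using assms(3) exhaust_2[of i] by (auto simp: torus_def)
    then obtain n :: int where "\<i> * of_real (2 * pi * x $ i) = \<i> * of_real (2 * pi * y $ i) + of_int (2 * n) * pi * \<i>"
      unfolding exp_eq by auto
    then have "2 * pi * x $ i = 2 * pi * y $ i + 2 * of_int n * pi"
      by (simp add: complex_eq_iff)
    then have "2 * pi * x $ i = 2 * pi * (y $ i + of_int n)" by (simp add: algebra_simps)
    then have n: "x $ i = y $ i + of_int n" by simp
    have "0 \<le> x $ i" "x $ i \<le> 1" "0 < y $ i" "y $ i < 1" using assms(1,2) by (auto simp: mem_box_cart)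
    then have "n = 0" using n by linarith
    then show ?thesis using n by simp
  qed
  then show ?thesis by (simp add: vec_eq_iff)
qed

lemma compact_sets_cell:
  assumes "compact K" "K \<subseteq> box 0 1"
  shows "K \<in> sets cell"
  using order_trans[OF assms(2) box_subset_cbox] assms(1)
  by (simp add: sets_restrict_space_iff lmeasurable_compact fmeasurableD)

text \<open>By \<open>torus_inj\<close> the image of \<open>K\<close> contains the image of no other
  point of the closed cell. Hence the indicator of \<open>K\<close> is a pointwise limit of
  continuous functions of the torus variable, namely cut-offs of the distance to that image, and
  dominated convergence applies.\<close>

lemma compact_orthogonal:
  assumes f: "f \<in> L2_M" "\<And>k. inner_M (ch k) f = 0" and K: "compact K" "K \<subseteq> box 0 1"
  shows "(\<integral>x. indicator K x *\<^sub>R (cnj (ch 0 x) * f x) \<partial>cell) = 0"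
proof (cases "K = {}")
  case False
  define g where "g x = cnj (ch 0 x) * f x" for x
  have g: "integrable cell g" unfolding g_def by (intro L2_M_integrable_mult f ch_L2_M)
  define C where "C = torus ` K"
  have C: "closed C" "C \<noteq> {}"
    unfolding C_def using False by (auto intro!: compact_imp_closed compact_continuous_image continuous_torus K)
  define G where "G n z = max 0 (1 - real n * infdist z C)" for n z
  have G01: "0 \<le> G n z" "G n z \<le> 1" for n z by (auto simp: G_def infdist_nonneg)
  have Gc: "continuous_on S (G n)" for n S unfolding G_def by (intro continuous_intros continuous_on_infdist)
  have lim: "(\<lambda>n. G n (torus x)) \<longlonglongrightarrow> indicator K x" if x: "x \<in> cbox 0 1" for x
  proof (cases "x \<in> K")
    case True
    then have "infdist (torus x) C = 0" unfolding C_def by simp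
    then show ?thesis using True by (simp add: G_def)
  next
    case False
    have "torus x \<notin> C"
    proof
      assume "torus x \<in> C"
      then obtain y where "y \<in> K" "torus x = torus y" by (auto simp: C_def)
      with torus_inj[OF x, of y] K(2) False show False by auto
    qed
    then have pos: "infdist (torus x) C > 0"
      using in_closed_iff_infdist_zero[OF C] infdist_nonneg by (metis less_eq_real_def)
    obtain N where N: "1 < real N * infdist (torus x) C" using reals_Archimedean3[OF pos] by blast
    have "eventually (\<lambda>n. G n (torus x) = 0) sequentially"
      using eventually_ge_at_top[of N]
    proof eventually_elim
      case (elim n)
      then have "real N * infdist (torus x) C \<le> real n * infdist (torus x) C" by (intro mult_right_mono) (auto simp: infdist_nonneg)
      with N show ?case by (simp add: G_def)
    qed
    then show ?thesis using False by (simp add: tendsto_eventually)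
  qed
  have Gm: "(\<lambda>x. complex_of_real (G n (torus x))) \<in> borel_measurable cell" for n
    by (intro continuous_imp_measurable_on_sets_lebesgue continuous_intros continuous_on_compose2[OF Gc]) auto
  have Km: "K \<in> sets cell" by (rule compact_sets_cell[OF K])
  have "(\<lambda>n. \<integral>x. of_real (G n (torus x)) * g x \<partial>cell) \<longlonglongrightarrow> (\<integral>x. indicator K x *\<^sub>R g x \<partial>cell)"
  proof (rule integral_dominated_convergence[where w = "\<lambda>x. norm (g x)"])
    show "(\<lambda>x. indicator K x *\<^sub>R g x) \<in> borel_measurable cell" using g Km by measurable
    show "(\<lambda>x. of_real (G n (torus x)) * g x) \<in> borel_measurable cell" for n
      using Gm g by (intro borel_measurable_times) auto
    show "AE x in cell. (\<lambda>n. of_real (G n (torus x)) * g x) \<longlonglongrightarrow> indicator K x *\<^sub>R g x"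
    proof (rule AE_I2)
      fix x assume "x \<in> space cell"
      then have "(\<lambda>n. of_real (G n (torus x)) * g x) \<longlonglongrightarrow> of_real (indicator K x) * g x"
        by (intro tendsto_intros lim) auto
      then show "(\<lambda>n. of_real (G n (torus x)) * g x) \<longlonglongrightarrow> indicator K x *\<^sub>R g x" by (simp add: scaleR_conv_of_real)
    qed
    show "AE x in cell. norm (of_real (G n (torus x)) * g x) \<le> norm (g x)" for n
      using G01 by (auto simp: norm_mult mult_left_le_one_le)
    show "integrable cell (\<lambda>x. norm (g x))" using g by simp
  qed
  moreover have "(\<integral>x. of_real (G n (torus x)) * g x \<partial>cell) = 0" for n
    unfolding g_def by (intro torus_orthogonal f Gc)
  ultimately show ?thesis by (simp add: g_def LIMSEQ_const_iff)
qed simp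

text \<open>Up to a null set the set where \<open>h > 0\<close> is a countable union of compact sets, each of which is null.\<close>

lemma AE_nonpos_of_compact:
  fixes h :: "real^2 \<Rightarrow> real"
  assumes h: "integrable cell h" 
    and z: "\<And>K. compact K \<Longrightarrow> K \<subseteq> box 0 1 \<Longrightarrow> (\<integral>x. indicator K x * h x \<partial>cell) = 0"
  shows "AE x in cell. h x \<le> 0"
proof -
  define S where "S = {x \<in> box 0 1. h x > 0}"
  have hm: "h \<in> borel_measurable cell" using h by simp
  have "S \<in> sets cell"
  proof -
    have "{x \<in> space cell. h x > 0} \<in> sets cell" using hm by measurable
    moreover have "box 0 1 \<in> sets cell" by (auto simp: sets_restrict_space_iff box_subset_cbox)
    ultimately have "{x \<in> space cell. h x > 0} \<inter> box 0 1 \<in> sets cell" by (rule sets.Int)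
    moreover have "{x \<in> space cell. h x > 0} \<inter> box 0 1 = S"
      using box_subset_cbox by (auto simp: S_def)
    ultimately show ?thesis by simp
  qed
  then have "S \<in> sets lebesgue" by (auto simp: sets_restrict_space_iff)
  obtain C T where CT: "fsigma C" "T \<in> null_sets lebesgue" "C \<union> T = S"
    using lebesgue_set_almost_fsigma[OF \<open>S \<in> sets lebesgue\<close>] by blast
  obtain F :: "nat \<Rightarrow> (real^2) set" where F: "\<And>n. compact (F n)" "C = (\<Union>n. F n)"
    using CT(1) unfolding fsigma_Union_compact by (metis image_subset_iff mem_Collect_eq UNIV_I)
  have "AE x in lebesgue. x \<notin> F n" for n
  proof -
    have sub: "F n \<subseteq> S" using F CT by auto
    then have sub': "F n \<subseteq> box 0 1" by (auto simp: S_def)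
    have Km: "F n \<in> sets cell" by (rule compact_sets_cell[OF F(1) sub'])
    have pos: "0 \<le> indicator (F n) x * h x" for x using sub by (auto simp: indicator_def S_def)
    have int: "integrable cell (\<lambda>x. indicator (F n) x * h x)"
      using integrable_mult_indicator[OF Km h] by simp
    have "AE x in cell. indicator (F n) x * h x = 0"
      using integral_nonneg_eq_0_iff_AE[OF int] z[OF F(1) sub'] pos by simp
    then have "AE x in lebesgue. x \<in> cbox 0 1 \<longrightarrow> indicator (F n) x * h x = 0" by (simp add: AE_cell_iff)
    then show ?thesis
      by eventually_elim (use sub sub' box_subset_cbox[of 0 "1::real^2"] in \<open>force simp: indicator_def S_def\<close>)
  qed
  then have "AE x in lebesgue. \<forall>n. x \<notin> F n" by (simp add: AE_all_countable)
  moreover have "AE x in lebesgue. x \<notin> T" using CT(2) by (rule AE_not_in)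
  \<comment> \<open>The boundary of the cell is a null set, so testing with compact subsets of the
    open cell suffices.\<close>
  moreover have "AE x in lebesgue. x \<notin> cbox 0 1 - box 0 (1::real^2)"
    using negligible_frontier_interval by (intro AE_not_in) (simp add: negligible_iff_null_sets)
  ultimately have "AE x in lebesgue. x \<in> cbox 0 1 \<longrightarrow> h x \<le> 0"
  proof eventually_elim
    case (elim x)
    then have "x \<notin> S" using CT(3) F(2) by blast
    with elim show ?case unfolding S_def by fastforce
  qed
  then show ?thesis by (simp add: AE_cell_iff)
qed

lemma ch_complete:
  assumes f: "f \<in> L2_M" "\<And>k. inner_M (ch k) f = 0"
  shows "AE x in lebesgue. f x = 0"
proof -
  define g where "g x = cnj (ch 0 x) * f x" for x
  have g: "integrable cell g" unfolding g_def by (intro L2_M_integrable_mult f ch_L2_M)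
  have z: "(\<integral>x. T (indicator K x *\<^sub>R g x) \<partial>cell) = 0" if T: "bounded_linear T" and K: "compact K" "K \<subseteq> box 0 1" for K T
  proof -
    have Km: "K \<in> sets cell" by (rule compact_sets_cell[OF K])
    show ?thesis
      using integral_bounded_linear[OF T integrable_mult_indicator[OF Km g]] compact_orthogonal[OF f K]
      by (simp add: g_def linear_simps(3)[OF T])
  qed
  \<comment> \<open>Applied to the real part, the imaginary part and their negatives, the four
    one-sided inequalities force \<open>g\<close> to vanish.\<close>
  have a: "AE x in cell. T (g x) \<le> 0" if T: "bounded_linear T" for T :: "complex \<Rightarrow> real"
    using z[OF T] by (intro AE_nonpos_of_compact integrable_bounded_linear[OF T g]) (simp_all add: linear_simps[OF T])
  have "AE x in cell. f x = 0"
    using a[OF bounded_linear_Re] a[OF bounded_linear_Im] a[OF bounded_linear_minus[OF bounded_linear_Re]]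
      a[OF bounded_linear_minus[OF bounded_linear_Im]]
  proof eventually_elim
    case (elim x)
    then have "g x = 0" by (auto simp: complex_eq_iff)
    moreover have "ch 0 x \<noteq> 0" by (metis norm_ch norm_zero zero_neq_one)
    ultimately show ?case by (simp add: g_def)
  qed
  then show ?thesis by (rule AE_zero_of_cell[OF f(1)])
qed

section \<open>Fourier expansions\<close>

definition fc :: "(real^2 \<Rightarrow> complex) \<Rightarrow> int \<times> int \<Rightarrow> complex" where
  "fc f k = inner_M (ch k) f"

definition nrm2 :: "(real^2 \<Rightarrow> complex) \<Rightarrow> real" where
  "nrm2 f = (\<integral>x. (norm (f x))\<^sup>2 \<partial>cell)"

lemma nrm2_nonneg [simp]: "nrm2 f \<ge> 0"
  by (simp add: nrm2_def)

lemma inner_M_self_nrm2: "inner_M f f = of_real (nrm2 f)"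
  by (simp add: inner_M_self nrm2_def)

lemma fc_add: "f \<in> L2_M \<Longrightarrow> g \<in> L2_M \<Longrightarrow> fc (\<lambda>x. f x + g x) k = fc f k + fc g k"
  and fc_diff: "f \<in> L2_M \<Longrightarrow> g \<in> L2_M \<Longrightarrow> fc (\<lambda>x. f x - g x) k = fc f k - fc g k"
  and fc_scale: "fc (\<lambda>x. c * f x) k = c * fc f k"
  and fc_zero [simp]: "fc (\<lambda>x. 0) k = 0"
  and fc_sum: "(\<And>i. i \<in> I \<Longrightarrow> h i \<in> L2_M) \<Longrightarrow> fc (\<lambda>x. \<Sum>i\<in>I. h i x) k = (\<Sum>i\<in>I. fc (h i) k)"
  by (simp_all add: fc_def inner_M_add_right inner_M_diff_right inner_M_scale_right inner_M_uminus_right inner_M_sum_right)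

lemma fc_ch: "fc (ch l) k = (if k = l then 1 else 0)"
  by (simp add: fc_def ch_orthonormal)

lemma fc_cong_AE: "f \<in> L2_M \<Longrightarrow> AE x in lebesgue. f x = g x \<Longrightarrow> fc g k = fc f k"
  unfolding fc_def by (intro inner_M_cong_AE) (auto intro: L2_M_cong_AE)

lemma fc_eq_imp_AE_eq:
  assumes "f \<in> L2_M" "g \<in> L2_M" "\<And>k. fc f k = fc g k"
  shows "AE x in lebesgue. f x = g x"
proof -
  have "AE x in lebesgue. f x - g x = 0"
    by (intro ch_complete L2_M_diff assms(1,2)) (use assms fc_diff[OF assms(1,2)] in \<open>auto simp: fc_def\<close>)
  then show ?thesis by simp
qed

definition trig_sum :: "(int \<times> int) set \<Rightarrow> (int \<times> int \<Rightarrow> complex) \<Rightarrow> real^2 \<Rightarrow> complex" where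
  "trig_sum F c x = (\<Sum>k\<in>F. c k * ch k x)"

lemma trig_sum_L2_M [simp]: "trig_sum F c \<in> L2_M"
  unfolding trig_sum_def[abs_def] by (intro L2_M_sum L2_M_scale ch_L2_M)

lemma inner_trig_sum: 
  assumes "f \<in> L2_M"
  shows "inner_M (trig_sum F c) f = (\<Sum>k\<in>F. cnj (c k) * fc f k)"
  unfolding trig_sum_def[abs_def] fc_def
  by (subst inner_M_sum_left) (simp_all add: assms L2_M_scale inner_M_scale_left)

lemma fc_trig_sum: "finite F \<Longrightarrow> fc (trig_sum F c) k = (if k \<in> F then c k else 0)"
  unfolding trig_sum_def[abs_def] 
  by (subst fc_sum) (simp_all add: L2_M_scale fc_scale fc_ch if_distrib sum.delta cong: if_cong)

lemma nrm2_trig_sum: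
  assumes "finite F"
  shows "nrm2 (trig_sum F c) = (\<Sum>k\<in>F. (norm (c k))\<^sup>2)"
proof -
  have "complex_of_real (nrm2 (trig_sum F c)) = of_real (\<Sum>k\<in>F. (norm (c k))\<^sup>2)"
    unfolding inner_M_self_nrm2[symmetric] inner_trig_sum[OF trig_sum_L2_M]
    by (simp add: fc_trig_sum assms complex_norm_square mult.commute del: of_real_power)
  then show ?thesis by (simp only: of_real_eq_iff)
qed

lemma trig_sum_Diff:
  "finite G \<Longrightarrow> F \<subseteq> G \<Longrightarrow> trig_sum G c x - trig_sum F c x = trig_sum (G - F) c x"
  by (simp add: trig_sum_def sum_diff)

lemma Bessel:
  assumes f: "f \<in> L2_M" and F: "finite F"
  shows "(\<Sum>k\<in>F. (norm (fc f k))\<^sup>2) \<le> nrm2 f"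
proof -
  define S where "S = trig_sum F (fc f)"
  have S: "S \<in> L2_M" by (simp add: S_def)
  have d: "(\<lambda>x. f x - S x) \<in> L2_M" by (intro L2_M_diff f S)
  have Sf: "inner_M S f = of_real (\<Sum>k\<in>F. (norm (fc f k))\<^sup>2)"
    unfolding S_def inner_trig_sum[OF f] by (simp add: complex_norm_square mult.commute del: of_real_power)
  then have fS: "inner_M f S = of_real (\<Sum>k\<in>F. (norm (fc f k))\<^sup>2)"
    using inner_M_cnj[of S f] by simp
  have SS: "inner_M S S = of_real (\<Sum>k\<in>F. (norm (fc f k))\<^sup>2)"
    unfolding inner_M_self_nrm2 by (simp add: S_def nrm2_trig_sum F)
  have "inner_M (\<lambda>x. f x - S x) (\<lambda>x. f x - S x) = inner_M (\<lambda>x. f x - S x) f - inner_M (\<lambda>x. f x - S x) S"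
    by (intro inner_M_diff_right d f S)
  also have "\<dots> = cnj (inner_M f (\<lambda>x. f x - S x)) - cnj (inner_M S (\<lambda>x. f x - S x))"
    by (simp add: inner_M_cnj)
  also have "\<dots> = inner_M f f - of_real (\<Sum>k\<in>F. (norm (fc f k))\<^sup>2)"
    by (simp add: inner_M_diff_right f S Sf fS SS inner_M_cnj)
  finally have "complex_of_real (nrm2 (\<lambda>x. f x - S x)) = of_real (nrm2 f - (\<Sum>k\<in>F. (norm (fc f k))\<^sup>2))"
    by (simp add: inner_M_self_nrm2)
  then have "nrm2 (\<lambda>x. f x - S x) = nrm2 f - (\<Sum>k\<in>F. (norm (fc f k))\<^sup>2)"
    by (simp only: of_real_eq_iff)
  with nrm2_nonneg[of "\<lambda>x. f x - S x"] show ?thesis by linarith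
qed

lemma fc_square_summable: "f \<in> L2_M \<Longrightarrow> (\<lambda>k. (norm (fc f k))\<^sup>2) summable_on UNIV"
  by (rule nonneg_bdd_above_summable_on) (auto intro!: bdd_aboveI[of _ "nrm2 f"] Bessel)

lemma inner_M_Cauchy_Schwarz:
  assumes f: "f \<in> L2_M" and g: "g \<in> L2_M"
  shows "norm (inner_M f g) \<le> sqrt (nrm2 f) * sqrt (nrm2 g)"
proof -
  note [measurable] = f[THEN L2_M_measurable_cell] g[THEN L2_M_measurable_cell]
  have i: "integrable cell (\<lambda>x. norm (f x) * norm (g x))"
    using integrable_norm[OF L2_M_integrable_mult[OF f g]] by (simp add: norm_mult)
  have "norm (inner_M f g) \<le> (\<integral>x. norm (f x) * norm (g x) \<partial>cell)"
    unfolding inner_M_eq by (rule order_trans[OF integral_norm_bound]) (simp add: norm_mult)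
  also have "\<dots> \<le> sqrt (nrm2 f) * sqrt (nrm2 g)"
  proof -
    have e: "(\<integral>\<^sup>+x. (ennreal (norm (h x)))\<^sup>2 \<partial>cell) = ennreal (nrm2 h)" if "h \<in> L2_M" for h
      using L2_M_square_integrable[OF that] unfolding nrm2_def
      by (subst nn_integral_eq_integral[symmetric]) (auto simp: ennreal_power)
    have "(\<integral>\<^sup>+x. ennreal (norm (f x)) * ennreal (norm (g x)) \<partial>cell) = ennreal (\<integral>x. norm (f x) * norm (g x) \<partial>cell)"
      by (subst nn_integral_eq_integral[symmetric]) (auto simp: i ennreal_mult)
    moreover have "(\<integral>\<^sup>+x. ennreal (norm (f x)) * ennreal (norm (g x)) \<partial>cell)\<^sup>2 \<le> 
       (\<integral>\<^sup>+x. (ennreal (norm (f x)))\<^sup>2 \<partial>cell) * (\<integral>\<^sup>+x. (ennreal (norm (g x)))\<^sup>2 \<partial>cell)"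
      by (rule Cauchy_Schwarz_nn_integral) measurable
    ultimately have "(\<integral>x. norm (f x) * norm (g x) \<partial>cell)\<^sup>2 \<le> nrm2 f * nrm2 g"
      unfolding e[OF f] e[OF g] by (simp add: ennreal_power flip: ennreal_mult)
    then show ?thesis by (simp add: real_le_rsqrt flip: real_sqrt_mult)
  qed
  finally show ?thesis .
qed

lemma AE_of_cell:
  assumes z: "AE x in cell. P x" and per: "\<And>x v. v \<in> \<Lambda> \<Longrightarrow> P x \<Longrightarrow> P (x + v)"
  shows "AE x in lebesgue. P x"
proof -
  have "AE x in lebesgue. \<forall>v\<in>\<Lambda>. x - v \<in> cbox 0 1 \<longrightarrow> P (x - v)"
    using AE_lebesgue_translate[OF z[unfolded AE_cell_iff], of "- v" for v]
    by (subst AE_ball_countable[OF countable_lattice]) simp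
  then show ?thesis
  proof eventually_elim
    case (elim x)
    then have "P (x - floor_vec x)" using floor_vec_lattice[of x] floor_vec_cell[of x] by blast
    from per[OF floor_vec_lattice[of x] this] show ?case by simp
  qed
qed

lemma trig_sum_quasi_periodic: "v \<in> \<Lambda> \<Longrightarrow> trig_sum F c (x + v) = phase v * trig_sum F c x"
  by (simp add: trig_sum_def ch_quasi_periodic sum_distrib_left mult_ac)

text \<open>The tails decay like 4^-n so that, after weighting with 2^n, a convergent geometric
  series is left; this is what almost everywhere convergence of the partial sums over
  \<open>G n\<close> rests on.\<close>

lemma exhausting_subsets:
  assumes c: "(\<lambda>k. (norm (c k))\<^sup>2) summable_on (UNIV :: (int \<times> int) set)"
  obtains G :: "nat \<Rightarrow> (int \<times> int) set" where "\<And>n. finite (G n)" "incseq G" "(\<Union>n. G n) = UNIV"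
    "\<And>n F. finite F \<Longrightarrow> F \<inter> G n = {} \<Longrightarrow> (\<Sum>k\<in>F. (norm (c k :: complex))\<^sup>2) \<le> (1/4) ^ n"
proof -
  let ?s = "\<lambda>k. (norm (c k))\<^sup>2"
  have "\<exists>X. finite X \<and> (\<forall>F. finite F \<longrightarrow> F \<inter> X = {} \<longrightarrow> sum ?s F \<le> (1/4) ^ n)" for n :: nat
  proof -
    have "(sum ?s \<longlongrightarrow> infsum ?s UNIV) (finite_subsets_at_top UNIV)" by (rule infsum_tendsto[OF c])
    then have "\<forall>\<^sub>F X in finite_subsets_at_top UNIV. infsum ?s UNIV - (1/4) ^ n < sum ?s X"
      by (rule order_tendstoD) simp
    then obtain X where X: "finite X" "infsum ?s UNIV - (1/4) ^ n < sum ?s X"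
      unfolding eventually_finite_subsets_at_top by blast
    have "sum ?s F \<le> (1/4) ^ n" if F: "finite F" "F \<inter> X = {}" for F
    proof -
      have "sum ?s F + sum ?s X = sum ?s (F \<union> X)" using F X by (simp add: sum.union_disjoint)
      also have "\<dots> \<le> infsum ?s UNIV" by (rule finite_sum_le_infsum[OF c]) (use F X in auto)
      finally show ?thesis using X by linarith
    qed
    then show ?thesis using X by blast
  qed
  then obtain X where X: "\<And>n. finite (X n)" "\<And>n F. finite F \<Longrightarrow> F \<inter> X n = {} \<Longrightarrow> sum ?s F \<le> (1/4) ^ n"
    by metis
  \<comment> \<open>The growing squares exhaust all indices and the union over i up to n makes the
    sets increase. Enlarging \<open>X n\<close> keeps the tail bound, which concerns every finite
    set disjoint from it.\<close>
  define G where "G n = {- int n..int n} \<times> {- int n..int n} \<union> (\<Union>i\<le>n. X i)" for n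
  show ?thesis
  proof
    show "finite (G n)" for n using X by (simp add: G_def)
    show "incseq G" unfolding G_def incseq_def by force
    show "(\<Union>n. G n) = UNIV"
    proof (intro equalityI subsetI)
      fix k :: "int \<times> int"
      have "k \<in> G (nat (\<bar>fst k\<bar> + \<bar>snd k\<bar>))" by (cases k) (auto simp: G_def)
      then show "k \<in> (\<Union>n. G n)" by blast
    qed simp
    show "sum ?s F \<le> (1/4) ^ n" if "finite F" "F \<inter> G n = {}" for n F
      using that by (intro X(2)) (auto simp: G_def)
  qed
qed

text \<open>Both modes of convergence along the sets \<open>G n\<close> are exported: convergence
  almost everywhere identifies \<open>f\<close> with a pointwise Fourier series in
  \<open>continuous_representative\<close>, and convergence in norm yields
  \<open>Parseval\<close>.\<close>

theorem Riesz_Fischer: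
  assumes c: "(\<lambda>k. (norm (c k :: complex))\<^sup>2) summable_on UNIV"
  obtains f G where "f \<in> L2_M" "\<And>k. fc f k = c k"
    "\<And>n. finite (G n :: (int \<times> int) set)" "filterlim G (finite_subsets_at_top UNIV) sequentially"
    "AE x in lebesgue. (\<lambda>n. trig_sum (G n) c x) \<longlonglongrightarrow> f x"
    "(\<lambda>n. nrm2 (\<lambda>x. f x - trig_sum (G n) c x)) \<longlonglongrightarrow> 0"
proof -
  obtain G where G: "\<And>n. finite (G n)" "incseq G" "(\<Union>n. G n) = UNIV"
    "\<And>n F. finite F \<Longrightarrow> F \<inter> G n = {} \<Longrightarrow> (\<Sum>k\<in>F. (norm (c k))\<^sup>2) \<le> (1/4) ^ n"
    using exhausting_subsets[OF c] by metis
  have Gmono: "m \<le> n \<Longrightarrow> G m \<subseteq> G n" for m n using G(2) by (simp add: incseq_def)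
  have Glim: "filterlim G (finite_subsets_at_top UNIV) sequentially"
    unfolding filterlim_finite_subsets_at_top
  proof (intro allI impI)
    fix X :: "(int \<times> int) set" assume "finite X \<and> X \<subseteq> UNIV"
    then have "finite X" by simp
    then obtain N where "X \<subseteq> G N"
    proof (induction X arbitrary: thesis)
      case (insert a X)
      obtain N where N: "X \<subseteq> G N" using insert.IH by blast
      obtain m where m: "a \<in> G m" using G(3) by blast
      have "insert a X \<subseteq> G (max m N)" using N m Gmono[of m "max m N"] Gmono[of N "max m N"] by auto
      then show ?case using insert.prems by blast
    qed simp
    then show "\<forall>\<^sub>F n in sequentially. finite (G n) \<and> X \<subseteq> G n \<and> G n \<subseteq> UNIV"
      using G(1) Gmono[of N] by (intro eventually_mono[OF eventually_ge_at_top[of N]]) blast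
  qed
  define S where "S n = trig_sum (G n) c" for n
  have S [simp]: "S n \<in> L2_M" for n by (simp add: S_def)
  note [measurable] = S[THEN L2_M_measurable] S[THEN L2_M_measurable_cell]
  have dS: "nrm2 (\<lambda>x. S m x - S n x) \<le> (1/4) ^ n" if "n \<le> m" for m n
  proof -
    have "(\<lambda>x. S m x - S n x) = trig_sum (G m - G n) c"
      using trig_sum_Diff[OF G(1) Gmono[OF that]] by (auto simp: S_def)
    then have "nrm2 (\<lambda>x. S m x - S n x) = (\<Sum>k\<in>G m - G n. (norm (c k))\<^sup>2)"
      using G(1) by (simp add: nrm2_trig_sum)
    also have "\<dots> \<le> (1/4) ^ n" using G(1) by (intro G(4)) auto
    finally show ?thesis .
  qed
  have nn: "(\<integral>\<^sup>+x. ennreal ((norm (h x))\<^sup>2) \<partial>cell) = ennreal (nrm2 h)" if "h \<in> L2_M" for h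
    unfolding nrm2_def by (rule nn_integral_eq_integral) (use L2_M_square_integrable[OF that] in auto)
  define D where "D n x = S (Suc n) x - S n x" for n x
  have D [simp]: "D n \<in> L2_M" for n unfolding D_def[abs_def] by (intro L2_M_diff S)
  note [measurable] = D[THEN L2_M_measurable] D[THEN L2_M_measurable_cell]
  \<comment> \<open>The squared norms of the increments are at most 4^-n, so the series weighted by
    2^n still has a finite integral and is finite almost everywhere.\<close>
  have "AE x in cell. (\<Sum>n. ennreal (2 ^ n * (norm (D n x))\<^sup>2)) \<noteq> \<infinity>"
  proof (rule nn_integral_noteq_infinite)
    have "(\<integral>\<^sup>+x. (\<Sum>n. ennreal (2 ^ n * (norm (D n x))\<^sup>2)) \<partial>cell) = (\<Sum>n. \<integral>\<^sup>+x. ennreal (2 ^ n * (norm (D n x))\<^sup>2) \<partial>cell)"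
      by (rule nn_integral_suminf) measurable
    also have "\<dots> = (\<Sum>n. ennreal (2 ^ n) * ennreal (nrm2 (D n)))"
      by (subst nn[symmetric], simp) (simp add: ennreal_mult nn_integral_cmult)
    also have "\<dots> \<le> (\<Sum>n. ennreal ((1/2) ^ n))"
    proof (intro suminf_le summableI)
      fix n
      have "2 ^ n * nrm2 (D n) \<le> 2 ^ n * (1/4) ^ n"
        using dS[of n "Suc n"] by (intro mult_left_mono) (auto simp: D_def[abs_def])
      also have "\<dots> = (1/2) ^ n" by (simp flip: power_mult_distrib)
      finally show "ennreal (2 ^ n) * ennreal (nrm2 (D n)) \<le> ennreal ((1/2) ^ n)"
        by (simp add: ennreal_leI flip: ennreal_mult)
    qed
    also have "\<dots> < \<infinity>" 
      by (subst suminf_ennreal2) (auto intro: summable_geometric)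
    finally show "(\<integral>\<^sup>+x. (\<Sum>n. ennreal (2 ^ n * (norm (D n x))\<^sup>2)) \<partial>cell) \<noteq> \<infinity>" by simp
  qed measurable
  then have "AE x in cell. convergent (\<lambda>n. S n x)"
  proof eventually_elim
    case (elim x)
    then have "summable (\<lambda>n. 2 ^ n * (norm (D n x))\<^sup>2)"
      by (intro summable_suminf_not_top) auto
    then have s: "summable (\<lambda>n. (1/2) ^ n + 2 ^ n * (norm (D n x))\<^sup>2)"
      by (intro summable_add summable_geometric) auto
    \<comment> \<open>By the inequality between arithmetic and geometric means, summability of the
      weighted squares gives absolute summability of the increments.\<close>
    have "norm (D n x) \<le> (1/2) ^ n + 2 ^ n * (norm (D n x))\<^sup>2" for n
    proof -
      define a where "a = (1/2 :: real) ^ n"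
      have a: "a > 0" "2 ^ n = 1 / a" by (simp_all add: a_def power_one_over)
      have "0 \<le> (a - norm (D n x) / 2)\<^sup>2 / a" using a by simp
      also have "\<dots> = a - norm (D n x) + (norm (D n x))\<^sup>2 / (4 * a)"
        using a by (simp add: power2_eq_square field_simps)
      also have "\<dots> \<le> a - norm (D n x) + (norm (D n x))\<^sup>2 / a"
        using a by (simp add: divide_simps)
      finally show ?thesis using a by (simp add: a_def[symmetric])
    qed
    then have "summable (\<lambda>n. D n x)" by (intro summable_comparison_test[OF _ s]) auto
    then have "(\<lambda>N. \<Sum>n<N. D n x) \<longlonglongrightarrow> (\<Sum>n. D n x)" by (rule summable_LIMSEQ)
    then have "(\<lambda>N. (\<Sum>n<N. D n x) + S 0 x) \<longlonglongrightarrow> (\<Sum>n. D n x) + S 0 x" by (intro tendsto_intros)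
    moreover have "(\<Sum>n<N. D n x) + S 0 x = S N x" for N
      unfolding D_def by (subst sum_lessThan_telescope) simp
    ultimately show ?case by (auto simp: convergent_def)
  qed
  moreover have Sper: "S n (x + v) = phase v * S n x" if "v \<in> \<Lambda>" for n x v
    using that by (simp add: S_def trig_sum_quasi_periodic)
  ultimately have conv: "AE x in lebesgue. convergent (\<lambda>n. S n x)"
    by (elim AE_of_cell) (auto simp: convergent_def intro: tendsto_mult_left)
  define f where "f x = lim (\<lambda>n. S n x)" for x
  have lim: "AE x in lebesgue. (\<lambda>n. S n x) \<longlonglongrightarrow> f x"
    using conv by eventually_elim (simp add: f_def convergent_LIMSEQ_iff)
  have fm [measurable]: "f \<in> borel_measurable lebesgue" unfolding f_def[abs_def] by measurable
  have fmc [measurable]: "f \<in> borel_measurable cell" by (rule measurable_cellI[OF fm])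
  have fper: "AE x in lebesgue. f (x + v) = phase v * f x" if v: "v \<in> \<Lambda>" for v
    using lim AE_lebesgue_translate[OF lim, of v]
  proof eventually_elim
    case (elim x)
    have "(\<lambda>n. S n (x + v)) \<longlonglongrightarrow> phase v * f x" unfolding Sper[OF v] by (intro tendsto_intros elim)
    from LIMSEQ_unique[OF elim(2) this] show ?case .
  qed
  \<comment> \<open>Fatou's lemma carries the Cauchy estimate to the limit; it yields membership of
    \<open>f\<close> in \<open>L2_M\<close> and convergence in norm at once.\<close>
  have fatou: "(\<integral>\<^sup>+x. ennreal ((norm (f x - S n x))\<^sup>2) \<partial>cell) \<le> ennreal ((1/4) ^ n)" for n
  proof -
    have "(\<integral>\<^sup>+x. ennreal ((norm (f x - S n x))\<^sup>2) \<partial>cell) = (\<integral>\<^sup>+x. liminf (\<lambda>m. ennreal ((norm (S m x - S n x))\<^sup>2)) \<partial>cell)"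
    proof (rule nn_integral_cong_AE, use AE_cellI[OF lim] in eventually_elim)
      case (elim x)
      then have "(\<lambda>m. ennreal ((norm (S m x - S n x))\<^sup>2)) \<longlonglongrightarrow> ennreal ((norm (f x - S n x))\<^sup>2)"
        by (intro tendsto_intros)
      from lim_imp_Liminf[OF sequentially_bot this] show ?case by (rule sym)
    qed
    also have "\<dots> \<le> liminf (\<lambda>m. \<integral>\<^sup>+x. ennreal ((norm (S m x - S n x))\<^sup>2) \<partial>cell)"
      by (rule nn_integral_liminf) measurable
    also have "\<dots> \<le> ennreal ((1/4) ^ n)"
    proof (rule Liminf_le[OF _ eventually_mono[OF eventually_ge_at_top[of n]]])
      fix m assume "n \<le> m"
      have "(\<integral>\<^sup>+x. ennreal ((norm (S m x - S n x))\<^sup>2) \<partial>cell) = ennreal (nrm2 (\<lambda>x. S m x - S n x))"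
        by (rule nn[OF L2_M_diff]) simp_all
      then show "(\<integral>\<^sup>+x. ennreal ((norm (S m x - S n x))\<^sup>2) \<partial>cell) \<le> ennreal ((1/4) ^ n)"
        using dS[OF \<open>n \<le> m\<close>] by (simp add: ennreal_leI)
    qed simp
    finally show ?thesis .
  qed
  have dL: "(\<lambda>x. f x - S n x) \<in> L2_M" for n
  proof (rule L2_M_I)
    show "integrable cell (\<lambda>x. (norm (f x - S n x))\<^sup>2)"
      using fatou[of n] by (intro integrableI_nonneg) (auto elim!: le_less_trans)
    show "AE x in lebesgue. f (x + v) - S n (x + v) = phase v * (f x - S n x)" if "v \<in> \<Lambda>" for v
      using fper[OF that] by eventually_elim (simp add: Sper[OF that] algebra_simps)
  qed measurable
  have f: "f \<in> L2_M" using L2_M_add[OF dL[of 0] S[of 0]] by simp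
  have est: "nrm2 (\<lambda>x. f x - S n x) \<le> (1/4) ^ n" for n
    using fatou[of n] nn[OF dL[of n]] by simp
  have to0: "(\<lambda>n. nrm2 (\<lambda>x. f x - S n x)) \<longlonglongrightarrow> 0"
    by (rule tendsto_sandwich[OF _ _ tendsto_const LIMSEQ_realpow_zero[of "1/4"]]) (auto simp: est)
  have "fc f k = c k" for k
  proof -
    obtain N where N: "k \<in> G N" using G(3) by blast
    have "(norm (fc f k - c k))\<^sup>2 \<le> nrm2 (\<lambda>x. f x - S n x)" if "n \<ge> N" for n
    proof -
      have "k \<in> G n" using N Gmono[OF that] by auto
      then have "fc (\<lambda>x. f x - S n x) k = fc f k - c k"
        by (simp add: fc_diff f fc_trig_sum G(1)) (simp add: S_def fc_trig_sum G(1))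
      with Bessel[OF dL[of n], of "{k}"] show ?thesis by simp
    qed
    then have "(norm (fc f k - c k))\<^sup>2 \<le> 0"
      by (intro LIMSEQ_le_const[OF to0]) auto
    then show ?thesis by simp
  qed
  with f G(1) Glim lim to0 that show ?thesis unfolding S_def by blast
qed

lemma norm_mult_summable_on:
  fixes a b :: "'i \<Rightarrow> complex"
  assumes "(\<lambda>k. (norm (a k))\<^sup>2) summable_on A" "(\<lambda>k. (norm (b k))\<^sup>2) summable_on A"
  shows "(\<lambda>k. norm (a k * b k)) summable_on A"
proof (rule Infinite_Sum.abs_summable_on_comparison_test)
  show "(\<lambda>k. norm ((norm (a k))\<^sup>2 + (norm (b k))\<^sup>2)) summable_on A"
    using summable_on_add[OF assms] by simp
  show "norm (a k * b k) \<le> norm ((norm (a k))\<^sup>2 + (norm (b k))\<^sup>2)" for k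
    using zero_le_power2[of "norm (a k) - norm (b k)"] mult_nonneg_nonneg[OF norm_ge_zero[of "a k"] norm_ge_zero[of "b k"]]
    unfolding power2_diff norm_mult real_norm_def by linarith
qed

text \<open>Completeness identifies \<open>f\<close> with the function that Riesz-Fischer builds
  from its coefficients. Norm convergence evaluates the sum along one sequence of finite sets, and
  absolute summability makes the unordered sum agree with that limit.\<close>

theorem Parseval:
  assumes f: "f \<in> L2_M" and g: "g \<in> L2_M"
  shows "((\<lambda>k. cnj (fc f k) * fc g k) has_sum inner_M f g) UNIV"
proof -
  obtain f' G where f': "f' \<in> L2_M" "\<And>k. fc f' k = fc f k"
    "\<And>n. finite (G n :: (int \<times> int) set)" and Glim: "filterlim G (finite_subsets_at_top UNIV) sequentially"
    and lim: "(\<lambda>n. nrm2 (\<lambda>x. f' x - trig_sum (G n) (fc f) x)) \<longlonglongrightarrow> 0"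
    by (rule Riesz_Fischer[OF fc_square_summable[OF f]]) (rule that)
  have ff': "inner_M f g = inner_M f' g"
    using fc_eq_imp_AE_eq[OF f f'(1)] f'(2) by (intro inner_M_cong_AE f f' g) auto
  define R where "R n x = f' x - trig_sum (G n) (fc f) x" for n x
  have R: "R n \<in> L2_M" for n unfolding R_def[abs_def] by (intro L2_M_diff f' trig_sum_L2_M)
  have "(\<lambda>n. inner_M (R n) g) \<longlonglongrightarrow> 0"
  proof (rule Lim_null_comparison)
    show "\<forall>\<^sub>F n in sequentially. norm (inner_M (R n) g) \<le> sqrt (nrm2 (R n)) * sqrt (nrm2 g)"
      using inner_M_Cauchy_Schwarz[OF R g] by simp
    show "(\<lambda>n. sqrt (nrm2 (R n)) * sqrt (nrm2 g)) \<longlonglongrightarrow> 0"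
      using tendsto_mult[OF tendsto_real_sqrt[OF lim] tendsto_const] by (simp add: R_def[abs_def])
  qed
  moreover have "inner_M (R n) g = inner_M f g - (\<Sum>k\<in>G n. cnj (fc f k) * fc g k)" for n
  proof -
    have "inner_M (R n) g = cnj (inner_M g (\<lambda>x. f' x - trig_sum (G n) (fc f) x))"
      by (simp add: inner_M_cnj R_def[abs_def])
    also have "\<dots> = inner_M f g - (\<Sum>k\<in>G n. cnj (fc f k) * fc g k)"
      using inner_trig_sum[OF g, of "G n" "fc f"]
      by (subst inner_M_diff_right) (simp_all add: g f' inner_M_cnj ff')
    finally show ?thesis .
  qed
  ultimately have "(\<lambda>n. inner_M f g - (inner_M f g - (\<Sum>k\<in>G n. cnj (fc f k) * fc g k))) \<longlonglongrightarrow> inner_M f g - 0"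
    by (intro tendsto_diff tendsto_const) simp
  then have l1: "(\<lambda>n. \<Sum>k\<in>G n. cnj (fc f k) * fc g k) \<longlonglongrightarrow> inner_M f g" by simp
  have s: "(\<lambda>k. cnj (fc f k) * fc g k) summable_on UNIV"
    using norm_mult_summable_on[OF fc_square_summable[OF f] fc_square_summable[OF g]]
    by (rule_tac Infinite_Sum.abs_summable_summable) (simp add: norm_mult)
  have "(\<lambda>n. \<Sum>k\<in>G n. cnj (fc f k) * fc g k) \<longlonglongrightarrow> (\<Sum>\<^sub>\<infinity>k. cnj (fc f k) * fc g k)"
    by (rule filterlim_compose[OF infsum_tendsto[OF s] Glim])
  from LIMSEQ_unique[OF this l1] show ?thesis using has_sum_infsum[OF s] by simp
qed

section \<open>Weak derivatives as Fourier multipliers\<close>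

text \<open>Characters are admissible test functions, which gives the multiplier. Conversely,
  Parseval turns the tested identity for an arbitrary smooth function into one that holds term by
  term.\<close>

lemma weak_pd_iff:
  "weak_pd r f g \<longleftrightarrow> f \<in> L2_M \<and> g \<in> L2_M \<and> (\<forall>k. fc g k = \<i> * of_real (xi k $ r) * fc f k)"
proof (intro iffI conjI allI)
  assume w: "weak_pd r f g"
  then show L: "f \<in> L2_M" "g \<in> L2_M" by (auto simp: weak_pd_def)
  fix k
  have "inner_M (pd r (ch k)) f = - inner_M (ch k) g"
    using w smooth_ch[of k] ch_L2_M[of k] by (auto simp: weak_pd_def)
  then show "fc g k = \<i> * of_real (xi k $ r) * fc f k"
    unfolding pd_ch inner_M_scale_left by (simp add: fc_def)
next
  assume a: "f \<in> L2_M \<and> g \<in> L2_M \<and> (\<forall>k. fc g k = \<i> * of_real (xi k $ r) * fc f k)"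
  have "inner_M (pd r \<phi>) f = - inner_M \<phi> g" if \<phi>: "\<phi> \<in> L2_M" "smooth \<phi>" for \<phi>
  proof (rule has_sum_unique)
    show "((\<lambda>k. cnj (fc (pd r \<phi>) k) * fc f k) has_sum inner_M (pd r \<phi>) f) UNIV"
      using a smooth_L2_M_pd(2)[OF \<phi>(2,1)] by (intro Parseval) auto
    have "((\<lambda>k. - (cnj (fc \<phi> k) * fc g k)) has_sum - inner_M \<phi> g) UNIV"
      using a \<phi> by (intro has_sum_uminusI Parseval) auto
    moreover have "cnj (fc (pd r \<phi>) k) * fc f k = - (cnj (fc \<phi> k) * fc g k)" for k
      using smooth_L2_M_pd(1)[OF \<phi>(2,1), of k r] conjunct2[OF conjunct2[OF a], THEN spec, of k] by (simp add: fc_def)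
    ultimately show "((\<lambda>k. cnj (fc (pd r \<phi>) k) * fc f k) has_sum - inner_M \<phi> g) UNIV" by simp
  qed
  with a show "weak_pd r f g" by (auto simp: weak_pd_def)
qed

lemma weak_pd_L2_M: "weak_pd r f g \<Longrightarrow> f \<in> L2_M" "weak_pd r f g \<Longrightarrow> g \<in> L2_M"
  by (auto simp: weak_pd_def)

lemma weak_pd_fc: "weak_pd r f g \<Longrightarrow> fc g k = \<i> * of_real (xi k $ r) * fc f k"
  unfolding weak_pd_iff by blast

lemma weak_pdI:
  "f \<in> L2_M \<Longrightarrow> g \<in> L2_M \<Longrightarrow> (\<And>k. fc g k = \<i> * of_real (xi k $ r) * fc f k) \<Longrightarrow> weak_pd r f g"
  unfolding weak_pd_iff by blast

text \<open>The multiplier is purely imaginary, so conjugation changes its sign; Parseval sums this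
  up and neither function has to be smooth.\<close>

lemma weak_pd_integration_by_parts:
  assumes "weak_pd r f g" "weak_pd r f' g'"
  shows "inner_M g f' = - inner_M f g'"
proof (rule has_sum_unique)
  show "((\<lambda>k. cnj (fc g k) * fc f' k) has_sum inner_M g f') UNIV"
    using assms by (intro Parseval) (auto dest: weak_pd_L2_M)
  have "((\<lambda>k. - (cnj (fc f k) * fc g' k)) has_sum - inner_M f g') UNIV"
    using assms by (intro has_sum_uminusI Parseval) (auto dest: weak_pd_L2_M)
  moreover have "cnj (fc g k) * fc f' k = - (cnj (fc f k) * fc g' k)" for k
    by (simp add: weak_pd_fc[OF assms(1)] weak_pd_fc[OF assms(2)])
  ultimately show "((\<lambda>k. cnj (fc g k) * fc f' k) has_sum - inner_M f g') UNIV" by simp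
qed

lemma weak_pd_wpd: "weak_pd r f g \<Longrightarrow> weak_pd r f (wpd r f)"
  unfolding wpd_def using someI[of "weak_pd r f" g] by simp

lemma weak_pd_cong_AE:
  assumes "f \<in> L2_M" "AE x in lebesgue. f x = f' x"
  shows "weak_pd r f' = weak_pd r f"
  using L2_M_cong_AE[OF assms] fc_cong_AE[OF assms] assms(1) by (auto simp: weak_pd_iff fun_eq_iff)

text \<open>Equality of functions and not merely almost everywhere: both \<open>SOME\<close> choices
  are made from the same predicate.\<close>

lemma wpd_cong_AE:
  assumes "f \<in> L2_M" "AE x in lebesgue. f x = f' x"
  shows "wpd r f' = wpd r f"
  unfolding wpd_def weak_pd_cong_AE[OF assms] ..

lemma H2_M_cong_AE:
  assumes "f \<in> H2_M" "AE x in lebesgue. f x = f' x"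
  shows "f' \<in> H2_M"
proof -
  have f: "f \<in> L2_M" using assms(1) by (simp add: H2_M_def)
  show ?thesis
    using assms(1) L2_M_cong_AE[OF f assms(2)] weak_pd_cong_AE[OF f assms(2)] wpd_cong_AE[OF f assms(2)]
    by (simp add: H2_M_def)
qed

lemma fc_wpd:
  assumes "weak_pd r f g"
  shows "wpd r f \<in> L2_M" "fc (wpd r f) k = \<i> * of_real (xi k $ r) * fc f k"
  using weak_pd_wpd[OF assms] by (auto dest: weak_pd_L2_M weak_pd_fc)

text \<open>\<open>en k\<close> is the symbol of \<open>-\<Delta>\<close>.\<close>

definition en :: "int \<times> int \<Rightarrow> real" where
  "en k = (xi k $ 1)\<^sup>2 + (xi k $ 2)\<^sup>2"

lemma odd_square_ge_1: "(1 :: real) \<le> (2 * of_int m + 1)\<^sup>2"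
proof -
  have "1 \<le> \<bar>2 * m + 1\<bar>" by presburger
  then have "1 \<le> \<bar>real_of_int (2 * m + 1)\<bar>" by (metis of_int_1_le_iff of_int_abs)
  then show ?thesis by (metis abs_le_square_iff abs_one of_int_1 of_int_add of_int_mult of_int_numeral one_power2)
qed

lemma xi_square_ge: "(2 * of_int (fst k) + 1)\<^sup>2 \<le> (xi k $ 1)\<^sup>2" "(2 * of_int (snd k) + 1)\<^sup>2 \<le> (xi k $ 2)\<^sup>2"
proof -
  have "t\<^sup>2 \<le> (pi * t)\<^sup>2" for t :: real
  proof -
    have "1 * t\<^sup>2 \<le> pi\<^sup>2 * t\<^sup>2" using pi_gt3 by (intro mult_right_mono) (auto simp: one_le_power)
    then show ?thesis by (simp add: power_mult_distrib)
  qed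
  then show "(2 * of_int (fst k) + 1)\<^sup>2 \<le> (xi k $ 1)\<^sup>2" "(2 * of_int (snd k) + 1)\<^sup>2 \<le> (xi k $ 2)\<^sup>2"
    by (simp_all add: xi_def)
qed

lemma xi_square_ge_1: "1 \<le> (xi k $ r)\<^sup>2"
  using xi_square_ge[of k] odd_square_ge_1[of "fst k"] odd_square_ge_1[of "snd k"] exhaust_2[of r] by auto

lemma abs_xi_ge_1: "1 \<le> \<bar>xi k $ r\<bar>"
  using xi_square_ge_1[of k r] by (metis abs_le_square_iff abs_one one_power2)

text \<open>Every component of \<open>xi k\<close> has modulus at least 1, a feature of the point M.
  Therefore \<open>en\<close> bounds all symbols of first and second order and may be divided
  by.\<close>

lemma en_ge: "(xi k $ r)\<^sup>2 \<le> en k" "\<bar>xi k $ r * xi k $ s\<bar> \<le> en k" "\<bar>xi k $ r\<bar> \<le> en k" "1 \<le> en k"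
proof -
  show 1: "(xi k $ r)\<^sup>2 \<le> en k" for r using exhaust_2[of r] by (auto simp: en_def)
  have "0 \<le> (\<bar>xi k $ r\<bar> - \<bar>xi k $ s\<bar>)\<^sup>2" by simp
  then have "2 * (\<bar>xi k $ r\<bar> * \<bar>xi k $ s\<bar>) \<le> (xi k $ r)\<^sup>2 + (xi k $ s)\<^sup>2"
    unfolding power2_diff by simp
  then show 2: "\<bar>xi k $ r * xi k $ s\<bar> \<le> en k" using 1[of r] 1[of s] unfolding abs_mult by linarith
  have "\<bar>xi k $ r\<bar> * 1 \<le> \<bar>xi k $ r\<bar> * \<bar>xi k $ r\<bar>" using abs_xi_ge_1 by (intro mult_left_mono) auto
  also have "\<dots> \<le> en k" using 1[of r] by (simp add: power2_eq_square)
  finally show "\<bar>xi k $ r\<bar> \<le> en k" by simp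
  show "1 \<le> en k" using 1[of 1] xi_square_ge_1[of k 1] by linarith
qed

lemma square_summable_mono:
  fixes a b :: "'i \<Rightarrow> complex"
  assumes "(\<lambda>k. (norm (b k))\<^sup>2) summable_on A" "\<And>k. k \<in> A \<Longrightarrow> norm (a k) \<le> norm (b k)"
  shows "(\<lambda>k. (norm (a k))\<^sup>2) summable_on A"
proof (rule summable_on_comparison_test[OF assms(1)])
  show "(norm (a k))\<^sup>2 \<le> (norm (b k))\<^sup>2" if "k \<in> A" for k
    using assms(2)[OF that] by (intro power_mono) auto
qed auto

text \<open>The symbols are dominated by \<open>en\<close>, so the candidate coefficients are square
  summable and Riesz-Fischer supplies the derivative.\<close>

lemma weak_pd_exists:
  assumes f: "f \<in> L2_M" and s: "(\<lambda>k. (norm (of_real (en k) * fc f k))\<^sup>2) summable_on UNIV"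
  shows "\<exists>g. weak_pd r f g" "\<exists>g. weak_pd r (wpd s f) g"
proof -
  have "(\<lambda>k. (norm (\<i> * of_real (xi k $ r) * fc f k))\<^sup>2) summable_on UNIV" for r
    by (rule square_summable_mono[OF s]) 
       (use en_ge(3)[of _ r] en_ge(4) in \<open>auto simp: norm_mult intro!: mult_right_mono intro: order_trans[OF _ abs_ge_self]\<close>)
  then show 1: "\<exists>g. weak_pd r f g" for r
    by (rule Riesz_Fischer) (use f weak_pdI in blast)
  obtain h where h: "weak_pd s f h" using 1 by blast
  have "(\<lambda>k. (norm (\<i> * of_real (xi k $ r) * (\<i> * of_real (xi k $ s) * fc f k)))\<^sup>2) summable_on UNIV"
  proof (rule square_summable_mono[OF s])
    fix k
    have "\<bar>xi k $ r\<bar> * \<bar>xi k $ s\<bar> * norm (fc f k) \<le> \<bar>en k\<bar> * norm (fc f k)"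
      using en_ge(2)[of k r s] by (intro mult_right_mono) (auto simp: abs_mult)
    then show "norm (\<i> * of_real (xi k $ r) * (\<i> * of_real (xi k $ s) * fc f k)) \<le> norm (of_real (en k) * fc f k)"
      by (simp add: norm_mult mult.assoc)
  qed
  then show "\<exists>g. weak_pd r (wpd s f) g"
    unfolding fc_wpd(2)[OF h, symmetric]
    by (rule Riesz_Fischer) (use fc_wpd(1)[OF h] weak_pdI in blast)
qed

section \<open>\<open>H2_M\<close> as a weighted l2 space and its embedding into l1\<close>

definition lap :: "(real^2 \<Rightarrow> complex) \<Rightarrow> real^2 \<Rightarrow> complex" where
  "lap f x = (\<Sum>r\<in>UNIV. wpd r (wpd r f) x)"

lemma H2_M_L2_M: "f \<in> H2_M \<Longrightarrow> f \<in> L2_M"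
  by (simp add: H2_M_def)

lemma H2_M_weak_pd: "f \<in> H2_M \<Longrightarrow> weak_pd r f (wpd r f)" "f \<in> H2_M \<Longrightarrow> weak_pd s (wpd r f) (wpd s (wpd r f))"
  unfolding H2_M_def using weak_pd_wpd by blast+

lemma lap_L2_M: "f \<in> H2_M \<Longrightarrow> lap f \<in> L2_M"
  unfolding lap_def[abs_def] by (intro L2_M_sum) (use H2_M_weak_pd(2) in \<open>auto simp: weak_pd_def\<close>)

lemma fc_lap: "f \<in> H2_M \<Longrightarrow> fc (lap f) k = - of_real (en k) * fc f k"
proof -
  assume f: "f \<in> H2_M"
  have "fc (lap f) k = (\<Sum>r\<in>UNIV. fc (wpd r (wpd r f)) k)"
    unfolding lap_def[abs_def] by (intro fc_sum) (use H2_M_weak_pd(2)[OF f] in \<open>auto simp: weak_pd_def\<close>)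
  moreover have "fc (wpd r (wpd r f)) k = - of_real ((xi k $ r)\<^sup>2) * fc f k" for r
    by (simp add: weak_pd_fc[OF H2_M_weak_pd(2)[OF f, of r r]] weak_pd_fc[OF H2_M_weak_pd(1)[OF f, of r]] power2_eq_square mult_ac)
  ultimately show ?thesis by (simp add: sum_2 en_def algebra_simps)
qed

text \<open>The Laplacian alone controls everything: its coefficients give the weighted summability,
  and from that every first and second derivative is recovered.\<close>

lemma H2_M_iff:
  "f \<in> H2_M \<longleftrightarrow> f \<in> L2_M \<and> (\<lambda>k. (norm (of_real (en k) * fc f k))\<^sup>2) summable_on UNIV"
proof
  assume f: "f \<in> H2_M"
  from fc_square_summable[OF lap_L2_M[OF f]] show "f \<in> L2_M \<and> (\<lambda>k. (norm (of_real (en k) * fc f k))\<^sup>2) summable_on UNIV"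
    using H2_M_L2_M[OF f] by (simp add: fc_lap[OF f] norm_mult)
qed (auto simp: H2_M_def intro: weak_pd_exists)

text \<open>The bound is a telescoping majorant: the two new terms of a step are together at most 4
  / ((N + 1) (N + 2)), the increment of the right-hand side. The constant 6 leaves room for the
  initial term 1.\<close>

lemma sum_inverse_odd_squares: "(\<Sum>m\<in>{- int N..int N}. 1 / (2 * real_of_int m + 1)\<^sup>2) \<le> 6 - 4 / (real N + 1)"
proof (induction N)
  case (Suc N)
  have "{- int (Suc N)..int (Suc N)} = insert (- int (Suc N)) (insert (int (Suc N)) {- int N..int N})" by auto
  then have "(\<Sum>m\<in>{- int (Suc N)..int (Suc N)}. 1 / (2 * real_of_int m + 1)\<^sup>2) =
     1 / (2 * real N + 1)\<^sup>2 + (1 / (2 * real N + 3)\<^sup>2 + (\<Sum>m\<in>{- int N..int N}. 1 / (2 * real_of_int m + 1)\<^sup>2))"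
    by (simp add: algebra_simps power2_eq_square)
  also have "\<dots> \<le> 1 / (2 * real N + 1)\<^sup>2 + (1 / (2 * real N + 1)\<^sup>2 + (6 - 4 / (real N + 1)))"
    by (intro add_mono Suc order_refl divide_left_mono power_mono) auto
  also have "2 / (2 * real N + 1)\<^sup>2 \<le> 4 / ((real N + 1) * (real N + 2))"
  proof -
    have "2 * ((real N + 1) * (real N + 2)) \<le> 4 * (2 * real N + 1)\<^sup>2"
      by (simp add: power2_eq_square algebra_simps)
    moreover have "2 / a \<le> 4 / b" if "0 < a" "0 < b" "2 * b \<le> 4 * a" for a b :: real
      using that by (simp add: divide_simps)
    ultimately show ?thesis by auto
  qed
  then have "1 / (2 * real N + 1)\<^sup>2 + (1 / (2 * real N + 1)\<^sup>2 + (6 - 4 / (real N + 1))) \<le> 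
      4 / ((real N + 1) * (real N + 2)) + (6 - 4 / (real N + 1))" by simp
  also have "\<dots> = 6 - 4 / (real (Suc N) + 1)" by (simp add: divide_simps) (simp add: algebra_simps)
  finally show ?case .
qed simp

text \<open>Each odd square is at most \<open>en k\<close>, so 1 / \<open>en k\<close>^2 is bounded
  by a product of a function of the first and a function of the second index. Sums over squares then
  factor into the one-dimensional sums bounded above.\<close>

lemma summable_inverse_en_square: "(\<lambda>k. (norm (1 / complex_of_real (en k)))\<^sup>2) summable_on UNIV"
proof (rule nonneg_bdd_above_summable_on)
  let ?a = "\<lambda>m. 1 / (2 * real_of_int m + 1)\<^sup>2"
  have le: "(norm (1 / complex_of_real (en k)))\<^sup>2 \<le> ?a (fst k) * ?a (snd k)" for k
  proof -
    let ?m = "(2 * real_of_int (fst k) + 1)\<^sup>2" and ?n = "(2 * real_of_int (snd k) + 1)\<^sup>2"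
    have p: "0 < ?m" "0 < ?n" using odd_square_ge_1[of "fst k"] odd_square_ge_1[of "snd k"] by linarith+
    have "?m * ?n \<le> en k * en k"
      using xi_square_ge[of k] en_ge(1)[of k 1] en_ge(1)[of k 2] en_ge(4)[of k] p by (intro mult_mono) linarith+
    then have "1 / (en k * en k) \<le> 1 / (?m * ?n)" 
      using p by (intro divide_left_mono mult_pos_pos) (use en_ge(4)[of k] in auto)
    then show ?thesis using en_ge(4)[of k] by (simp add: norm_divide power_divide power2_eq_square)
  qed
  show "bdd_above (sum (\<lambda>k. (norm (1 / complex_of_real (en k)))\<^sup>2) ` {F. F \<subseteq> UNIV \<and> finite F})"
  proof (rule bdd_aboveI2)
    fix F :: "(int \<times> int) set" assume "F \<in> {F. F \<subseteq> UNIV \<and> finite F}"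
    then have F: "finite F" by simp
    define N where "N = nat (Max (insert 0 ((\<lambda>k. max \<bar>fst k\<bar> \<bar>snd k\<bar>) ` F)))"
    have sub: "F \<subseteq> {- int N..int N} \<times> {- int N..int N}"
    proof
      fix k assume "k \<in> F"
      then have "max \<bar>fst k\<bar> \<bar>snd k\<bar> \<le> Max (insert 0 ((\<lambda>k. max \<bar>fst k\<bar> \<bar>snd k\<bar>) ` F))" using F by (intro Max_ge) auto
      then have "max \<bar>fst k\<bar> \<bar>snd k\<bar> \<le> int N" unfolding N_def by linarith
      then show "k \<in> {- int N..int N} \<times> {- int N..int N}" by (cases k) auto
    qed
    have "(\<Sum>k\<in>F. (norm (1 / complex_of_real (en k)))\<^sup>2) \<le> (\<Sum>k\<in>F. ?a (fst k) * ?a (snd k))"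
      by (intro sum_mono le)
    also have "\<dots> \<le> (\<Sum>k\<in>{- int N..int N} \<times> {- int N..int N}. ?a (fst k) * ?a (snd k))"
      by (rule sum_mono2) (use sub in auto)
    also have "\<dots> = (\<Sum>m\<in>{- int N..int N}. ?a m) * (\<Sum>m\<in>{- int N..int N}. ?a m)"
      by (simp add: sum_product sum.cartesian_product case_prod_unfold)
    also have "\<dots> \<le> 6 * 6"
    proof -
      have "6 - 4 / (real N + 1) \<le> 6" by simp
      with sum_inverse_odd_squares[of N] have "(\<Sum>m\<in>{- int N..int N}. ?a m) \<le> 6" by linarith
      moreover have "0 \<le> (\<Sum>m\<in>{- int N..int N}. ?a m)" by (intro sum_nonneg) auto
      ultimately show ?thesis by (intro mult_mono) auto
    qed
    finally show "(\<Sum>k\<in>F. (norm (1 / complex_of_real (en k)))\<^sup>2) \<le> 6 * 6" .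
  qed
qed auto

text \<open>The Sobolev embedding in dimension two on the Fourier side: the sequence is a product of
  two square summable ones, the weighted sequence and 1 / \<open>en\<close>.\<close>

lemma abs_summable_of_en:
  assumes "(\<lambda>k. (norm (of_real (en k) * c k :: complex))\<^sup>2) summable_on UNIV"
  shows "(\<lambda>k. norm (c k)) summable_on UNIV"
proof -
  have "c k = (of_real (en k) * c k) * (1 / of_real (en k))" for k using en_ge(4)[of k] by simp
  then show ?thesis
    using norm_mult_summable_on[OF assms summable_inverse_en_square] by simp
qed

lemma H2_M_fc_abs_summable: "f \<in> H2_M \<Longrightarrow> (\<lambda>k. norm (fc f k)) summable_on UNIV"
  by (intro abs_summable_of_en) (simp add: H2_M_iff)

text \<open>Absolute summability makes the Fourier series converge uniformly. Continuity upgrades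
  quasi-periodicity from almost every point to every point, as the boundary condition in
  \<open>solvable2\<close> demands.\<close>

lemma continuous_representative:
  assumes f: "f \<in> L2_M" and s: "(\<lambda>k. norm (fc f k)) summable_on UNIV"
  obtains u where "continuous_on UNIV u" "\<And>x v. v \<in> \<Lambda> \<Longrightarrow> u (x + v) = phase v * u x"
    "AE x in lebesgue. f x = u x"
proof -
  obtain f' G where f': "f' \<in> L2_M" "\<And>k. fc f' k = fc f k"
    "\<And>n. finite (G n :: (int \<times> int) set)" and Glim: "filterlim G (finite_subsets_at_top UNIV) sequentially"
    and lim: "AE x in lebesgue. (\<lambda>n. trig_sum (G n) (fc f) x) \<longlonglongrightarrow> f' x"
    by (rule Riesz_Fischer[OF fc_square_summable[OF f]]) (rule that)
  define u where "u x = (\<Sum>\<^sub>\<infinity>k. fc f k * ch k x)" for x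
  have ul: "uniform_limit UNIV (\<lambda>X x. \<Sum>k\<in>X. fc f k * ch k x) u (finite_subsets_at_top UNIV)"
    unfolding u_def by (rule Weierstrass_m_test_general[OF _ s]) (simp add: norm_mult)
  have c: "continuous_on UNIV u"
    by (rule uniform_limit_theorem[OF _ ul])
       (auto intro!: always_eventually continuous_intros ch_continuous simp: finite_subsets_at_top_neq_bot)
  have "AE x in lebesgue. f' x = u x"
    using lim
  proof eventually_elim
    case (elim x)
    have "(\<lambda>n. \<Sum>k\<in>G n. fc f k * ch k x) \<longlonglongrightarrow> u x"
      by (rule filterlim_compose[OF tendsto_uniform_limitI[OF ul] Glim]) simp
    from LIMSEQ_unique[OF elim[unfolded trig_sum_def] this] show ?case .
  qed
  moreover have "AE x in lebesgue. f x = f' x"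
    using f' by (intro fc_eq_imp_AE_eq f) auto
  ultimately have ae: "AE x in lebesgue. f x = u x" by eventually_elim simp
  show ?thesis
    using that[OF c continuous_L2_M_quasi_periodic[OF L2_M_cong_AE[OF f ae] c] ae] .
qed

section \<open>Multiplication by the potential\<close>

lemma pd_periodic:
  fixes f :: "real^2 \<Rightarrow> 'b::real_normed_vector"
  assumes "\<And>x. f differentiable (at x)" "\<And>x. f (x + v) = f x"
  shows "pd r f (x + v) = pd r f x"
proof -
  have d: "(f has_derivative frechet_derivative f (at x)) (at x)" for x
    using assms(1) frechet_derivative_works by blast
  have "((\<lambda>x. f (x + v)) has_derivative (\<lambda>h. frechet_derivative f (at (x + v)) h)) (at x)"
    by (rule has_derivative_compose[OF _ d]) (auto intro!: derivative_eq_intros)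
  then have "(f has_derivative (\<lambda>h. frechet_derivative f (at (x + v)) h)) (at x)"
    unfolding assms(2) .
  from has_derivative_unique[OF this d] show ?thesis by (simp add: pd_def)
qed

lemma has_sum_diff:
  fixes f g :: "'i \<Rightarrow> complex"
  assumes "(f has_sum a) A" "(g has_sum b) A"
  shows "((\<lambda>i. f i - g i) has_sum (a - b)) A"
  using has_sum_add[OF assms(1) has_sum_uminusI[OF assms(2)]] by simp

locale potential =
  fixes V :: "real^2 \<Rightarrow> real"
  assumes admissible: "admissible V"
begin

lemma periodic_V: "v \<in> \<Lambda> \<Longrightarrow> V (x + v) = V x"
  using admissible by (auto simp: admissible_def)

lemma smooth_V: "smooth V"
  using admissible by (simp add: admissible_def)

definition V_times :: "(real^2 \<Rightarrow> complex) \<Rightarrow> real^2 \<Rightarrow> complex" where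
  "V_times f x = of_real (V x) * f x"

lemma bounded_periodic:
  fixes W :: "real^2 \<Rightarrow> real"
  assumes "continuous_on UNIV W" "\<And>x v. v \<in> \<Lambda> \<Longrightarrow> W (x + v) = W x"
  shows "\<exists>B. \<forall>x. \<bar>W x\<bar> \<le> B"
proof -
  have "compact (W ` cbox 0 1)"
    by (intro compact_continuous_image continuous_on_subset[OF assms(1)]) auto
  then have "bounded (W ` cbox 0 1)" by (rule compact_imp_bounded)
  then obtain B where "\<forall>y\<in>W ` cbox 0 1. norm y \<le> B"
    unfolding bounded_iff by (rule exE)
  then have B: "\<bar>W x\<bar> \<le> B" if "x \<in> cbox 0 1" for x using that by simp
  have "\<bar>W x\<bar> \<le> B" for x
    using B[OF floor_vec_cell[of x]] assms(2)[OF floor_vec_lattice[of x], of "x - floor_vec x"] by simp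
  then show ?thesis by blast
qed

lemma L2_M_mult_real:
  fixes W :: "real^2 \<Rightarrow> real"
  assumes "continuous_on UNIV W" "\<And>x v. v \<in> \<Lambda> \<Longrightarrow> W (x + v) = W x" "f \<in> L2_M"
  shows "(\<lambda>x. of_real (W x) * f x) \<in> L2_M"
proof -
  obtain B where B: "\<And>x. \<bar>W x\<bar> \<le> B" using bounded_periodic[OF assms(1,2)] by blast
  have c: "continuous_on UNIV (\<lambda>x. complex_of_real (W x))" by (intro continuous_intros assms)
  have "(\<lambda>x. complex_of_real (W x)) \<in> borel_measurable lebesgue"
    using continuous_imp_measurable_on_sets_lebesgue[OF c] by (simp add: lebesgue_on_UNIV_eq)
  then show ?thesis
    by (intro L2_M_mult_periodic[where B = B] assms(3)) (use B assms(2) in auto)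
qed

lemma V_times_L2_M: "f \<in> L2_M \<Longrightarrow> V_times f \<in> L2_M"
  unfolding V_times_def[abs_def] by (intro L2_M_mult_real smooth_continuous smooth_V periodic_V)

lemma V_times_symmetric: "inner_M (V_times f) g = inner_M f (V_times g)"
  unfolding inner_M_eq V_times_def by (simp add: mult_ac)

text \<open>The product rule for \<open>W\<close> times \<open>ch 0\<close> trades a frequency
  factor for a derivative of \<open>W\<close>. The fixed character only moves periodic functions
  into \<open>L2_M\<close>.\<close>

lemma fc_mult_real_derivative:
  fixes W :: "real^2 \<Rightarrow> real"
  assumes W: "smooth W" "\<And>x v. v \<in> \<Lambda> \<Longrightarrow> W (x + v) = W x"
  shows "\<i> * of_real (xi k $ r) * fc (\<lambda>x. of_real (W x) * ch 0 x) k =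
     fc (\<lambda>x. of_real (pd r W x) * ch 0 x) k + \<i> * of_real (xi 0 $ r) * fc (\<lambda>x. of_real (W x) * ch 0 x) k"
proof -
  define U where "U x = complex_of_real (W x) * ch 0 x" for x
  have d: "(U has_derivative (\<lambda>h. of_real (W x) * (\<i> * of_real (xi 0 \<bullet> h) * ch 0 x) +
       of_real (frechet_derivative W (at x) h) * ch 0 x)) (at x)" for x
  proof -
    have "(W has_derivative frechet_derivative W (at x)) (at x)"
      using smooth_differentiable[OF W(1)] frechet_derivative_works by blast
    then have "((\<lambda>x. complex_of_real (W x)) has_derivative (\<lambda>h. of_real (frechet_derivative W (at x) h))) (at x)"
      by (rule has_derivative_of_real)
    from has_derivative_mult[OF this ch_has_derivative[of 1 0 x]] show ?thesis
      by (simp add: U_def[abs_def])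
  qed
  have pdU: "pd r U = (\<lambda>x. of_real (pd r W x) * ch 0 x + \<i> * of_real (xi 0 $ r) * (of_real (W x) * ch 0 x))"
    using pd_eqI[OF d] by (auto simp: fun_eq_iff pd_def inner_axis)
  have cW: "continuous_on UNIV W" "continuous_on UNIV (pd r W)"
    by (intro smooth_continuous smooth_pd W(1))+
  have L: "(\<lambda>x. of_real (pd r W x) * ch 0 x) \<in> L2_M" "(\<lambda>x. of_real (W x) * ch 0 x) \<in> L2_M"
    using W by (auto intro!: L2_M_mult_real cW pd_periodic smooth_differentiable)
  have "inner_M (ch k) (pd r U) = \<i> * of_real (xi k $ r) * inner_M (ch k) U"
  proof (rule inner_M_ch_pd)
    show "U differentiable at x" for x using d by (auto simp: differentiable_def)
    show "continuous_on UNIV (pd r U)" unfolding pdU by (intro continuous_intros cW ch_continuous)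
    show "U (x + v) = phase v * U x" if "v \<in> \<Lambda>" for x v
      using that by (simp add: U_def W(2) ch_quasi_periodic)
  qed
  then have "fc (pd r U) k = \<i> * of_real (xi k $ r) * fc U k" by (simp add: fc_def)
  then show ?thesis
    unfolding pdU unfolding U_def[abs_def] by (simp add: fc_add fc_scale L L2_M_scale)
qed

text \<open>The ordinary Fourier coefficient of the periodic function \<open>V\<close> at frequency
  2 pi k, because \<open>xi k - xi 0\<close> equals 2 pi k.\<close>

definition V_coeff :: "int \<times> int \<Rightarrow> complex" where
  "V_coeff k = fc (V_times (ch 0)) k"

lemma V_coeff_abs_summable: "(\<lambda>k. norm (V_coeff k)) summable_on UNIV"
proof (rule abs_summable_of_en)
  define Z where "Z W = (\<lambda>x. complex_of_real (W x) * ch 0 x)" for W :: "real^2 \<Rightarrow> real"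
  define a where "a r = \<i> * complex_of_real (xi 0 $ r)" for r
  have pV: "pd r V (x + v) = pd r V x" if "v \<in> \<Lambda>" for r x v
    using that by (intro pd_periodic smooth_differentiable smooth_V periodic_V)
  have ppV: "pd r (pd r V) (x + v) = pd r (pd r V) x" if "v \<in> \<Lambda>" for r x v
    using that by (intro pd_periodic smooth_differentiable smooth_pd smooth_V pV)
  have L: "Z V \<in> L2_M" "Z (pd r V) \<in> L2_M" "Z (pd r (pd r V)) \<in> L2_M" for r
    unfolding Z_def by (intro L2_M_mult_real smooth_continuous smooth_pd smooth_V periodic_V pV ppV ch_L2_M; assumption)+
  have s1: "\<i> * of_real (xi k $ r) * fc (Z V) k = fc (Z (pd r V)) k + a r * fc (Z V) k" for k r
    unfolding Z_def a_def by (intro fc_mult_real_derivative smooth_V periodic_V)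
  have s2: "\<i> * of_real (xi k $ r) * fc (Z (pd r V)) k = fc (Z (pd r (pd r V))) k + a r * fc (Z (pd r V)) k" for k r
    unfolding Z_def a_def by (intro fc_mult_real_derivative smooth_pd smooth_V pV)
  \<comment> \<open>The second r-derivative of \<open>V\<close> times \<open>ch 0\<close>, written
    through derivatives of \<open>V\<close>: the operator \<open>d_r + a r\<close> is applied twice
    to \<open>V\<close> and the result is multiplied by \<open>ch 0\<close>.\<close>
  define P where "P r = (\<lambda>x. (Z (pd r (pd r V)) x + a r * Z (pd r V) x) + a r * (Z (pd r V) x + a r * Z V x))" for r
  have P: "P r \<in> L2_M" for r unfolding P_def by (intro L2_M_add L2_M_scale L)
  have fP: "fc (P r) k = - of_real ((xi k $ r)\<^sup>2) * V_coeff k" for r k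
  proof -
    have "fc (P r) k = (fc (Z (pd r (pd r V))) k + a r * fc (Z (pd r V)) k) + a r * (fc (Z (pd r V)) k + a r * fc (Z V) k)"
      unfolding P_def by (simp add: fc_add fc_scale L L2_M_add L2_M_scale)
    also have "\<dots> = \<i> * of_real (xi k $ r) * (fc (Z (pd r V)) k + a r * fc (Z V) k)"
    proof -
      have "A * (z1 + a r * z0) = A * z1 + a r * (A * z0)" for A z0 z1 by (simp add: algebra_simps)
      then show ?thesis by (simp only: s1 s2)
    qed
    also have "\<dots> = \<i> * of_real (xi k $ r) * (\<i> * of_real (xi k $ r) * fc (Z V) k)"
      by (simp only: s1)
    finally show ?thesis by (simp add: V_coeff_def V_times_def[abs_def] Z_def power2_eq_square mult_ac)
  qed
  have "(\<lambda>x. P 1 x + P 2 x) \<in> L2_M" by (intro L2_M_add P)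
  from fc_square_summable[OF this] show "(\<lambda>k. (norm (of_real (en k) * V_coeff k))\<^sup>2) summable_on UNIV"
  proof (rule square_summable_mono)
    fix k
    have "fc (\<lambda>x. P 1 x + P 2 x) k = - (of_real (en k) * V_coeff k)"
      by (simp add: fc_add P fP en_def algebra_simps)
    then show "norm (of_real (en k) * V_coeff k) \<le> norm (fc (\<lambda>x. P 1 x + P 2 x) k)" by simp
  qed
qed

lemma cnj_ch_ch: "cnj (ch k x) * ch l x = cnj (ch (k - l) x) * ch 0 x"
proof -
  have "xi l - xi k = xi 0 - xi (k - l)"
    by (simp add: vec_eq_iff xi_def algebra_simps)
  then have "xi l \<bullet> x - xi k \<bullet> x = xi 0 \<bullet> x - xi (k - l) \<bullet> x" by (metis inner_diff_left)
  then have "\<i> * complex_of_real (xi l \<bullet> x) - \<i> * of_real (xi k \<bullet> x) = \<i> * of_real (xi 0 \<bullet> x) - \<i> * of_real (xi (k - l) \<bullet> x)"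
    by (simp flip: of_real_diff right_diff_distrib)
  then show ?thesis
    by (simp add: ch_def exp_cnj flip: exp_add)
qed

text \<open>The convolution formula, read off from Parseval after moving the real potential onto
  \<open>ch k\<close>; the conjugate comes from the first argument of the inner product.\<close>

lemma fc_V_times_has_sum:
  assumes f: "f \<in> L2_M"
  shows "((\<lambda>l. cnj (V_coeff (l - k)) * fc f l) has_sum fc (V_times f) k) UNIV"
proof -
  have "fc (V_times (ch k)) l = V_coeff (l - k)" for l
    unfolding V_coeff_def fc_def inner_M_eq V_times_def
    by (simp only: mult.left_commute[of "cnj _" "of_real _"] cnj_ch_ch[of l _ k])
  with Parseval[OF V_times_L2_M[OF ch_L2_M] f, of k] show ?thesis
    by (simp add: fc_def V_times_symmetric)
qed

text \<open>The l1 norm of the convolution kernel, hence a bound for multiplication by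
  \<open>V\<close> on bounded coefficient sequences.\<close>

definition V_bound :: real where "V_bound = (\<Sum>\<^sub>\<infinity>k. norm (V_coeff k))"

lemma V_bound_nonneg: "V_bound \<ge> 0"
  unfolding V_bound_def by (intro infsum_nonneg) auto

lemma V_coeff_row:
  "(\<lambda>l. norm (cnj (V_coeff (l - k)))) summable_on UNIV" "(\<Sum>\<^sub>\<infinity>l. norm (cnj (V_coeff (l - k)))) = V_bound"
proof -
  have b: "bij_betw (\<lambda>l. l - k) UNIV UNIV"
    by (rule bij_betw_byWitness[where f' = "\<lambda>l. l + k"]) auto
  show "(\<lambda>l. norm (cnj (V_coeff (l - k)))) summable_on UNIV"
    using summable_on_reindex_bij_betw[OF b, of "\<lambda>k. norm (V_coeff k)"] V_coeff_abs_summable by simp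
  show "(\<Sum>\<^sub>\<infinity>l. norm (cnj (V_coeff (l - k)))) = V_bound"
    using infsum_reindex_bij_betw[OF b, of "\<lambda>k. norm (V_coeff k)"] by (simp add: V_bound_def)
qed

lemma V_coeff_row_bounded:
  assumes u: "\<And>l. norm (u l) \<le> C"
  shows "(\<lambda>l. cnj (V_coeff (l - k)) * u l) summable_on UNIV"
    and "norm (\<Sum>\<^sub>\<infinity>l. cnj (V_coeff (l - k)) * u l) \<le> V_bound * C"
proof -
  have s: "(\<lambda>l. norm (cnj (V_coeff (l - k))) * C) summable_on UNIV"
    by (intro summable_on_cmult_left V_coeff_row)
  have le: "norm (cnj (V_coeff (l - k)) * u l) \<le> norm (cnj (V_coeff (l - k))) * C" for l
    unfolding norm_mult by (intro mult_left_mono u) auto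
  have n: "(\<lambda>l. norm (cnj (V_coeff (l - k)) * u l)) summable_on UNIV"
    by (rule summable_on_comparison_test[OF s]) (use le in auto)
  then show "(\<lambda>l. cnj (V_coeff (l - k)) * u l) summable_on UNIV" by (rule Infinite_Sum.abs_summable_summable)
  have "norm (\<Sum>\<^sub>\<infinity>l. cnj (V_coeff (l - k)) * u l) \<le> (\<Sum>\<^sub>\<infinity>l. norm (cnj (V_coeff (l - k)) * u l))"
    by (rule norm_infsum_bound[OF n])
  also have "\<dots> \<le> (\<Sum>\<^sub>\<infinity>l. norm (cnj (V_coeff (l - k))) * C)"
    by (rule infsum_mono[OF n s le])
  also have "\<dots> = V_bound * C" by (simp only: infsum_cmult_left' V_coeff_row)
  finally show "norm (\<Sum>\<^sub>\<infinity>l. cnj (V_coeff (l - k)) * u l) \<le> V_bound * C" .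
qed

end

text \<open>Banach's fixed point theorem in the sup norm. The hypotheses are restricted to bounded
  sequences because \<open>V_coeff_row_bounded\<close> controls the infinite sums of the intended
  \<open>T\<close> only there.\<close>

lemma bounded_contraction_fixed_point:
  fixes T :: "('i \<Rightarrow> complex) \<Rightarrow> 'i \<Rightarrow> complex"
  assumes bdd: "\<And>u C. (\<And>k. norm (u k) \<le> C) \<Longrightarrow> \<exists>C'. \<forall>k. norm (T u k) \<le> C'"
    and contr: "\<And>u v C C' D k. (\<And>k. norm (u k) \<le> C) \<Longrightarrow> (\<And>k. norm (v k) \<le> C') \<Longrightarrow>
      (\<And>k. norm (u k - v k) \<le> D) \<Longrightarrow> norm (T u k - T v k) \<le> D / 2"
  obtains u C where "\<And>k. norm (u k) \<le> C" "T u = u"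
proof -
  define c where "c n = (T ^^ n) (\<lambda>_. 0)" for n
  have c0: "c 0 = (\<lambda>_. 0)" and cS: "c (Suc n) = T (c n)" for n by (simp_all add: c_def)
  have "\<exists>C. \<forall>k. norm (c n k) \<le> C" for n
  proof (induction n)
    case 0 show ?case by (auto simp: c0)
  next
    case (Suc n) then show ?case using bdd[of "c n"] by (auto simp: cS)
  qed
  then obtain C where C: "\<And>n k. norm (c n k) \<le> C n" by metis
  define \<beta> where "\<beta> = C 1"
  have \<beta>: "\<beta> \<ge> 0" using C[of 1] norm_ge_zero order_trans unfolding \<beta>_def by blast
  have step: "norm (c (Suc n) k - c n k) \<le> \<beta> * (1/2) ^ n" for n k
  proof (induction n arbitrary: k)
    case 0 show ?case using C[of 1 k] by (simp add: c0 \<beta>_def)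
  next
    case (Suc n)
    have "norm (T (c (Suc n)) k - T (c n) k) \<le> \<beta> * (1/2) ^ n / 2"
      by (rule contr[OF C C Suc])
    then show ?case by (simp add: cS)
  qed
  \<comment> \<open>The exact partial sum of the geometric series is kept so that the induction on m
    closes; the plain bound by 2 is extracted afterwards.\<close>
  have tail: "norm (c (n + m) k - c n k) \<le> \<beta> * (1/2) ^ n * (2 - 2 * (1/2) ^ m)" for n m k
  proof (induction m)
    case (Suc m)
    have "norm (c (n + Suc m) k - c n k) \<le> norm (c (Suc (n + m)) k - c (n + m) k) + norm (c (n + m) k - c n k)"
      by (rule order_trans[OF _ norm_triangle_ineq]) simp
    also have "\<dots> \<le> \<beta> * (1/2) ^ (n + m) + \<beta> * (1/2) ^ n * (2 - 2 * (1/2) ^ m)"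
      by (intro add_mono step Suc)
    also have "\<dots> = \<beta> * (1/2) ^ n * (2 - 2 * (1/2) ^ Suc m)" by (simp add: power_add algebra_simps)
    finally show ?case .
  qed simp
  have tail2: "norm (c m k - c n k) \<le> 2 * \<beta> * (1/2) ^ n" if "n \<le> m" for n m k
  proof -
    have "norm (c m k - c n k) \<le> \<beta> * (1/2) ^ n * (2 - 2 * (1/2) ^ (m - n))" using tail[of n "m - n" k] that by simp
    also have "\<dots> \<le> \<beta> * (1/2) ^ n * 2" using \<beta> by (intro mult_left_mono) auto
    finally show ?thesis by (simp add: mult_ac)
  qed
  have to0: "(\<lambda>n. K * (1/2) ^ n) \<longlonglongrightarrow> (0 :: real)" for K
    using tendsto_mult[OF tendsto_const LIMSEQ_realpow_zero[of "1/2"], of K] by simp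
  have "Cauchy (\<lambda>n. c n k)" for k
  proof (rule metric_CauchyI)
    fix e :: real assume "e > 0"
    from order_tendstoD(2)[OF to0[of "4 * \<beta>"] this] obtain N where N: "4 * \<beta> * (1/2) ^ N < e"
      by (auto simp: eventually_sequentially)
    have "dist (c m k) (c n k) < e" if "m \<ge> N" "n \<ge> N" for m n
    proof -
      have "dist (c m k) (c n k) \<le> norm (c m k - c N k) + norm (c n k - c N k)"
        by (metis dist_norm dist_triangle2)
      also have "\<dots> \<le> 2 * \<beta> * (1/2) ^ N + 2 * \<beta> * (1/2) ^ N" by (intro add_mono tail2 that)
      also have "\<dots> < e" using N by simp
      finally show ?thesis .
    qed
    then show "\<exists>M. \<forall>m\<ge>M. \<forall>n\<ge>M. dist (c m k) (c n k) < e" by blast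
  qed
  then have "\<forall>k. \<exists>L. (\<lambda>n. c n k) \<longlonglongrightarrow> L" by (simp add: Cauchy_convergent_iff convergent_def)
  then obtain u where u: "\<And>k. (\<lambda>n. c n k) \<longlonglongrightarrow> u k" by metis
  have uc: "norm (u k - c n k) \<le> 2 * \<beta> * (1/2) ^ n" for k n
    by (rule LIMSEQ_le_const2[OF tendsto_norm[OF tendsto_diff[OF u tendsto_const]]])
       (use tail2 in blast)
  have ub: "norm (u k) \<le> 2 * \<beta>" for k using uc[of k 0] by (simp add: c0)
  have "T u k = u k" for k
  proof -
    have "norm (T u k - u k) \<le> 2 * \<beta> * (1/2) ^ n" for n
    proof -
      have "norm (T u k - T (c n) k) \<le> 2 * \<beta> * (1/2) ^ n / 2" by (rule contr[OF ub C uc])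
      moreover have "norm (u k - T (c n) k) \<le> 2 * \<beta> * (1/2) ^ n / 2" using uc[of k "Suc n"] by (simp add: cS)
      ultimately show ?thesis
        using norm_triangle_ineq4[of "T u k - T (c n) k" "u k - T (c n) k"] by simp
    qed
    then have "norm (T u k - u k) \<le> 0" by (intro LIMSEQ_le_const[OF to0]) blast
    then show ?thesis by simp
  qed
  then show ?thesis using that ub by blast
qed

context potential
begin

text \<open>Solving for the diagonal term gives a fixed point equation in which the potential acts
  with norm at most \<open>V_bound / d k\<close>, hence at most 1/2. The summand 1 keeps the
  diagonal away from zero even for a vanishing potential.\<close>

lemma bounded_fixed_point:
  fixes d :: "int \<times> int \<Rightarrow> real"
  assumes d: "\<And>k. d k \<ge> 2 * V_bound + 1" and b: "\<And>k. norm (b k) \<le> \<beta>"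
  obtains u :: "int \<times> int \<Rightarrow> complex" and C where "\<And>k. norm (u k) \<le> C"
    "\<And>k. of_real (d k) * u k + (\<Sum>\<^sub>\<infinity>l. cnj (V_coeff (l - k)) * u l) = b k"
proof -
  have dpos: "d k > 0" "d k \<noteq> 0" "d k \<ge> 1" for k using d[of k] V_bound_nonneg by auto
  define T where "T u k = (b k - (\<Sum>\<^sub>\<infinity>l. cnj (V_coeff (l - k)) * u l)) / of_real (d k)" for u k
  obtain u C where u: "\<And>k. norm (u k) \<le> C" "T u = u"
  proof (rule bounded_contraction_fixed_point[of T])
    fix u :: "int \<times> int \<Rightarrow> complex" and C
    assume u: "\<And>k. norm (u k) \<le> C"
    have "norm (T u k) \<le> \<beta> + V_bound * C" for k
    proof -
      have "norm (T u k) = norm (b k - (\<Sum>\<^sub>\<infinity>l. cnj (V_coeff (l - k)) * u l)) / d k"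
        using dpos[of k] by (simp add: T_def norm_divide)
      also have "\<dots> \<le> norm (b k - (\<Sum>\<^sub>\<infinity>l. cnj (V_coeff (l - k)) * u l)) / 1"
        using dpos[of k] by (intro divide_left_mono) auto
      also have "\<dots> \<le> \<beta> + V_bound * C"
        using norm_triangle_ineq4[of "b k" "\<Sum>\<^sub>\<infinity>l. cnj (V_coeff (l - k)) * u l"] b[of k] V_coeff_row_bounded(2)[where u = u and k = k, OF u]
        by simp
      finally show ?thesis .
    qed
    then show "\<exists>C'. \<forall>k. norm (T u k) \<le> C'" by blast
  next
    fix u v :: "int \<times> int \<Rightarrow> complex" and C C' D k
    assume u: "\<And>k. norm (u k) \<le> C" and v: "\<And>k. norm (v k) \<le> C'" and uv: "\<And>k. norm (u k - v k) \<le> D"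
    have D: "D \<ge> 0" using uv[of 0] norm_ge_zero order_trans by blast
    have "T u k - T v k = - ((\<Sum>\<^sub>\<infinity>l. cnj (V_coeff (l - k)) * u l) - (\<Sum>\<^sub>\<infinity>l. cnj (V_coeff (l - k)) * v l)) / of_real (d k)"
      by (simp add: T_def flip: diff_divide_distrib)
    also have "(\<Sum>\<^sub>\<infinity>l. cnj (V_coeff (l - k)) * u l) - (\<Sum>\<^sub>\<infinity>l. cnj (V_coeff (l - k)) * v l) = (\<Sum>\<^sub>\<infinity>l. cnj (V_coeff (l - k)) * (u l - v l))"
      unfolding right_diff_distrib
      by (rule infsumI[OF has_sum_diff[OF has_sum_infsum has_sum_infsum], symmetric]) (rule V_coeff_row_bounded[OF u] V_coeff_row_bounded[OF v])+
    finally have "norm (T u k - T v k) = norm (\<Sum>\<^sub>\<infinity>l. cnj (V_coeff (l - k)) * (u l - v l)) / d k"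
      using dpos[of k] by (simp add: norm_divide)
    also have "\<dots> \<le> V_bound * D / d k"
      using dpos[of k] by (intro divide_right_mono V_coeff_row_bounded(2) uv) auto
    also have "\<dots> \<le> D / 2"
    proof -
      have "V_bound * D \<le> (1/2 * d k) * D" using d[of k] D by (intro mult_right_mono) auto
      then show ?thesis using dpos[of k] by (simp add: pos_divide_le_eq mult_ac)
    qed
    finally show "norm (T u k - T v k) \<le> D / 2" .
  qed (rule that)
  have "of_real (d k) * u k + (\<Sum>\<^sub>\<infinity>l. cnj (V_coeff (l - k)) * u l) = b k" for k
  proof -
    have "u k = T u k" using u(2) by simp
    then show ?thesis using dpos[of k] by (simp add: T_def field_simps)
  qed
  with u(1) show ?thesis by (rule that)
qed

text \<open>The coefficients of the solution are first found in the space of bounded sequences; the growth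
  of \<open>d\<close> and \<open>\<Sum> 1 / en\<^sup>2 < \<infinity>\<close> put them into \<open>l\<^sup>2\<close>, and then the equation puts \<open>u\<close> into \<open>H2_M\<close>.\<close>

lemma shifted_solution:
  fixes d :: "int \<times> int \<Rightarrow> real"
  assumes d: "\<And>k. d k \<ge> en k / 2 + (2 * V_bound + 1)" and f: "f \<in> L2_M"
  shows "\<exists>u\<in>H2_M. \<forall>k. of_real (d k) * fc u k + fc (V_times u) k = fc f k"
proof -
  have dpos: "d k > 0" "d k \<noteq> 0" and ed: "en k \<le> 2 * d k" for k 
    using d[of k] V_bound_nonneg en_ge(4)[of k] by auto
  have fb: "norm (fc f k) \<le> sqrt (nrm2 f)" for k
    using Bessel[OF f, of "{k}"] by (simp add: real_le_rsqrt)
  have d': "d k \<ge> 2 * V_bound + 1" for k using d[of k] en_ge(4)[of k] by linarith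
  obtain c C where c: "\<And>k. norm (c k) \<le> C" 
    "\<And>k. of_real (d k) * c k + (\<Sum>\<^sub>\<infinity>l. cnj (V_coeff (l - k)) * c l) = fc f k"
    by (rule bounded_fixed_point[OF d' fb]) (rule that)
  have C: "C \<ge> 0" using c(1)[of 0] norm_ge_zero order_trans by blast
  \<comment> \<open>The equation bounds \<open>d k * norm (c k)\<close> by half of \<open>D\<close>,
    and \<open>en k\<close> is at most twice \<open>d k\<close>.\<close>
  define D where "D = 2 * (sqrt (nrm2 f) + V_bound * C)"
  have D: "D \<ge> 0" using C V_bound_nonneg by (simp add: D_def)
  have "(\<lambda>k. (norm (of_real D * (1 / complex_of_real (en k))))\<^sup>2) summable_on UNIV"
    using summable_on_cmult_right[OF summable_inverse_en_square, of "D\<^sup>2"] by (simp only: norm_mult power_mult_distrib norm_of_real power2_abs)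
  then have cs: "(\<lambda>k. (norm (c k))\<^sup>2) summable_on UNIV"
  proof (rule square_summable_mono)
    fix k
    have "of_real (d k) * c k = fc f k - (\<Sum>\<^sub>\<infinity>l. cnj (V_coeff (l - k)) * c l)"
      using c(2)[of k] by (simp add: algebra_simps)
    then have "d k * norm (c k) = norm (fc f k - (\<Sum>\<^sub>\<infinity>l. cnj (V_coeff (l - k)) * c l))"
      using dpos[of k] by (metis abs_of_pos norm_mult norm_of_real)
    also have "\<dots> \<le> sqrt (nrm2 f) + V_bound * C"
      using norm_triangle_ineq4[of "fc f k" "\<Sum>\<^sub>\<infinity>l. cnj (V_coeff (l - k)) * c l"] fb[of k] V_coeff_row_bounded(2)[where u = c and k = k, OF c(1)]
      by simp
    finally have 1: "2 * (d k * norm (c k)) \<le> D" by (simp add: D_def)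
    have "en k * norm (c k) \<le> 2 * d k * norm (c k)" by (intro mult_right_mono ed) auto
    with 1 have "norm (c k) * en k \<le> D" by (simp add: mult_ac)
    then have "norm (c k) \<le> D / en k" using en_ge(4)[of k] by (simp add: pos_le_divide_eq)
    then show "norm (c k) \<le> norm (of_real D * (1 / complex_of_real (en k)))"
      using D en_ge(4)[of k] by (simp add: norm_mult norm_divide)
  qed
  obtain u where u: "u \<in> L2_M" "\<And>k. fc u k = c k"
    by (rule Riesz_Fischer[OF cs]) (rule that)
  have eq: "of_real (d k) * fc u k + fc (V_times u) k = fc f k" for k
    using c(2)[of k] infsumI[OF fc_V_times_has_sum[OF u(1), of k]] by (simp add: u(2))
  have "(\<lambda>x. 2 * (f x - V_times u x)) \<in> L2_M" by (intro L2_M_scale L2_M_diff f V_times_L2_M u)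
  from fc_square_summable[OF this] have "(\<lambda>k. (norm (of_real (en k) * fc u k))\<^sup>2) summable_on UNIV"
  proof (rule square_summable_mono)
    fix k
    have "fc (\<lambda>x. 2 * (f x - V_times u x)) k = 2 * (of_real (d k) * fc u k)"
      unfolding fc_scale by (simp add: fc_diff f V_times_L2_M u(1) eq[of k, symmetric])
    then have "norm (fc (\<lambda>x. 2 * (f x - V_times u x)) k) = 2 * d k * norm (fc u k)"
      using dpos[of k] by (simp add: norm_mult)
    moreover have "en k * norm (fc u k) \<le> 2 * d k * norm (fc u k)" by (intro mult_right_mono ed) auto
    ultimately show "norm (of_real (en k) * fc u k) \<le> norm (fc (\<lambda>x. 2 * (f x - V_times u x)) k)"
      using en_ge(4)[of k] by (simp add: norm_mult)
  qed
  then have "u \<in> H2_M" using u(1) by (simp add: H2_M_iff)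
  with eq show ?thesis by blast
qed

end

section \<open>The Fredholm alternative\<close>

text \<open>Existence of a least-squares solution for the columns \<open>a j\<close>, whatever their
  rank, by a Gram-Schmidt induction. \<open>b\<close> is generalized because the induction
  hypothesis is also applied to the new column.\<close>

lemma finite_orthogonal_projection:
  fixes a :: "'j \<Rightarrow> 'i \<Rightarrow> complex"
  assumes "finite J" "finite I"
  shows "\<exists>x. \<forall>j\<in>J. (\<Sum>i\<in>I. cnj (b i - (\<Sum>j\<in>J. x j * a j i)) * a j i) = 0"
  using assms(1)
proof (induction J arbitrary: b)
  case (insert j0 J)
  define ip where "ip u v = (\<Sum>i\<in>I. cnj (u i) * v i)" for u v :: "'i \<Rightarrow> complex"
  have ip_diff: "ip (\<lambda>i. u i - c * v i) z = ip u z - cnj c * ip v z" for u v z c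
    by (simp add: ip_def sum_subtractf sum_distrib_left algebra_simps)
  have ip_add: "ip z (\<lambda>i. u i + v i) = ip z u + ip z v" for u v z
    by (simp add: ip_def sum.distrib algebra_simps)
  have ip_sum: "ip z (\<lambda>i. \<Sum>j\<in>J. y j * a j i) = (\<Sum>j\<in>J. y j * ip z (a j))" for z y
    unfolding ip_def sum_distrib_left by (subst sum.swap) (simp add: mult_ac)
  obtain x where x: "\<forall>j\<in>J. ip (\<lambda>i. b i - (\<Sum>j\<in>J. x j * a j i)) (a j) = 0"
    using insert.IH[of b] by (auto simp: ip_def)
  obtain y where y: "\<forall>j\<in>J. ip (\<lambda>i. a j0 i - (\<Sum>j\<in>J. y j * a j i)) (a j) = 0"
    using insert.IH[of "a j0"] by (auto simp: ip_def)
  define z where "z i = b i - (\<Sum>j\<in>J. x j * a j i)" for i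
  define r where "r i = a j0 i - (\<Sum>j\<in>J. y j * a j i)" for i
  \<comment> \<open>The coefficient that removes the component along \<open>r\<close>. If
    \<open>r\<close> vanishes on \<open>I\<close>, division by zero gives 0, and \<open>rr\<close>
    shows that nothing has to be removed then.\<close>
  define t where "t = cnj (ip z r / ip r r)"
  have a0: "a j0 = (\<lambda>i. r i + (\<Sum>j\<in>J. y j * a j i))" by (simp add: r_def)
  have rr: "ip r r = 0 \<Longrightarrow> ip z r = 0"
  proof -
    assume "ip r r = 0"
    then have "of_real (\<Sum>i\<in>I. (norm (r i))\<^sup>2) = (0 :: complex)"
      by (simp add: ip_def complex_norm_square mult.commute del: of_real_power)
    then have "(\<Sum>i\<in>I. (norm (r i))\<^sup>2) = 0" by (simp only: of_real_eq_0_iff)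
    then have "\<forall>i\<in>I. r i = 0" using assms(2) by (subst (asm) sum_nonneg_eq_0_iff) auto
    then show "ip z r = 0" by (simp add: ip_def)
  qed
  have zt: "ip (\<lambda>i. z i - t * r i) (a j) = 0" if "j \<in> insert j0 J" for j
  proof (cases "j = j0")
    case False
    with that x y show ?thesis by (auto simp: ip_diff z_def[abs_def] r_def[abs_def])
  next
    case True
    have e: "ip q (a j0) = ip q r + (\<Sum>j\<in>J. y j * ip q (a j))" for q
      by (subst a0) (simp only: ip_add ip_sum)
    have "(\<Sum>j\<in>J. y j * ip z (a j)) = 0" "(\<Sum>j\<in>J. y j * ip r (a j)) = 0"
      using x y by (auto simp: z_def[abs_def] r_def[abs_def] intro!: sum.neutral)
    then have "ip z (a j0) = ip z r" "ip r (a j0) = ip r r" by (simp_all add: e)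
    then have "ip (\<lambda>i. z i - t * r i) (a j) = ip z r - cnj t * ip r r" by (simp only: ip_diff True)
    then show ?thesis using rr by (cases "ip r r = 0") (simp_all add: t_def)
  qed
  have "z i - t * r i = b i - (\<Sum>j\<in>insert j0 J. (if j = j0 then t else x j - t * y j) * a j i)" for i
  proof -
    have "(\<Sum>j\<in>J. (if j = j0 then t else x j - t * y j) * a j i) = (\<Sum>j\<in>J. x j * a j i) - t * (\<Sum>j\<in>J. y j * a j i)"
      unfolding sum_distrib_left sum_subtractf[symmetric]
      by (rule sum.cong) (use insert.hyps in \<open>auto simp: algebra_simps\<close>)
    then show ?thesis using insert.hyps by (simp add: z_def r_def algebra_simps)
  qed
  then show ?case using zt unfolding ip_def by (intro exI[of _ "\<lambda>j. if j = j0 then t else x j - t * y j"]) simp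
qed simp

text \<open>Only finitely many modes are low. This takes the place of compactness of the resolvent
  in the Fredholm argument.\<close>

lemma finite_en_less: "finite {k. en k < R}"
proof (rule finite_subset)
  show "{k. en k < R} \<subseteq> {- \<lceil>R\<rceil>..\<lceil>R\<rceil>} \<times> {- \<lceil>R\<rceil>..\<lceil>R\<rceil>}"
  proof
    fix k assume "k \<in> {k. en k < R}"
    then have R: "en k < R" by simp
    have m: "m \<in> {- \<lceil>R\<rceil>..\<lceil>R\<rceil>}" if "(2 * real_of_int m + 1)\<^sup>2 \<le> en k" for m
    proof -
      have "\<bar>m\<bar> \<le> (2 * m + 1)\<^sup>2"
      proof -
        have "\<bar>m\<bar> \<le> \<bar>2 * m + 1\<bar>" by presburger
        moreover have "\<bar>2 * m + 1\<bar> * 1 \<le> \<bar>2 * m + 1\<bar> * \<bar>2 * m + 1\<bar>" by (intro mult_left_mono) presburger+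
        ultimately show ?thesis by (simp add: power2_eq_square)
      qed
      then have "real_of_int \<bar>m\<bar> \<le> (2 * real_of_int m + 1)\<^sup>2"
        by (metis (mono_tags, lifting) of_int_le_iff of_int_add of_int_mult of_int_numeral of_int_1 of_int_power)
      with that R have "real_of_int \<bar>m\<bar> \<le> R" by linarith
      then have "\<bar>m\<bar> \<le> \<lceil>R\<rceil>" by linarith
      then show ?thesis by auto
    qed
    have "(2 * real_of_int (fst k) + 1)\<^sup>2 \<le> en k" "(2 * real_of_int (snd k) + 1)\<^sup>2 \<le> en k"
      using xi_square_ge[of k] en_ge(1)[of k 1] en_ge(1)[of k 2] by linarith+
    then show "k \<in> {- \<lceil>R\<rceil>..\<lceil>R\<rceil>} \<times> {- \<lceil>R\<rceil>..\<lceil>R\<rceil>}" using m by (cases k) auto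
  qed
qed auto

context potential
begin

section \<open>The Hamiltonian on Fourier coefficients\<close>

lemma hamiltonian_eq: "hamiltonian V u x = - lap u x + V_times u x"
  by (simp add: hamiltonian_def lap_def V_times_def)

lemma hamiltonian_L2_M: "u \<in> H2_M \<Longrightarrow> hamiltonian V u \<in> L2_M"
  unfolding hamiltonian_eq[abs_def] by (intro L2_M_add L2_M_uminus lap_L2_M V_times_L2_M H2_M_L2_M)

lemma fc_hamiltonian: "u \<in> H2_M \<Longrightarrow> fc (hamiltonian V u) k = of_real (en k) * fc u k + fc (V_times u) k"
  unfolding hamiltonian_eq[abs_def]
  by (simp add: fc_diff lap_L2_M V_times_L2_M H2_M_L2_M fc_lap)

lemma hamiltonian_equation_iff:
  assumes u: "u \<in> H2_M" and f: "f \<in> L2_M"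
  shows "(AE x in lebesgue. hamiltonian V u x - of_real \<mu> * u x = f x) \<longleftrightarrow>
    (\<forall>k. of_real (en k - \<mu>) * fc u k + fc (V_times u) k = fc f k)" (is "?l \<longleftrightarrow> ?r")
proof -
  have L: "(\<lambda>x. hamiltonian V u x - of_real \<mu> * u x) \<in> L2_M"
    by (intro L2_M_diff hamiltonian_L2_M u L2_M_scale H2_M_L2_M)
  have c: "fc (\<lambda>x. hamiltonian V u x - of_real \<mu> * u x) k = of_real (en k - \<mu>) * fc u k + fc (V_times u) k" for k
    by (simp add: fc_diff hamiltonian_L2_M u L2_M_scale H2_M_L2_M fc_scale fc_hamiltonian algebra_simps)
  show ?thesis
    using fc_eq_imp_AE_eq[OF L f] fc_cong_AE[OF L, of f] unfolding c by metis
qed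

lemma eigenspace_iff:
  "v \<in> eigenspace_M V \<mu> \<longleftrightarrow> v \<in> H2_M \<and> (\<forall>k. of_real (en k - \<mu>) * fc v k + fc (V_times v) k = 0)"
  using hamiltonian_equation_iff[of v "\<lambda>x. 0" \<mu>] L2_M_zero by (auto simp: eigenspace_M_def)

text \<open>The weights are real and \<open>V\<close> is symmetric. The diagonal part is expressed
  as a difference, \<open>f\<close> minus \<open>V_times u\<close>, so that Parseval is applied only
  to functions in \<open>L2_M\<close>.\<close>

lemma shifted_symmetric:
  fixes d :: "int \<times> int \<Rightarrow> real"
  assumes u: "u \<in> L2_M" "f \<in> L2_M" "\<And>k. of_real (d k) * fc u k + fc (V_times u) k = fc f k"
    and v: "v \<in> L2_M" "g \<in> L2_M" "\<And>k. of_real (d k) * fc v k + fc (V_times v) k = fc g k"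
  shows "inner_M f v = inner_M u g"
proof -
  have "((\<lambda>k. cnj (fc f k) * fc v k - cnj (fc (V_times u) k) * fc v k) has_sum (inner_M f v - inner_M (V_times u) v)) UNIV"
    by (intro has_sum_diff Parseval u v V_times_L2_M)
  moreover have "((\<lambda>k. cnj (fc u k) * fc g k - cnj (fc u k) * fc (V_times v) k) has_sum (inner_M u g - inner_M u (V_times v))) UNIV"
    by (intro has_sum_diff Parseval u v V_times_L2_M)
  moreover have "cnj (fc f k) * fc v k - cnj (fc (V_times u) k) * fc v k = cnj (fc u k) * fc g k - cnj (fc u k) * fc (V_times v) k" for k
    unfolding u(3)[symmetric] v(3)[symmetric] by (simp add: algebra_simps)
  ultimately have "inner_M f v - inner_M (V_times u) v = inner_M u g - inner_M u (V_times v)"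
    by (auto intro: has_sum_unique)
  then show ?thesis by (simp add: V_times_symmetric)
qed

text \<open>Adding \<open>c\<close> on the finite set \<open>F\<close> of low modes makes the operator invertible, with a symmetric
  inverse \<open>G\<close>. The original equation is \<open>u = G (f + c P u)\<close> with \<open>P\<close> the projection to the modes in \<open>F\<close>,
  a finite Hermitian system for \<open>P u\<close>. The residual \<open>z\<close> of its least-squares solution \<open>x\<close> yields the
  eigenfunction \<open>G z\<close>, so that \<open>z = 0\<close> when \<open>f\<close> is orthogonal to the eigenspace.\<close>

theorem Fredholm_alternative:
  assumes f: "f \<in> L2_M" and orth: "\<And>v. v \<in> eigenspace_M V \<mu> \<Longrightarrow> inner_M v f = 0"
  shows "\<exists>u\<in>H2_M. AE x in lebesgue. hamiltonian V u x - of_real \<mu> * u x = f x"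
proof -
  \<comment> \<open>On \<open>F\<close> the shift absorbs \<open>\<mu>\<close> and the potential by
    itself; outside \<open>F\<close> the inequality \<open>en k \<ge> 2 * c\<close> lets half of
    \<open>en k\<close> do the same. This is the bound required by
    \<open>shifted_solution\<close>.\<close>
  define c where "c = \<bar>\<mu>\<bar> + 2 * V_bound + 1"
  have c: "c > 0" using V_bound_nonneg by (simp add: c_def)
  define F where "F = {k. en k < 2 * c}"
  have F: "finite F" by (simp add: F_def finite_en_less)
  define d where "d k = en k - \<mu> + (if k \<in> F then c else 0)" for k
  have d: "d k \<ge> en k / 2 + (2 * V_bound + 1)" for k
    using en_ge(4)[of k] by (auto simp: d_def F_def c_def)
  have "\<exists>u. u \<in> H2_M \<and> (\<forall>k. of_real (d k) * fc u k + fc (V_times u) k = fc f k)" if "f \<in> L2_M" for f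
    using shifted_solution[OF d that] by blast
  then obtain G where G: "\<And>f. f \<in> L2_M \<Longrightarrow> G f \<in> H2_M"
    "\<And>f k. f \<in> L2_M \<Longrightarrow> of_real (d k) * fc (G f) k + fc (V_times (G f)) k = fc f k" by metis
  have GL: "G f \<in> L2_M" if "f \<in> L2_M" for f using G(1)[OF that] by (rule H2_M_L2_M)
  have sym: "inner_M f (G g) = inner_M (G f) g" if "f \<in> L2_M" "g \<in> L2_M" for f g
    by (rule shifted_symmetric[where d = d]) (use that G GL in auto)
  define g where "g j = G (ch j)" for j
  have g: "g j \<in> H2_M" "g j \<in> L2_M" "of_real (d k) * fc (g j) k + fc (V_times (g j)) k = (if k = j then 1 else 0)" for j k
    using G[OF ch_L2_M] GL[OF ch_L2_M] by (simp_all add: g_def fc_ch)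
  have gsym: "fc (g i) j = cnj (fc (g j) i)" for i j
    using sym[OF ch_L2_M ch_L2_M, of j i] by (simp add: g_def fc_def inner_M_cnj)
  have gf: "fc (G f) i = inner_M (g i) f" for i
    using sym[OF ch_L2_M f] by (simp add: g_def fc_def)
  define comb where "comb z x = (\<Sum>j\<in>F. z j * g j x)" for z x
  have comb: "comb z \<in> L2_M" "fc (comb z) k = (\<Sum>j\<in>F. z j * fc (g j) k)"
    "fc (V_times (comb z)) k = (\<Sum>j\<in>F. z j * fc (V_times (g j)) k)" "comb z \<in> H2_M"
    "of_real (d k) * fc (comb z) k + fc (V_times (comb z)) k = (if k \<in> F then z k else 0)" for z k
  proof -
    show 1: "comb z \<in> L2_M" unfolding comb_def[abs_def] by (intro L2_M_sum L2_M_scale g)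
    show 2: "fc (comb z) k = (\<Sum>j\<in>F. z j * fc (g j) k)" for k
      unfolding comb_def[abs_def] by (subst fc_sum) (simp_all add: L2_M_scale g fc_scale)
    have "V_times (comb z) = (\<lambda>x. \<Sum>j\<in>F. z j * V_times (g j) x)"
      by (simp add: V_times_def comb_def sum_distrib_left mult_ac fun_eq_iff)
    then show 3: "fc (V_times (comb z)) k = (\<Sum>j\<in>F. z j * fc (V_times (g j)) k)" for k
      by (simp add: fc_sum L2_M_scale V_times_L2_M g fc_scale)
    have "(\<lambda>x. \<Sum>j\<in>F. z j * lap (g j) x) \<in> L2_M" by (intro L2_M_sum L2_M_scale lap_L2_M g)
    from fc_square_summable[OF this] have "(\<lambda>k. (norm (of_real (en k) * fc (comb z) k))\<^sup>2) summable_on UNIV"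
    proof (rule square_summable_mono)
      fix k
      have "fc (\<lambda>x. \<Sum>j\<in>F. z j * lap (g j) x) k = - (of_real (en k) * fc (comb z) k)"
        by (simp add: fc_sum L2_M_scale lap_L2_M g fc_scale fc_lap 2 sum_distrib_left sum_negf mult_ac)
      then show "norm (of_real (en k) * fc (comb z) k) \<le> norm (fc (\<lambda>x. \<Sum>j\<in>F. z j * lap (g j) x) k)" by simp
    qed
    with 1 show "comb z \<in> H2_M" by (simp add: H2_M_iff)
    have "of_real (d k) * fc (comb z) k + fc (V_times (comb z)) k = (\<Sum>j\<in>F. z j * (of_real (d k) * fc (g j) k + fc (V_times (g j)) k))"
      unfolding 2 3 sum_distrib_left by (simp add: sum.distrib algebra_simps)
    then show "of_real (d k) * fc (comb z) k + fc (V_times (comb z)) k = (if k \<in> F then z k else 0)"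
      using F by (simp add: g if_distrib sum.delta cong: if_cong)
  qed
  \<comment> \<open>The matrix of the identity minus \<open>c\<close> times the compression of
    \<open>G\<close> to the low modes. It is Hermitian by \<open>gsym\<close>.\<close>
  define a where "a j i = (if i = j then 1 else 0) - of_real c * fc (g j) i" for i j
  obtain x where x: "\<forall>j\<in>F. (\<Sum>i\<in>F. cnj (fc (G f) i - (\<Sum>j\<in>F. x j * a j i)) * a j i) = 0"
    using finite_orthogonal_projection[OF F F, of "fc (G f)" a] by blast
  define z where "z i = fc (G f) i - (\<Sum>j\<in>F. x j * a j i)" for i
  have z1: "(\<Sum>i\<in>F. cnj (z i) * a j i) = 0" if "j \<in> F" for j using x that by (simp add: z_def)
  \<comment> \<open>For a Hermitian matrix, orthogonality to all columns means lying in the kernel.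
    Thus \<open>z\<close> equals \<open>c\<close> times the low modes of \<open>comb z\<close>,
    which cancels the shift in the equation for \<open>comb z\<close>.\<close>
  have zj: "z j = of_real c * fc (comb z) j" if j: "j \<in> F" for j
  proof -
    have "(\<Sum>i\<in>F. cnj (z i) * a j i) = cnj (z j) - of_real c * (\<Sum>i\<in>F. cnj (z i) * fc (g j) i)"
    proof -
      have "cnj (z i) * a j i = (if i = j then cnj (z i) else 0) - of_real c * (cnj (z i) * fc (g j) i)" for i
        by (simp add: a_def algebra_simps)
      then show ?thesis using F j by (simp add: sum_subtractf sum_distrib_left)
    qed
    with z1[OF j] have "cnj (z j) = of_real c * (\<Sum>i\<in>F. cnj (z i) * fc (g j) i)" by simp
    then have "cnj (cnj (z j)) = cnj (of_real c * (\<Sum>i\<in>F. cnj (z i) * fc (g j) i))" by simp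
    also have "\<dots> = of_real c * (\<Sum>i\<in>F. z i * fc (g i) j)" by (simp add: gsym[of _ j])
    finally show ?thesis by (simp add: comb)
  qed
  have "comb z \<in> eigenspace_M V \<mu>"
    unfolding eigenspace_iff
  proof (intro conjI comb allI)
    fix k
    have "of_real (en k - \<mu>) * fc (comb z) k + fc (V_times (comb z)) k =
        (of_real (d k) * fc (comb z) k + fc (V_times (comb z)) k) - (if k \<in> F then of_real c * fc (comb z) k else 0)"
      by (simp add: d_def algebra_simps)
    also have "\<dots> = 0" by (simp add: comb(5) zj)
    finally show "of_real (en k - \<mu>) * fc (comb z) k + fc (V_times (comb z)) k = 0" .
  qed
  then have "inner_M (comb z) f = 0" by (rule orth)
  moreover have "inner_M (comb z) f = (\<Sum>i\<in>F. cnj (z i) * fc (G f) i)"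
    unfolding comb_def[abs_def] gf by (subst inner_M_sum_left) (simp_all add: f L2_M_scale g inner_M_scale_left)
  ultimately have z2: "(\<Sum>i\<in>F. cnj (z i) * fc (G f) i) = 0" by simp
  \<comment> \<open>The residual is orthogonal to the columns and, by the orthogonality of
    \<open>f\<close> to eigenfunctions, to the right-hand side; hence it is orthogonal to
    itself.\<close>
  have "(\<Sum>i\<in>F. cnj (z i) * z i) = (\<Sum>i\<in>F. cnj (z i) * fc (G f) i) - (\<Sum>j\<in>F. x j * (\<Sum>i\<in>F. cnj (z i) * a j i))"
  proof -
    have "(\<Sum>j\<in>F. x j * (\<Sum>i\<in>F. cnj (z i) * a j i)) = (\<Sum>i\<in>F. cnj (z i) * (\<Sum>j\<in>F. x j * a j i))"
      unfolding sum_distrib_left by (subst sum.swap) (simp add: mult_ac)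
    moreover have "(\<Sum>i\<in>F. cnj (z i) * z i) = (\<Sum>i\<in>F. cnj (z i) * fc (G f) i - cnj (z i) * (\<Sum>j\<in>F. x j * a j i))"
      by (rule sum.cong) (simp_all add: z_def right_diff_distrib)
    ultimately show ?thesis by (simp add: sum_subtractf)
  qed
  also have "\<dots> = 0" using z1 z2 by simp
  finally have "of_real (\<Sum>i\<in>F. (norm (z i))\<^sup>2) = (0 :: complex)"
    by (simp add: complex_norm_square mult.commute del: of_real_power)
  then have "(\<Sum>i\<in>F. (norm (z i))\<^sup>2) = 0" by (simp only: of_real_eq_0_iff)
  then have z0: "z i = 0" if "i \<in> F" for i using F that by (subst (asm) sum_nonneg_eq_0_iff) auto
  \<comment> \<open>This is \<open>G\<close> applied to \<open>f\<close> plus \<open>c\<close> times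
    the low-mode function with coefficients \<open>x\<close>. \<open>xu\<close> shows that
    \<open>x\<close> consists of the low modes of \<open>u\<close>, so the shift drops out
    again.\<close>
  define u where "u y = G f y + comb (\<lambda>j. of_real c * x j) y" for y
  have uL: "u \<in> L2_M" unfolding u_def[abs_def] by (intro L2_M_add GL f comb)
  have fu: "fc u k = fc (G f) k + fc (comb (\<lambda>j. of_real c * x j)) k" for k
    unfolding u_def[abs_def] by (rule fc_add[OF GL[OF f] comb(1)])
  have "V_times u = (\<lambda>y. V_times (G f) y + V_times (comb (\<lambda>j. of_real c * x j)) y)"
    by (simp add: V_times_def u_def fun_eq_iff algebra_simps)
  then have fVu: "fc (V_times u) k = fc (V_times (G f)) k + fc (V_times (comb (\<lambda>j. of_real c * x j))) k" for k
    by (simp add: fc_add V_times_L2_M GL f comb)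
  have uH: "u \<in> H2_M"
  proof -
    have "(\<lambda>y. lap (G f) y + lap (comb (\<lambda>j. of_real c * x j)) y) \<in> L2_M"
      by (intro L2_M_add lap_L2_M G f comb)
    from fc_square_summable[OF this] have "(\<lambda>k. (norm (of_real (en k) * fc u k))\<^sup>2) summable_on UNIV"
    proof (rule square_summable_mono)
      fix k
      have "fc (\<lambda>y. lap (G f) y + lap (comb (\<lambda>j. of_real c * x j)) y) k = - (of_real (en k) * fc u k)"
        by (simp add: fc_add lap_L2_M G f comb(4) fc_lap fu algebra_simps)
      then show "norm (of_real (en k) * fc u k) \<le> norm (fc (\<lambda>y. lap (G f) y + lap (comb (\<lambda>j. of_real c * x j)) y) k)" by simp
    qed
    with uL show ?thesis by (simp add: H2_M_iff)
  qed
  have xu: "x k = fc u k" if k: "k \<in> F" for k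
  proof -
    have "(\<Sum>j\<in>F. x j * a j k) = x k - of_real c * (\<Sum>j\<in>F. x j * fc (g j) k)"
    proof -
      have "x j * a j k = (if k = j then x j else 0) - of_real c * (x j * fc (g j) k)" for j
        by (simp add: a_def algebra_simps)
      then show ?thesis using F k by (simp add: sum_subtractf sum_distrib_left)
    qed
    then have "fc (G f) k = x k - of_real c * (\<Sum>j\<in>F. x j * fc (g j) k)"
      using z0[OF k] by (simp add: z_def)
    then show ?thesis by (simp add: fu comb(2) sum_distrib_left mult_ac)
  qed
  have "of_real (en k - \<mu>) * fc u k + fc (V_times u) k = fc f k" for k
  proof -
    have "of_real (en k - \<mu>) * fc u k + fc (V_times u) k = (of_real (d k) * fc (G f) k + fc (V_times (G f)) k) +
       (of_real (d k) * fc (comb (\<lambda>j. of_real c * x j)) k + fc (V_times (comb (\<lambda>j. of_real c * x j))) k) -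
       (if k \<in> F then of_real c * fc u k else 0)"
      by (simp add: fu fVu d_def algebra_simps)
    also have "\<dots> = fc f k" by (simp add: comb(5) G(2)[OF f] xu)
    finally show ?thesis .
  qed
  with hamiltonian_equation_iff[OF uH f] uH show ?thesis by blast
qed

end

section \<open>The resolvent\<close>

lemma H2_M_add_scale:
  assumes "f \<in> H2_M" "g \<in> H2_M"
  shows "(\<lambda>x. f x + c * g x) \<in> H2_M"
proof -
  note L = assms[THEN H2_M_L2_M]
  have "(\<lambda>x. lap f x + c * lap g x) \<in> L2_M" by (intro L2_M_add L2_M_scale lap_L2_M assms)
  from fc_square_summable[OF this] have "(\<lambda>k. (norm (of_real (en k) * fc (\<lambda>x. f x + c * g x) k))\<^sup>2) summable_on UNIV"
  proof (rule square_summable_mono)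
    fix k
    have "fc (\<lambda>x. lap f x + c * lap g x) k = - (of_real (en k) * fc (\<lambda>x. f x + c * g x) k)"
      by (simp add: fc_add fc_scale L L2_M_scale lap_L2_M assms fc_lap algebra_simps)
    then show "norm (of_real (en k) * fc (\<lambda>x. f x + c * g x) k) \<le> norm (fc (\<lambda>x. lap f x + c * lap g x) k)" by simp
  qed
  then show ?thesis by (simp add: H2_M_iff L2_M_add L2_M_scale L)
qed

lemma H2_M_zero: "(\<lambda>x. 0) \<in> H2_M"
  by (simp add: H2_M_iff L2_M_zero)

context potential
begin

text \<open>The equation for \<open>hamiltonian V u\<close> in coefficient form. It is linear in
  \<open>u\<close> and \<open>f\<close> as it stands, whereas \<open>hamiltonian\<close> contains
  chosen representatives of weak derivatives.\<close>

definition solves :: "real \<Rightarrow> (real^2 \<Rightarrow> complex) \<Rightarrow> (real^2 \<Rightarrow> complex) \<Rightarrow> bool" where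
  "solves \<mu> u f \<longleftrightarrow> u \<in> H2_M \<and> f \<in> L2_M \<and>
     (\<forall>k. of_real (en k - \<mu>) * fc u k + fc (V_times u) k = fc f k)"

lemma solves_iff:
  "solves \<mu> u f \<longleftrightarrow> u \<in> H2_M \<and> f \<in> L2_M \<and> (AE x in lebesgue. hamiltonian V u x - of_real \<mu> * u x = f x)"
  unfolding solves_def using hamiltonian_equation_iff by blast

lemma eigenspace_solves: "v \<in> eigenspace_M V \<mu> \<longleftrightarrow> solves \<mu> v (\<lambda>x. 0)"
  by (auto simp: eigenspace_iff solves_def L2_M_zero)

lemma solves_add_scale:
  assumes u: "solves \<mu> u f" and v: "solves \<mu> v g"
  shows "solves \<mu> (\<lambda>x. u x + c * v x) (\<lambda>x. f x + c * g x)"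
proof -
  have L: "u \<in> L2_M" "v \<in> L2_M" "f \<in> L2_M" "g \<in> L2_M" using u v by (auto simp: solves_def H2_M_L2_M)
  have "V_times (\<lambda>x. u x + c * v x) = (\<lambda>x. V_times u x + c * V_times v x)"
    by (simp add: V_times_def fun_eq_iff algebra_simps)
  moreover have "of_real (en k - \<mu>) * fc u k + fc (V_times u) k + c * (of_real (en k - \<mu>) * fc v k + fc (V_times v) k) = fc f k + c * fc g k" for k
    using u v unfolding solves_def by metis
  ultimately show ?thesis
    using u v L by (simp add: solves_def H2_M_add_scale L2_M_add L2_M_scale fc_add fc_scale V_times_L2_M algebra_simps)
qed

lemma solves_zero: "solves \<mu> (\<lambda>x. 0) (\<lambda>x. 0)"
proof -
  have "V_times (\<lambda>x. 0) = (\<lambda>x. 0)" by (simp add: V_times_def fun_eq_iff)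
  then show ?thesis by (simp add: solves_def H2_M_zero L2_M_zero)
qed

lemma solves_cong_AE:
  assumes u: "solves \<mu> u f" and ae: "AE x in lebesgue. u x = u' x"
  shows "solves \<mu> u' f"
proof -
  have L: "u \<in> L2_M" using u by (simp add: solves_def H2_M_L2_M)
  have "AE x in lebesgue. V_times u x = V_times u' x" using ae by eventually_elim (simp add: V_times_def)
  then have "fc (V_times u') k = fc (V_times u) k" for k by (rule fc_cong_AE[OF V_times_L2_M[OF L]])
  moreover have "fc u' k = fc u k" for k by (rule fc_cong_AE[OF L ae])
  ultimately show ?thesis using u H2_M_cong_AE[OF _ ae] by (simp add: solves_def)
qed

end

section \<open>The two-dimensional eigenspace and the inverse on its complement\<close>

locale eigenpair = potential +
  fixes \<mu> :: real and \<Phi> :: "2 \<Rightarrow> real^2 \<Rightarrow> complex"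
  assumes multiplicity: "eigenvalue_of_multiplicity V \<mu> 2"
    and eigenfunction: "\<And>p. \<Phi> p \<in> eigenspace_M V \<mu>"
    and orthonormal: "\<And>p q. inner_M (\<Phi> p) (\<Phi> q) = (if p = q then 1 else 0)"
begin

lemma Phi_H2_M: "\<Phi> p \<in> H2_M"
  using eigenfunction by (simp add: eigenspace_M_def)

lemma Phi_L2_M: "\<Phi> p \<in> L2_M"
  by (rule H2_M_L2_M[OF Phi_H2_M])

lemma AE_lincomb_zero:
  assumes v: "v \<in> L2_M" "\<And>p. inner_M (\<Phi> p) v = 0"
    and z: "AE x in lebesgue. a * \<Phi> 1 x + b * \<Phi> 2 x + c * v x = 0"
  shows "a = 0" "b = 0" "AE x in lebesgue. c * v x = 0"
proof -
  have L: "(\<lambda>x. a * \<Phi> 1 x + b * \<Phi> 2 x + c * v x) \<in> L2_M" "(\<lambda>x. a * \<Phi> 1 x + b * \<Phi> 2 x) \<in> L2_M"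
    by (intro L2_M_add L2_M_scale Phi_L2_M v)+
  have "inner_M (\<Phi> p) (\<lambda>x. a * \<Phi> 1 x + b * \<Phi> 2 x + c * v x) = (if p = 1 then a else 0) + (if p = 2 then b else 0)" for p
    by (simp add: inner_M_add_right inner_M_scale_right Phi_L2_M L2_M_scale L2_M_add v orthonormal)
  moreover have "inner_M (\<Phi> p) (\<lambda>x. a * \<Phi> 1 x + b * \<Phi> 2 x + c * v x) = inner_M (\<Phi> p) (\<lambda>x. 0)" for p
    by (intro inner_M_cong_AE Phi_L2_M L L2_M_zero z) auto
  ultimately have "(if p = 1 then a else 0) + (if p = 2 then b else 0) = 0" for p :: 2 by simp
  from this[of 1] this[of 2] show "a = 0" "b = 0" by auto
  then show "AE x in lebesgue. c * v x = 0" using z by simp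
qed

text \<open>Any three elements of a two-dimensional space satisfy the linear relation whose
  coefficients are their \<open>2 \<times> 2\<close> minors.\<close>

lemma eigenspace_orthogonal_zero:
  assumes v: "v \<in> eigenspace_M V \<mu>" "\<And>p. inner_M (\<Phi> p) v = 0"
  shows "AE x in lebesgue. v x = 0"
proof -
  have vL: "v \<in> L2_M" using v by (simp add: eigenspace_M_def H2_M_L2_M)
  obtain b :: "nat \<Rightarrow> real^2 \<Rightarrow> complex" where
    b: "\<And>f. f \<in> eigenspace_M V \<mu> \<Longrightarrow> \<exists>c :: nat \<Rightarrow> complex. AE x in lebesgue. f x = (\<Sum>i<2. c i * b i x)"
    using multiplicity unfolding eigenvalue_of_multiplicity_def by blast
  have b2: "\<exists>c d. AE x in lebesgue. f x = c * b 0 x + d * b 1 x" if "f \<in> eigenspace_M V \<mu>" for f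
    using b[OF that] by (auto simp: numeral_2_eq_2)
  obtain \<alpha> \<alpha>' where 1: "AE x in lebesgue. \<Phi> 1 x = \<alpha> * b 0 x + \<alpha>' * b 1 x" using b2[OF eigenfunction[of 1]] by blast
  obtain \<beta> \<beta>' where 2: "AE x in lebesgue. \<Phi> 2 x = \<beta> * b 0 x + \<beta>' * b 1 x" using b2[OF eigenfunction[of 2]] by blast
  obtain \<gamma> \<gamma>' where 3: "AE x in lebesgue. v x = \<gamma> * b 0 x + \<gamma>' * b 1 x" using b2[OF v(1)] by blast
  have "AE x in lebesgue. (\<beta> * \<gamma>' - \<beta>' * \<gamma>) * \<Phi> 1 x + (\<gamma> * \<alpha>' - \<gamma>' * \<alpha>) * \<Phi> 2 x + (\<alpha> * \<beta>' - \<alpha>' * \<beta>) * v x = 0"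
    using 1 2 3 by eventually_elim (simp add: algebra_simps)
  from AE_lincomb_zero(3)[OF vL v(2) this] have *: "AE x in lebesgue. (\<alpha> * \<beta>' - \<alpha>' * \<beta>) * v x = 0" .
  \<comment> \<open>If the minor vanished, the linear relations between \<open>\<Phi> 1\<close> and
    \<open>\<Phi> 2\<close> would force both coordinates of \<open>\<Phi> 1\<close> to be zero,
    against orthonormality.\<close>
  have "\<alpha> * \<beta>' - \<alpha>' * \<beta> \<noteq> 0"
  proof
    assume z: "\<alpha> * \<beta>' - \<alpha>' * \<beta> = 0"
    then have z': "\<alpha> * \<beta>' = \<alpha>' * \<beta>" by simp
    have "AE x in lebesgue. \<beta> * \<Phi> 1 x + (- \<alpha>) * \<Phi> 2 x + 0 * v x = 0"
      using 1 2
    proof eventually_elim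
      case (elim x)
      have "\<beta> * \<Phi> 1 x + (- \<alpha>) * \<Phi> 2 x + 0 * v x = (\<alpha>' * \<beta> - \<alpha> * \<beta>') * b 1 x" 
        unfolding elim by (simp add: algebra_simps)
      then show ?case by (simp add: z')
    qed
    from AE_lincomb_zero(2)[OF vL v(2) this] have a: "\<alpha> = 0" by simp
    have "AE x in lebesgue. \<beta>' * \<Phi> 1 x + (- \<alpha>') * \<Phi> 2 x + 0 * v x = 0"
      using 1 2
    proof eventually_elim
      case (elim x)
      have "\<beta>' * \<Phi> 1 x + (- \<alpha>') * \<Phi> 2 x + 0 * v x = (\<alpha> * \<beta>' - \<alpha>' * \<beta>) * b 0 x" 
        unfolding elim by (simp add: algebra_simps)
      then show ?case by (simp add: z')
    qed
    from AE_lincomb_zero(2)[OF vL v(2) this] have a': "\<alpha>' = 0" by simp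
    have "AE x in lebesgue. 1 * \<Phi> 1 x + 0 * \<Phi> 2 x + 0 * v x = 0" using 1 a a' by simp
    from AE_lincomb_zero(1)[OF vL v(2) this] show False by simp
  qed
  with * show ?thesis by simp
qed

definition proj :: "(real^2 \<Rightarrow> complex) \<Rightarrow> real^2 \<Rightarrow> complex" where
  "proj f x = (\<Sum>p\<in>UNIV. inner_M (\<Phi> p) f * \<Phi> p x)"

lemma proj_L2_M: "proj f \<in> L2_M"
  unfolding proj_def[abs_def] by (intro L2_M_sum L2_M_scale Phi_L2_M)

lemma inner_Phi_proj: "inner_M (\<Phi> p) (proj f) = inner_M (\<Phi> p) f"
  unfolding proj_def[abs_def]
  by (subst inner_M_sum_right) (simp_all add: Phi_L2_M L2_M_scale inner_M_scale_right orthonormal if_distrib cong: if_cong)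

lemma proj_eigenspace: "proj f \<in> eigenspace_M V \<mu>"
proof -
  have e: "solves \<mu> (\<Phi> p) (\<lambda>x. 0)" for p using eigenfunction by (simp add: eigenspace_solves)
  have "solves \<mu> (\<lambda>x. 0 + inner_M (\<Phi> 1) f * \<Phi> 1 x + inner_M (\<Phi> 2) f * \<Phi> 2 x)
      (\<lambda>x. 0 + inner_M (\<Phi> 1) f * 0 + inner_M (\<Phi> 2) f * 0)"
    by (intro solves_add_scale solves_zero e)
  then show ?thesis by (simp add: eigenspace_solves proj_def[abs_def] sum_2)
qed

text \<open>An eigenfunction minus its projection is an eigenfunction orthogonal to the pair, hence
  zero. So the pair spans the eigenspace, and two orthogonality conditions suffice for the Fredholm
  alternative.\<close>

lemma orthogonal_eigenspace:
  assumes f: "f \<in> L2_M" "\<And>p. inner_M (\<Phi> p) f = 0" and v: "v \<in> eigenspace_M V \<mu>"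
  shows "inner_M v f = 0"
proof -
  have vL: "v \<in> L2_M" using v by (simp add: eigenspace_M_def H2_M_L2_M)
  have "solves \<mu> (\<lambda>x. v x + (-1) * proj v x) (\<lambda>x. 0 + (-1) * 0)"
    using v proj_eigenspace by (intro solves_add_scale) (simp_all add: eigenspace_solves)
  then have "(\<lambda>x. v x - proj v x) \<in> eigenspace_M V \<mu>" by (simp add: eigenspace_solves)
  moreover have "inner_M (\<Phi> p) (\<lambda>x. v x - proj v x) = 0" for p
    by (simp add: inner_M_diff_right Phi_L2_M vL proj_L2_M inner_Phi_proj)
  ultimately have "AE x in lebesgue. v x - proj v x = 0" by (rule eigenspace_orthogonal_zero)
  then have "inner_M v f = inner_M (proj v) f"
    by (intro inner_M_cong_AE vL proj_L2_M f) auto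
  also have "\<dots> = (\<Sum>p\<in>UNIV. cnj (inner_M (\<Phi> p) v) * inner_M (\<Phi> p) f)"
    unfolding proj_def[abs_def] by (subst inner_M_sum_left) (simp_all add: f L2_M_scale Phi_L2_M inner_M_scale_left)
  finally show ?thesis by (simp add: f)
qed

text \<open>A solution from the Fredholm alternative is normalised twice: its kernel component is
  subtracted, and it is replaced by its continuous representative.\<close>

lemma orthogonal_solvable:
  assumes f: "f \<in> L2_M" "\<And>p. inner_M (\<Phi> p) f = 0"
  obtains u where "continuous_on UNIV u" "\<And>x v. v \<in> \<Lambda> \<Longrightarrow> u (x + v) = phase v * u x"
    "\<And>p. inner_M (\<Phi> p) u = 0" "solves \<mu> u f"
proof -
  obtain u0 where u0: "solves \<mu> u0 f"
    using Fredholm_alternative[OF f(1) orthogonal_eigenspace[OF f]] f(1) by (auto simp: solves_iff)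
  then have u0L: "u0 \<in> L2_M" by (simp add: solves_def H2_M_L2_M)
  define u1 where "u1 x = u0 x - proj u0 x" for x
  have "solves \<mu> (\<lambda>x. u0 x + (-1) * proj u0 x) (\<lambda>x. f x + (-1) * 0)"
    using u0 proj_eigenspace by (intro solves_add_scale) (simp_all add: eigenspace_solves)
  then have u1: "solves \<mu> u1 f" by (simp add: u1_def[abs_def])
  then have u1L: "u1 \<in> L2_M" by (simp add: solves_def H2_M_L2_M)
  have u1o: "inner_M (\<Phi> p) u1 = 0" for p
    unfolding u1_def[abs_def] by (simp add: inner_M_diff_right Phi_L2_M u0L proj_L2_M inner_Phi_proj)
  obtain u where u: "continuous_on UNIV u" "\<And>x v. v \<in> \<Lambda> \<Longrightarrow> u (x + v) = phase v * u x"
    "AE x in lebesgue. u1 x = u x"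
    by (rule continuous_representative[OF u1L]) (use u1 H2_M_fc_abs_summable in \<open>auto simp: solves_def\<close>)
  have "inner_M (\<Phi> p) u = 0" for p
    unfolding u1o[of p, symmetric]
    by (intro inner_M_cong_AE Phi_L2_M u1L L2_M_cong_AE[OF u1L u(3)]) (use u(3) in auto)
  with that[OF u(1,2) _ solves_cong_AE[OF u1 u(3)]] show ?thesis by blast
qed

definition is_resolvent :: "(real^2 \<Rightarrow> complex) \<Rightarrow> (real^2 \<Rightarrow> complex) \<Rightarrow> bool" where
  "is_resolvent f u \<longleftrightarrow> continuous_on UNIV u \<and> (\<forall>p. inner_M (\<Phi> p) u = 0) \<and> solves \<mu> u (\<lambda>x. f x - proj f x)"

text \<open>The difference is an eigenfunction orthogonal to the pair, so it vanishes almost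
  everywhere, and by continuity everywhere. This justifies the \<open>THE\<close> in
  \<open>resolvent\<close>.\<close>

lemma is_resolvent_unique:
  assumes "is_resolvent f u" "is_resolvent f u'"
  shows "u = u'"
proof
  fix x
  have "solves \<mu> (\<lambda>x. u x + (-1) * u' x) (\<lambda>x. (f x - proj f x) + (-1) * (f x - proj f x))"
    using assms by (intro solves_add_scale) (auto simp: is_resolvent_def)
  then have "(\<lambda>x. u x - u' x) \<in> eigenspace_M V \<mu>" by (simp add: eigenspace_solves)
  moreover have "inner_M (\<Phi> p) (\<lambda>x. u x - u' x) = 0" for p
    using assms by (subst inner_M_diff_right) (auto simp: is_resolvent_def solves_def Phi_L2_M H2_M_L2_M)
  ultimately have "AE x in lebesgue. u x - u' x = 0" by (rule eigenspace_orthogonal_zero)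
  then show "u x = u' x"
    using assms by (intro continuous_AE_imp_eq) (auto simp: is_resolvent_def)
qed

lemma resolvent_eqI:
  assumes "f \<in> L2_M" "is_resolvent f u"
  shows "resolvent V \<mu> \<Phi> f = u"
proof -
  have "(continuous_on UNIV u \<and> u \<in> H2_M \<and> (\<forall>p. inner_M (\<Phi> p) u = 0) \<and>
     (AE x in lebesgue. hamiltonian V u x - of_real \<mu> * u x = f x - (\<Sum>p\<in>UNIV. inner_M (\<Phi> p) f * \<Phi> p x))) \<longleftrightarrow> is_resolvent f u" for u
    using L2_M_diff[OF assms(1) proj_L2_M] by (auto simp: is_resolvent_def solves_iff proj_def)
  then show ?thesis
    unfolding resolvent_def using assms(2) is_resolvent_unique by auto
qed

lemma resolvent_is_resolvent:
  assumes f: "f \<in> L2_M"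
  shows "is_resolvent f (resolvent V \<mu> \<Phi> f)"
proof -
  have "(\<lambda>x. f x - proj f x) \<in> L2_M" by (intro L2_M_diff f proj_L2_M)
  moreover have "inner_M (\<Phi> p) (\<lambda>x. f x - proj f x) = 0" for p
    by (simp add: inner_M_diff_right Phi_L2_M f proj_L2_M inner_Phi_proj)
  ultimately obtain u where "is_resolvent f u"
    by (rule orthogonal_solvable) (auto simp: is_resolvent_def intro: that)
  with resolvent_eqI[OF f this] show ?thesis by simp
qed

lemma resolvent_H2_M: "f \<in> L2_M \<Longrightarrow> resolvent V \<mu> \<Phi> f \<in> H2_M"
  using resolvent_is_resolvent by (auto simp: is_resolvent_def solves_def)

text \<open>The combination on the right has all properties that characterise the resolvent, so
  uniqueness gives linearity at every point.\<close>

lemma resolvent_add_scale: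
  assumes f: "f \<in> L2_M" and g: "g \<in> L2_M"
  shows "resolvent V \<mu> \<Phi> (\<lambda>x. f x + c * g x) = (\<lambda>x. resolvent V \<mu> \<Phi> f x + c * resolvent V \<mu> \<Phi> g x)"
proof (rule resolvent_eqI)
  show "(\<lambda>x. f x + c * g x) \<in> L2_M" by (intro L2_M_add L2_M_scale f g)
  note rf = resolvent_is_resolvent[OF f, unfolded is_resolvent_def] 
  note rg = resolvent_is_resolvent[OF g, unfolded is_resolvent_def]
  have "proj (\<lambda>x. f x + c * g x) x = proj f x + c * proj g x" for x
    by (simp add: proj_def inner_M_add_right inner_M_scale_right Phi_L2_M f g L2_M_scale sum_distrib_left sum.distrib algebra_simps)
  then have "(\<lambda>x. f x + c * g x - proj (\<lambda>x. f x + c * g x) x) = (\<lambda>x. f x - proj f x + c * (g x - proj g x))"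
    by (simp add: fun_eq_iff algebra_simps)
  moreover have "inner_M (\<Phi> p) (\<lambda>x. resolvent V \<mu> \<Phi> f x + c * resolvent V \<mu> \<Phi> g x) = 0" for p
    using rf rg by (simp add: inner_M_add_right inner_M_scale_right Phi_L2_M H2_M_L2_M resolvent_H2_M f g L2_M_scale)
  ultimately show "is_resolvent (\<lambda>x. f x + c * g x) (\<lambda>x. resolvent V \<mu> \<Phi> f x + c * resolvent V \<mu> \<Phi> g x)"
    using rf rg by (auto simp: is_resolvent_def intro!: continuous_intros solves_add_scale)
qed

lemma resolvent_zero: "resolvent V \<mu> \<Phi> (\<lambda>x. 0) = (\<lambda>x. 0)"
  by (rule resolvent_eqI) (auto simp: is_resolvent_def L2_M_zero proj_def solves_zero)

lemma resolvent_sum: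
  assumes "\<And>i. i \<in> I \<Longrightarrow> h i \<in> L2_M"
  shows "resolvent V \<mu> \<Phi> (\<lambda>x. \<Sum>i\<in>I. c i * h i x) = (\<lambda>x. \<Sum>i\<in>I. c i * resolvent V \<mu> \<Phi> (h i) x)"
  using assms
proof (induction I rule: infinite_finite_induct)
  case (insert i I)
  have "resolvent V \<mu> \<Phi> (\<lambda>x. \<Sum>i\<in>insert i I. c i * h i x) = resolvent V \<mu> \<Phi> (\<lambda>x. (\<Sum>i\<in>I. c i * h i x) + c i * h i x)"
    using insert.hyps by (simp add: add.commute)
  also have "\<dots> = (\<lambda>x. (\<Sum>i\<in>I. c i * resolvent V \<mu> \<Phi> (h i) x) + c i * resolvent V \<mu> \<Phi> (h i) x)"
    using insert by (subst resolvent_add_scale) (auto intro!: L2_M_sum L2_M_scale)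
  finally show ?case using insert.hyps by (simp add: add.commute)
qed (simp_all add: resolvent_zero)

end

text \<open>The spatial derivative is again jointly smooth in position and time, so the lemma can be
  applied to its own output to reach second derivatives.\<close>

lemma pd_slow:
  fixes c :: "real^2 \<Rightarrow> real \<Rightarrow> complex"
  assumes "smooth (\<lambda>(X, T). c X T)"
  shows "smooth (\<lambda>(X, T). pd s (\<lambda>X. c X T) X)" and "(\<lambda>X. c X T) differentiable (at X)"
    and "(\<lambda>T. c X T) differentiable (at T)"
proof -
  define f where "f = (\<lambda>(X, T). c X T)"
  have d: "(f has_derivative frechet_derivative f (at z)) (at z)" for z
    using smooth_differentiable[OF assms] frechet_derivative_works unfolding f_def by blast
  have dX: "((\<lambda>X. c X T) has_derivative (\<lambda>h. frechet_derivative f (at (X, T)) (h, 0))) (at X)" for X T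
    using has_derivative_compose[OF has_derivative_Pair[OF has_derivative_ident has_derivative_const] d[of "(X, T)"]]
    by (simp add: f_def)
  have dT: "((\<lambda>T. c X T) has_derivative (\<lambda>h. frechet_derivative f (at (X, T)) (0, h))) (at T)" for X T
    using has_derivative_compose[OF has_derivative_Pair[OF has_derivative_const has_derivative_ident] d[of "(X, T)"]]
    by (simp add: f_def)
  show "(\<lambda>X. c X T) differentiable (at X)" "(\<lambda>T. c X T) differentiable (at T)"
    using dX dT unfolding differentiable_def by blast+
  have "(\<lambda>(X, T). pd s (\<lambda>X. c X T) X) = (\<lambda>z. frechet_derivative f (at z) (axis s 1, 0))"
    using pd_eqI[OF dX] by (auto simp: fun_eq_iff)
  moreover have "smooth (\<lambda>z. frechet_derivative f (at z) (axis s 1, 0))"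
    using assms by (intro smooth_deriv) (auto simp: f_def Basis_prod_def)
  ultimately show "smooth (\<lambda>(X, T). pd s (\<lambda>X. c X T) X)" by simp
qed

lemma pd_sum_mult:
  fixes g :: "'i \<Rightarrow> real^2 \<Rightarrow> complex"
  assumes "\<And>i. i \<in> I \<Longrightarrow> g i differentiable (at X)"
  shows "pd r (\<lambda>X. \<Sum>i\<in>I. g i X * k i) X = (\<Sum>i\<in>I. pd r (g i) X * k i)"
proof -
  have "((\<lambda>X. \<Sum>i\<in>I. g i X * k i) has_derivative (\<lambda>h. \<Sum>i\<in>I. frechet_derivative (g i) (at X) h * k i)) (at X)"
    using assms frechet_derivative_works by (intro has_derivative_sum has_derivative_mult_left) blast
  from pd_eqI[OF this] show ?thesis by (simp add: pd_def)
qed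

text \<open>Even for the zero function \<open>wpd\<close> may choose any function that vanishes
  almost everywhere. Needed for the mixed term in X2, where the inner derivative is zero.\<close>

lemma wpd_zero: "AE x in lebesgue. wpd r (\<lambda>x. 0) x = 0"
proof -
  have w: "weak_pd r (\<lambda>x. 0) (\<lambda>x. 0)" by (intro weak_pdI L2_M_zero) simp
  show ?thesis using fc_wpd[OF w] by (intro fc_eq_imp_AE_eq L2_M_zero) auto
qed

text \<open>Both sides are weak derivatives of the same function and so have the same coefficients;
  the choice made by \<open>wpd\<close> prevents more than equality almost everywhere.\<close>

lemma wpd_sum:
  assumes "\<And>i. i \<in> I \<Longrightarrow> h i \<in> H2_M"
  shows "AE x in lebesgue. wpd r (\<lambda>y. \<Sum>i\<in>I. c i * h i y) x = (\<Sum>i\<in>I. c i * wpd r (h i) x)"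
proof -
  have w: "weak_pd r (h i) (wpd r (h i))" if "i \<in> I" for i using assms[OF that] by (rule H2_M_weak_pd)
  have L: "h i \<in> L2_M" "wpd r (h i) \<in> L2_M" if "i \<in> I" for i using weak_pd_L2_M[OF w[OF that]] by auto
  have "weak_pd r (\<lambda>y. \<Sum>i\<in>I. c i * h i y) (\<lambda>x. \<Sum>i\<in>I. c i * wpd r (h i) x)"
  proof (rule weak_pdI)
    show "(\<lambda>y. \<Sum>i\<in>I. c i * h i y) \<in> L2_M" "(\<lambda>x. \<Sum>i\<in>I. c i * wpd r (h i) x) \<in> L2_M"
      using L by (auto intro!: L2_M_sum L2_M_scale)
    fix k
    have "fc (\<lambda>x. \<Sum>i\<in>I. c i * wpd r (h i) x) k = (\<Sum>i\<in>I. c i * fc (wpd r (h i)) k)"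
      using L by (subst fc_sum) (auto intro!: L2_M_scale simp: fc_scale)
    also have "\<dots> = \<i> * of_real (xi k $ r) * (\<Sum>i\<in>I. c i * fc (h i) k)"
      unfolding sum_distrib_left by (rule sum.cong) (simp_all add: weak_pd_fc[OF w])
    also have "(\<Sum>i\<in>I. c i * fc (h i) k) = fc (\<lambda>y. \<Sum>i\<in>I. c i * h i y) k"
      using L by (subst fc_sum) (auto intro!: L2_M_scale simp: fc_scale)
    finally show "fc (\<lambda>x. \<Sum>i\<in>I. c i * wpd r (h i) x) k = \<i> * of_real (xi k $ r) * fc (\<lambda>y. \<Sum>i\<in>I. c i * h i y) k" .
  qed
  note this' = this
  show ?thesis
    by (intro fc_eq_imp_AE_eq fc_wpd(1)[OF this'] weak_pd_L2_M(2)[OF this'])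
       (simp only: fc_wpd(2)[OF this'] weak_pd_fc[OF this'])
qed

section \<open>The second-order equation\<close>

context eigenpair
begin

definition res_grad :: "2 \<Rightarrow> 2 \<Rightarrow> real^2 \<Rightarrow> complex" where
  "res_grad q s = resolvent V \<mu> \<Phi> (wpd s (\<Phi> q))"

lemma wpd_Phi_L2_M: "wpd s (\<Phi> q) \<in> L2_M"
  using weak_pd_L2_M(2)[OF H2_M_weak_pd(1)[OF Phi_H2_M]] .

lemma res_grad_H2_M: "res_grad q s \<in> H2_M"
  unfolding res_grad_def by (intro resolvent_H2_M wpd_Phi_L2_M)

text \<open>Integration by parts moves the derivative onto \<open>\<Phi> p\<close>; its minus sign
  is the origin of the sign in front of the coefficients in the amplitude system.\<close>

lemma inner_Phi_wpd_res_grad: "inner_M (\<Phi> p) (wpd r (res_grad q s)) = - a_coeff V \<mu> \<Phi> p q r s"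
  using weak_pd_integration_by_parts[OF H2_M_weak_pd(1)[where r = r, OF Phi_H2_M[of p]] H2_M_weak_pd(1)[where r = r, OF res_grad_H2_M[of q s]]]
  by (simp add: a_coeff_def res_grad_def)

text \<open>The double sum is flattened to a sum over pairs, so that linearity of the resolvent is
  used once.\<close>

lemma resolvent_gradient:
  "resolvent V \<mu> \<Phi> (\<lambda>y. \<Sum>q\<in>UNIV. \<Sum>s\<in>UNIV. k q s * wpd s (\<Phi> q) y) x = (\<Sum>q\<in>UNIV. \<Sum>s\<in>UNIV. k q s * res_grad q s x)"
proof -
  have "(\<lambda>y. \<Sum>q\<in>UNIV. \<Sum>s\<in>UNIV. k q s * wpd s (\<Phi> q) y) =
      (\<lambda>y. \<Sum>i\<in>UNIV. k (fst i) (snd i) * wpd (snd i) (\<Phi> (fst i)) y)"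
    by (simp add: sum.cartesian_product case_prod_unfold)
  then show ?thesis
    by (simp only: resolvent_sum[OF wpd_Phi_L2_M]) (simp add: res_grad_def sum.cartesian_product case_prod_unfold)
qed

end

section \<open>Amplitudes that satisfy the Schroedinger system\<close>

locale amplitudes = eigenpair +
  fixes C :: "2 \<Rightarrow> real^2 \<Rightarrow> real \<Rightarrow> complex"
  assumes smooth_C: "\<And>q. smooth (\<lambda>(X1, T2). C q X1 T2)"
    and Schroedinger: "\<And>p X1 T2. \<i> * vector_derivative (\<lambda>T. C p X1 T) (at T2) =
          - (\<Sum>r\<in>UNIV. pd r (pd r (\<lambda>X. C p X T2)) X1)
          + 4 * (\<Sum>q\<in>UNIV. \<Sum>r\<in>UNIV. \<Sum>s\<in>UNIV.
              a_coeff V \<mu> \<Phi> p q r s * pd r (pd s (\<lambda>X. C q X T2)) X1)"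
begin

lemma C_differentiable:
  "(\<lambda>X. C q X T) differentiable (at X)" "(\<lambda>T. C q X T) differentiable (at T)"
  "pd s (\<lambda>X. C q X T) differentiable (at X)"
  using pd_slow(2,3)[OF smooth_C] pd_slow(2)[OF pd_slow(1)[OF smooth_C]] by blast+

definition slow_amp :: "2 \<Rightarrow> amplitude" where
  "slow_amp = (\<lambda>q X1 X2 T2. C q X1 T2)"

definition hess :: "2 \<Rightarrow> 2 \<Rightarrow> 2 \<Rightarrow> real^2 \<Rightarrow> real \<Rightarrow> complex" where
  "hess q r s X1 T2 = pd r (pd s (\<lambda>X. C q X T2)) X1"

text \<open>The coefficient of \<open>\<Phi> q\<close> in the time derivative and slow Laplacian
  terms acting on \<open>psi0\<close>.\<close>

definition drift :: "2 \<Rightarrow> real^2 \<Rightarrow> real \<Rightarrow> complex" where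
  "drift q X1 T2 = \<i> * vector_derivative (\<lambda>T. C q X1 T) (at T2) + (\<Sum>r\<in>UNIV. hess q r r X1 T2)"

text \<open>The right-hand side as a combination of fixed functions of x with slow coefficients. The
  4 is the 2 of the equation times the 2 in \<open>psi1\<close>.\<close>

definition source :: "real^2 \<Rightarrow> real \<Rightarrow> real^2 \<Rightarrow> complex" where
  "source X1 T2 x = - (\<Sum>q\<in>UNIV. drift q X1 T2 * \<Phi> q x)
     - 4 * (\<Sum>q\<in>UNIV. \<Sum>r\<in>UNIV. \<Sum>s\<in>UNIV. hess q r s X1 T2 * wpd r (res_grad q s) x)"

lemma drift_eq:
  "drift p X1 T2 = 4 * (\<Sum>q\<in>UNIV. \<Sum>r\<in>UNIV. \<Sum>s\<in>UNIV. a_coeff V \<mu> \<Phi> p q r s * hess q r s X1 T2)"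
  by (simp add: drift_def Schroedinger hess_def)

lemma wpd_res_grad_L2_M: "wpd r (res_grad q s) \<in> L2_M"
  using weak_pd_L2_M(2)[OF H2_M_weak_pd(1)[OF res_grad_H2_M]] .

lemma source_L2_M: "source X1 T2 \<in> L2_M"
  unfolding source_def[abs_def]
  by (intro L2_M_diff L2_M_uminus L2_M_scale L2_M_sum Phi_L2_M wpd_res_grad_L2_M)

text \<open>Orthonormality isolates \<open>drift p\<close> and \<open>inner_Phi_wpd_res_grad\<close>
  turns the remaining inner products into coefficients, so the p-th condition is exactly the p-th
  amplitude equation.\<close>

lemma source_orthogonal: "inner_M (\<Phi> p) (source X1 T2) = 0"
proof -
  have "inner_M (\<Phi> p) (source X1 T2) = - (\<Sum>q\<in>UNIV. drift q X1 T2 * inner_M (\<Phi> p) (\<Phi> q))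
     - 4 * (\<Sum>q\<in>UNIV. \<Sum>r\<in>UNIV. \<Sum>s\<in>UNIV. hess q r s X1 T2 * inner_M (\<Phi> p) (wpd r (res_grad q s)))"
    unfolding source_def[abs_def]
    by (subst inner_M_diff_right inner_M_uminus_right inner_M_scale_right inner_M_sum_right;
        (intro L2_M_diff L2_M_uminus L2_M_scale L2_M_sum Phi_L2_M wpd_res_grad_L2_M)?)+ simp
  also have "\<dots> = - drift p X1 T2 + 4 * (\<Sum>q\<in>UNIV. \<Sum>r\<in>UNIV. \<Sum>s\<in>UNIV. a_coeff V \<mu> \<Phi> p q r s * hess q r s X1 T2)"
    by (simp add: orthonormal inner_Phi_wpd_res_grad sum_negf if_distrib mult.commute cong: if_cong)
  also have "\<dots> = 0" by (simp add: drift_eq)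
  finally show ?thesis .
qed

lemma psi1_eq:
  "psi1 V \<mu> \<Phi> slow_amp x X1 X2 T2 = 2 * (\<Sum>q\<in>UNIV. \<Sum>s\<in>UNIV. pd s (\<lambda>X. C q X T2) X1 * res_grad q s x)"
  by (simp add: psi1_def slow_amp_def resolvent_gradient)

text \<open>For fixed \<open>y\<close> the values of \<open>res_grad\<close> are constants in X1,
  because \<open>psi1_eq\<close> holds at every point and not only almost everywhere.\<close>

lemma pd_psi1:
  "pd r (\<lambda>X. psi1 V \<mu> \<Phi> slow_amp y X X2 T2) X1 = (\<Sum>i\<in>UNIV. 2 * hess (fst i) r (snd i) X1 T2 * res_grad (fst i) (snd i) y)"
proof -
  have "(\<lambda>X. psi1 V \<mu> \<Phi> slow_amp y X X2 T2) =
      (\<lambda>X. \<Sum>i\<in>UNIV. pd (snd i) (\<lambda>X. C (fst i) X T2) X * (2 * res_grad (fst i) (snd i) y))"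
    by (simp add: psi1_eq sum.cartesian_product case_prod_unfold sum_distrib_left mult_ac)
  then show ?thesis
    by (simp only: pd_sum_mult[OF C_differentiable(3)]) (simp add: hess_def mult_ac)
qed

lemma rhs2_eq_source:
  "AE x in lebesgue. rhs2 (psi0 \<Phi> slow_amp) (psi1 V \<mu> \<Phi> slow_amp) x X1 X2 T2 = source X1 T2 x"
proof -
  have t: "vector_derivative (\<lambda>T. psi0 \<Phi> slow_amp x X1 X2 T) (at T2) =
      (\<Sum>q\<in>UNIV. vector_derivative (\<lambda>T. C q X1 T) (at T2) * \<Phi> q x)" for x
  proof (rule vector_derivative_at)
    have "((\<lambda>T. C q X1 T) has_vector_derivative vector_derivative (\<lambda>T. C q X1 T) (at T2)) (at T2)" for q
      using C_differentiable(2) vector_derivative_works by blast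
    then show "((\<lambda>T. psi0 \<Phi> slow_amp x X1 X2 T) has_vector_derivative (\<Sum>q\<in>UNIV. vector_derivative (\<lambda>T. C q X1 T) (at T2) * \<Phi> q x)) (at T2)"
      unfolding psi0_def slow_amp_def by (intro has_vector_derivative_sum has_vector_derivative_mult_left)
  qed
  \<comment> \<open>The amplitudes do not depend on X2, so the mixed term is a weak derivative of
    the zero function.\<close>
  have z: "pd r (\<lambda>X. psi0 \<Phi> slow_amp y X1 X T2) X2 = 0" for r y
    unfolding psi0_def slow_amp_def by (rule pd_eqI[OF has_derivative_const])
  have l: "pd r (pd r (\<lambda>X. psi0 \<Phi> slow_amp x X X2 T2)) X1 = (\<Sum>q\<in>UNIV. hess q r r X1 T2 * \<Phi> q x)" for r x
  proof -
    have "pd r (\<lambda>X. psi0 \<Phi> slow_amp x X X2 T2) = (\<lambda>X. \<Sum>q\<in>UNIV. pd r (\<lambda>X. C q X T2) X * \<Phi> q x)"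
      unfolding psi0_def slow_amp_def by (intro ext pd_sum_mult C_differentiable)
    then show ?thesis by (simp only: pd_sum_mult[OF C_differentiable(3)] hess_def)
  qed
  have w: "AE x in lebesgue. \<forall>r. wpd r (\<lambda>y. pd r (\<lambda>X. psi1 V \<mu> \<Phi> slow_amp y X X2 T2) X1) x =
      (\<Sum>i\<in>UNIV. 2 * hess (fst i) r (snd i) X1 T2 * wpd r (res_grad (fst i) (snd i)) x)"
    unfolding pd_psi1 AE_all_countable by (intro allI wpd_sum[OF res_grad_H2_M])
  have w0: "AE x in lebesgue. \<forall>r. wpd r (\<lambda>x. 0) x = 0"
    unfolding AE_all_countable by (intro allI wpd_zero)
  show ?thesis
    using w0 w
  proof eventually_elim
    case (elim x)
    have "rhs2 (psi0 \<Phi> slow_amp) (psi1 V \<mu> \<Phi> slow_amp) x X1 X2 T2 =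
       - (\<i> * (\<Sum>q\<in>UNIV. vector_derivative (\<lambda>T. C q X1 T) (at T2) * \<Phi> q x) + (\<Sum>r\<in>UNIV. \<Sum>q\<in>UNIV. hess q r r X1 T2 * \<Phi> q x))
       - 2 * (\<Sum>r\<in>UNIV. \<Sum>i\<in>UNIV. 2 * hess (fst i) r (snd i) X1 T2 * wpd r (res_grad (fst i) (snd i)) x)"
      unfolding rhs2_def t z l using elim by simp
    also have "\<i> * (\<Sum>q\<in>UNIV. vector_derivative (\<lambda>T. C q X1 T) (at T2) * \<Phi> q x) +
        (\<Sum>r\<in>UNIV. \<Sum>q\<in>UNIV. hess q r r X1 T2 * \<Phi> q x) = (\<Sum>q\<in>UNIV. drift q X1 T2 * \<Phi> q x)"
      unfolding drift_def distrib_right sum_distrib_right sum.distrib sum_distrib_left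
      by (subst sum.swap) (simp add: mult.assoc)
    also have "(\<Sum>r\<in>UNIV. \<Sum>i\<in>UNIV. 2 * hess (fst i) r (snd i) X1 T2 * wpd r (res_grad (fst i) (snd i)) x) =
       2 * (\<Sum>q\<in>UNIV. \<Sum>r\<in>UNIV. \<Sum>s\<in>UNIV. hess q r s X1 T2 * wpd r (res_grad q s) x)"
    proof -
      have "(\<Sum>i\<in>UNIV. 2 * hess (fst i) r (snd i) X1 T2 * wpd r (res_grad (fst i) (snd i)) x) =
         2 * (\<Sum>q\<in>UNIV. \<Sum>s\<in>UNIV. hess q r s X1 T2 * wpd r (res_grad q s) x)" for r
        by (simp add: sum.cartesian_product case_prod_unfold sum_distrib_left mult_ac)
      then show ?thesis by (simp only: sum_distrib_left[symmetric]) (rule arg_cong[where f = "\<lambda>t. 2 * t"], rule sum.swap)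
    qed
    finally show ?case by (simp add: source_def)
  qed
qed

text \<open>A solution is chosen separately for each X1 and T2 and is constant in X2; the slow
  variables are frozen, so no regularity in them is asked for. The minus sign before
  \<open>source\<close> accounts for passing from \<open>H - \<mu>\<close> to
  \<open>\<mu> - H\<close>.\<close>

lemma amplitudes_solvable: "solvable2 V \<mu> (rhs2 (psi0 \<Phi> slow_amp) (psi1 V \<mu> \<Phi> slow_amp))"
proof -
  define P where "P X1 T2 u \<longleftrightarrow> u \<in> H2_M \<and>
     (AE x in lebesgue. of_real \<mu> * u x - hamiltonian V u x = source X1 T2 x) \<and>
     (\<forall>x. \<forall>v\<in>\<Lambda>. u (x + v) = phase v * u x)" for X1 T2 u
  have "\<exists>u. P X1 T2 u" for X1 T2
  proof -
    have "(\<lambda>x. - source X1 T2 x) \<in> L2_M" by (intro L2_M_uminus source_L2_M)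
    moreover have "inner_M (\<Phi> p) (\<lambda>x. - source X1 T2 x) = 0" for p
      by (simp add: inner_M_uminus_right source_orthogonal)
    ultimately obtain u where u: "\<And>x v. v \<in> \<Lambda> \<Longrightarrow> u (x + v) = phase v * u x" "solves \<mu> u (\<lambda>x. - source X1 T2 x)"
      by (rule orthogonal_solvable) (rule that)
    then have ae: "AE x in lebesgue. hamiltonian V u x - of_real \<mu> * u x = - source X1 T2 x" by (simp add: solves_iff)
    have "AE x in lebesgue. of_real \<mu> * u x - hamiltonian V u x = source X1 T2 x"
      using ae by eventually_elim (metis minus_diff_eq minus_minus)
    with u show ?thesis by (auto simp: solves_iff P_def)
  qed
  then obtain U where "\<And>X1 T2. P X1 T2 (U X1 T2)" by metis
  then have U: "\<And>X1 T2. U X1 T2 \<in> H2_M"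
    "\<And>X1 T2. AE x in lebesgue. of_real \<mu> * U X1 T2 x - hamiltonian V (U X1 T2) x = source X1 T2 x"
    "\<And>X1 T2 x v. v \<in> \<Lambda> \<Longrightarrow> U X1 T2 (x + v) = phase v * U X1 T2 x" by (simp_all add: P_def)
  have "AE x in lebesgue. of_real \<mu> * U X1 T2 x - hamiltonian V (U X1 T2) x = rhs2 (psi0 \<Phi> slow_amp) (psi1 V \<mu> \<Phi> slow_amp) x X1 X2 T2" for X1 X2 T2
    using U(2)[of X1 T2] rhs2_eq_source[of X1 X2 T2] by eventually_elim simp
  with U(1,3) show ?thesis
    unfolding solvable2_def by (intro exI[of _ "\<lambda>x X1 X2 T2. U X1 T2 x"]) (simp add: phase_def)
qed

end

theorem propositionB1:
  fixes V :: "real^2 \<Rightarrow> real" and \<mu>\<^sub>S :: real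
    and \<Phi> :: "2 \<Rightarrow> real^2 \<Rightarrow> complex"
    and C :: "2 \<Rightarrow> real^2 \<Rightarrow> real \<Rightarrow> complex"
  assumes "admissible V"
    and "eigenvalue_of_multiplicity V \<mu>\<^sub>S 2"
    and "\<And>p. \<Phi> p \<in> eigenspace_M V \<mu>\<^sub>S"
    and "\<And>p q. inner_M (\<Phi> p) (\<Phi> q) = (if p = q then 1 else 0)"
    and "\<Phi> 1 \<in> L2_M_rot \<i>"
    and "\<Phi> 2 = (\<lambda>x. cnj (\<Phi> 1 (- x)))"
    and "\<Phi> 2 \<in> L2_M_rot (- \<i>)"
    and "\<And>q. smooth (\<lambda>(X1, T2). C q X1 T2)"
    and "\<And>p X1 T2. \<i> * vector_derivative (\<lambda>T. C p X1 T) (at T2) =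
          - (\<Sum>r\<in>UNIV. pd r (pd r (\<lambda>X. C p X T2)) X1)
          + 4 * (\<Sum>q\<in>UNIV. \<Sum>r\<in>UNIV. \<Sum>s\<in>UNIV.
              a_coeff V \<mu>\<^sub>S \<Phi> p q r s * pd r (pd s (\<lambda>X. C q X T2)) X1)"
  shows "let A = (\<lambda>q X1 X2 T2. C q X1 T2) in
         solvable2 V \<mu>\<^sub>S (rhs2 (psi0 \<Phi> A) (psi1 V \<mu>\<^sub>S \<Phi> A))"
proof -
  interpret amplitudes V \<mu>\<^sub>S \<Phi> C
    by unfold_locales (fact assms)+
  show ?thesis using amplitudes_solvable by (simp add: slow_amp_def)
qed

end
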